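(* Let $A=\mathbb{Z}^n$ with $n\ge1$, let $\varphi\colon A\to A$ be a monomorphism, and let $G=\langle A,t\mid tat^{-1}=\varphi(a),\ a\in A\rangle$. Let $\{0\}=A_0<A_1<\dots<A_l=A$ be the chain of $\varphi$-invariant subgroups obtained from a composition series of $\mathbb{Q}^n$ as described in the context, let $f_i(x)$ $(1\le i\le l)$ be the characteristic polynomial of the endomorphism of $A_i/A_{i-1}\cong\mathbb{Z}^{n_i}$ induced by $\varphi$, and for a prime $p$ and $0\le i<l$ let $$K_{p,i}=\{a\in A\mid \varphi^j(a)\in A_i+pA\text{ for some } j\ge 0\}.$$ The following are equivalent: (1) $G$ is cyclic subgroup separable. (2) There is no prime $p$ and $0\le i<l$ with $A_{i+1}\subseteq K_{p,i}$. (3) There is no prime $p$ and $1\le i\le l$ with $f_i(x)\equiv x^{n_i}\pmod p$.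
   Context: A subgroup of a group $G$ is separable in $G$ if it is an intersection of finite-index subgroups of $G$. A group is cyclic subgroup separable if every cyclic subgroup is separable. View $A=\mathbb{Z}^n\subset\mathbb{Q}^n$, and let $\varphi_{\mathbb{Q}}\colon\mathbb{Q}^n\to\mathbb{Q}^n$ be the $\mathbb{Q}$-linear map induced by $\varphi$. Fix a composition series $\{0\}=V_0\le V_1\le\dots\le V_l=\mathbb{Q}^n$ of $\mathbb{Q}^n$ as a $\mathbb{Q}[\varphi_{\mathbb{Q}}]$-module, i.e. the $V_i$ are distinct $\varphi_{\mathbb{Q}}$-invariant subspaces such that there is no $\varphi_{\mathbb{Q}}$-invariant subspace $V$ with $V_i\lneq V\lneq V_{i+1}$ for any $0\le i<l$. Put $A_i=V_i\cap A$. Each $A_i$ is a $\varphi$-invariant subgroup of $A$, and $A_i/A_{i-1}$ is torsion-free, of rank denoted $n_i$. For an integer $m$, $mA=\{ma\mid a\in A\}$ (additive notation in $A$). The $f_i(x)$ are monic integer polynomials of degree $n_i$. *)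

theory Defs
  imports
    "HOL-Algebra.Generated_Groups"
    "HOL-Number_Theory.Cong"
    "Jordan_Normal_Form.Char_Poly"
    "Jordan_Normal_Form.VS_Connect"
begin

section \<open>Separability\<close>

definition finite_index_subgroup :: "'a set \<Rightarrow> ('a, 'b) monoid_scheme \<Rightarrow> bool" where
  "finite_index_subgroup H G \<longleftrightarrow> subgroup H G \<and> finite (rcosets\<^bsub>G\<^esub> H)"

text \<open>The family is required to be nonempty because \<open>\<Inter>{}\<close> is \<open>UNIV\<close>; nothing is lost, since
  the carrier itself is a subgroup of index one.\<close>

definition separable_subgroup :: "'a set \<Rightarrow> ('a, 'b) monoid_scheme \<Rightarrow> bool" where
  "separable_subgroup H G \<longleftrightarrow>
     (\<exists>\<F>. \<F> \<noteq> {} \<and> (\<forall>K\<in>\<F>. finite_index_subgroup K G) \<and> H = \<Inter>\<F>)"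

definition cyclic_subgroup_separable :: "('a, 'b) monoid_scheme \<Rightarrow> bool" where
  "cyclic_subgroup_separable G \<longleftrightarrow> (\<forall>g\<in>carrier G. separable_subgroup (generate G {g}) G)"

section \<open>Group presentations\<close>

text \<open>Words over generators and formal inverses: the letter \<open>(g, True)\<close> stands for \<open>g\<close> and
  \<open>(g, False)\<close> for \<open>g\<inverse>\<close>.\<close>

type_synonym 'g word = "('g \<times> bool) list"

inductive pres_eq :: "'g set \<Rightarrow> ('g word \<times> 'g word) set \<Rightarrow> 'g word \<Rightarrow> 'g word \<Rightarrow> bool"
  for S :: "'g set" and R :: "('g word \<times> 'g word) set" where
  relator: "(u, v) \<in> R \<Longrightarrow> pres_eq S R u v"
| cancel: "g \<in> S \<Longrightarrow> pres_eq S R [(g, b), (g, \<not> b)] []"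
| refl: "w \<in> lists (S \<times> UNIV) \<Longrightarrow> pres_eq S R w w"
| sym: "pres_eq S R u v \<Longrightarrow> pres_eq S R v u"
| trans: "pres_eq S R u v \<Longrightarrow> pres_eq S R v w \<Longrightarrow> pres_eq S R u w"
| append: "pres_eq S R u v \<Longrightarrow> pres_eq S R u' v' \<Longrightarrow> pres_eq S R (u @ u') (v @ v')"

definition word_class :: "'g set \<Rightarrow> ('g word \<times> 'g word) set \<Rightarrow> 'g word \<Rightarrow> 'g word set" where
  "word_class S R w = {v. pres_eq S R w v}"

definition presented_group :: "'g set \<Rightarrow> ('g word \<times> 'g word) set \<Rightarrow> 'g word set monoid" where
  "presented_group S R =
     \<lparr>carrier = word_class S R ` lists (S \<times> UNIV),
      monoid.mult = (\<lambda>C D. \<Union>u\<in>C. \<Union>v\<in>D. word_class S R (u @ v)),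
      one = word_class S R []\<rparr>"

section \<open>The ascending HNN extension\<close>

datatype 'a hnn_gen = Base 'a | Stable

text \<open>As usual for HNN extensions, the relations that hold in the base group are part of the
  presentation \<open>\<langle>A, t | t a t\<inverse> = \<phi> a, a \<in> A\<rangle>\<close>; here they are given by the
  multiplication table of \<open>A\<close>.\<close>

definition hnn_gens :: "('a, 'b) monoid_scheme \<Rightarrow> 'a hnn_gen set" where
  "hnn_gens A = insert Stable (Base ` carrier A)"

definition hnn_rels ::
  "('a, 'b) monoid_scheme \<Rightarrow> ('a \<Rightarrow> 'a) \<Rightarrow> ('a hnn_gen word \<times> 'a hnn_gen word) set" where
  "hnn_rels A \<phi> =
     {([(Base a, True), (Base b, True)], [(Base (a \<otimes>\<^bsub>A\<^esub> b), True)])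
        | a b. a \<in> carrier A \<and> b \<in> carrier A}
   \<union> {([(Stable, True), (Base a, True), (Stable, False)], [(Base (\<phi> a), True)])
        | a. a \<in> carrier A}"

definition ascending_HNN ::
  "('a, 'b) monoid_scheme \<Rightarrow> ('a \<Rightarrow> 'a) \<Rightarrow> 'a hnn_gen word set monoid" where
  "ascending_HNN A \<phi> = presented_group (hnn_gens A) (hnn_rels A \<phi>)"

section \<open>The lattice and its rational composition series\<close>

abbreviation Zn :: "nat \<Rightarrow> int vec monoid" where
  "Zn n \<equiv> monoid_vec TYPE(int) n"

definition rat_extension :: "nat \<Rightarrow> (int vec \<Rightarrow> int vec) \<Rightarrow> rat vec \<Rightarrow> rat vec" where
  "rat_extension n \<phi> v = mat n n (\<lambda>(i, j). rat_of_int (\<phi> (unit_vec n j) $ i)) *\<^sub>v v"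

definition invariant_subspace :: "nat \<Rightarrow> (rat vec \<Rightarrow> rat vec) \<Rightarrow> rat vec set \<Rightarrow> bool" where
  "invariant_subspace n T W \<longleftrightarrow>
     VectorSpace.subspace class_ring W (module_vec TYPE(rat) n) \<and> T ` W \<subseteq> W"

definition composition_series ::
  "nat \<Rightarrow> (rat vec \<Rightarrow> rat vec) \<Rightarrow> (nat \<Rightarrow> rat vec set) \<Rightarrow> nat \<Rightarrow> bool" where
  "composition_series n T V l \<longleftrightarrow>
     V 0 = {0\<^sub>v n} \<and> V l = carrier_vec n \<and>
     (\<forall>i\<le>l. invariant_subspace n T (V i)) \<and>
     (\<forall>i<l. V i \<subset> V (Suc i) \<and>
        \<not> (\<exists>W. invariant_subspace n T W \<and> V i \<subset> W \<and> W \<subset> V (Suc i)))"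

definition lattice_part :: "nat \<Rightarrow> rat vec set \<Rightarrow> int vec set" where
  "lattice_part n W = {a \<in> carrier_vec n. map_vec rat_of_int a \<in> W}"

text \<open>The set \<open>K\<^bsub>p,i\<^esub>\<close>, with the subgroup \<open>A\<^sub>i\<close> passed as \<open>B\<close>.\<close>

definition K_set :: "nat \<Rightarrow> (int vec \<Rightarrow> int vec) \<Rightarrow> nat \<Rightarrow> int vec set \<Rightarrow> int vec set" where
  "K_set n \<phi> p B =
     {a \<in> carrier_vec n. \<exists>j. \<exists>b\<in>B. \<exists>c\<in>carrier_vec n. (\<phi> ^^ j) a = b + int p \<cdot>\<^sub>v c}"

section \<open>Characteristic polynomials on quotients\<close>

definition quotient_group ::
  "('a, 'b) monoid_scheme \<Rightarrow> 'a set \<Rightarrow> 'a set \<Rightarrow> 'a set monoid" where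
  "quotient_group A H N = (A\<lparr>carrier := H\<rparr>) Mod N"

text \<open>The map \<open>N a \<mapsto> N \<phi>(a)\<close> on cosets of \<open>N\<close>; when \<open>\<phi>\<close> preserves \<open>N\<close>, all members of the
  union coincide.\<close>

definition quotient_endo ::
  "('a, 'b) monoid_scheme \<Rightarrow> 'a set \<Rightarrow> ('a \<Rightarrow> 'a) \<Rightarrow> 'a set \<Rightarrow> 'a set" where
  "quotient_endo A N \<phi> C = (\<Union>a\<in>C. N #>\<^bsub>A\<^esub> \<phi> a)"

definition free_rank :: "('a, 'b) monoid_scheme \<Rightarrow> nat" where
  "free_rank Q = (THE m. Q \<cong> Zn m)"

definition represents_endo ::
  "('a, 'b) monoid_scheme \<Rightarrow> ('a \<Rightarrow> 'a) \<Rightarrow> nat \<Rightarrow> int mat \<Rightarrow> bool" where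
  "represents_endo Q \<psi> m M \<longleftrightarrow>
     M \<in> carrier_mat m m \<and> (\<exists>h \<in> iso Q (Zn m). \<forall>x\<in>carrier Q. h (\<psi> x) = M *\<^sub>v h x)"

text \<open>The characteristic polynomial of an endomorphism of a group isomorphic to some \<open>\<int>\<^sup>m\<close>,
  computed from its matrix in any basis.\<close>

definition endo_char_poly :: "('a, 'b) monoid_scheme \<Rightarrow> ('a \<Rightarrow> 'a) \<Rightarrow> int poly" where
  "endo_char_poly Q \<psi> = (THE f. \<exists>m M. represents_endo Q \<psi> m M \<and> f = char_poly M)"

definition poly_cong :: "int poly \<Rightarrow> int poly \<Rightarrow> int \<Rightarrow> bool" where
  "poly_cong f g m \<longleftrightarrow> (\<forall>k. [coeff f k = coeff g k] (mod m))"

section \<open>Basic facts\<close>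

lemma pres_eq_words:
  assumes "R \<subseteq> lists (S \<times> UNIV) \<times> lists (S \<times> UNIV)" "pres_eq S R u v"
  shows "u \<in> lists (S \<times> UNIV) \<and> v \<in> lists (S \<times> UNIV)"
  using assms(2,1) by (induction rule: pres_eq.induct) auto

lemma word_class_eqI: "pres_eq S R u v \<Longrightarrow> word_class S R u = word_class S R v"
  unfolding word_class_def using pres_eq.trans[of S R u v] pres_eq.trans[of S R v u]
  by (auto dest: pres_eq.sym[of S R u v])

lemma presented_group_mult:
  assumes "u \<in> lists (S \<times> UNIV)" "v \<in> lists (S \<times> UNIV)"
  shows "word_class S R u \<otimes>\<^bsub>presented_group S R\<^esub> word_class S R v = word_class S R (u @ v)"
proof -
  have eq: "word_class S R (u' @ v') = word_class S R (u @ v)"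
    if "u' \<in> word_class S R u" "v' \<in> word_class S R v" for u' v'
    using word_class_eqI[OF pres_eq.append, of S R u u' v v'] that
    by (simp add: word_class_def)
  have mem: "u \<in> word_class S R u" "v \<in> word_class S R v"
    using assms by (simp_all add: word_class_def pres_eq.refl)
  have "(\<Union>u'\<in>word_class S R u. \<Union>v'\<in>word_class S R v. word_class S R (u' @ v'))
      = (\<Union>u'\<in>word_class S R u. \<Union>v'\<in>word_class S R v. word_class S R (u @ v))"
    by (intro SUP_cong HOL.refl eq)
  also have "\<dots> = word_class S R (u @ v)" using mem by blast
  finally show ?thesis by (simp add: presented_group_def)
qed

lemma pres_eq_inverse:
  assumes "w \<in> lists (S \<times> UNIV)"
  shows "pres_eq S R (map (\<lambda>(g, b). (g, \<not> b)) (rev w) @ w) []"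
  using assms
proof (induction w)
  case Nil
  show ?case by (simp add: pres_eq.refl)
next
  case (Cons x w)
  obtain g b where x: "x = (g, b)" by force
  let ?w' = "map (\<lambda>(g, b). (g, \<not> b)) (rev w)"
  have w: "w \<in> lists (S \<times> UNIV)" and g: "g \<in> S" using Cons.hyps x by auto
  have w': "?w' \<in> lists (S \<times> UNIV)" using w by (auto simp: in_lists_conv_set)
  have "pres_eq S R ([(g, \<not> b), (g, b)] @ w) ([] @ w)"
    using pres_eq.cancel[OF g, of R "\<not> b"] w by (intro pres_eq.append pres_eq.refl) auto
  then have "pres_eq S R (?w' @ [(g, \<not> b), (g, b)] @ w) (?w' @ w)"
    using pres_eq.append[OF pres_eq.refl[OF w']] by simp
  then have "pres_eq S R (?w' @ [(g, \<not> b), (g, b)] @ w) []"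
    using Cons.IH by (rule pres_eq.trans)
  then show ?case by (simp add: x)
qed

lemma presented_group_is_group: "group (presented_group S R)"
proof (rule groupI)
  fix x y z
  assume "x \<in> carrier (presented_group S R)" "y \<in> carrier (presented_group S R)"
    "z \<in> carrier (presented_group S R)"
  then obtain u v w where
    "u \<in> lists (S \<times> UNIV)" "v \<in> lists (S \<times> UNIV)" "w \<in> lists (S \<times> UNIV)"
    "x = word_class S R u" "y = word_class S R v" "z = word_class S R w"
    unfolding presented_group_def by (auto simp only: partial_object.simps)
  then show "x \<otimes>\<^bsub>presented_group S R\<^esub> y \<otimes>\<^bsub>presented_group S R\<^esub> z =
      x \<otimes>\<^bsub>presented_group S R\<^esub> (y \<otimes>\<^bsub>presented_group S R\<^esub> z)"
    by (simp add: presented_group_mult)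
next
  fix x y
  assume "x \<in> carrier (presented_group S R)" "y \<in> carrier (presented_group S R)"
  then obtain u v where uv: "u \<in> lists (S \<times> UNIV)" "v \<in> lists (S \<times> UNIV)"
    "x = word_class S R u" "y = word_class S R v"
    unfolding presented_group_def by (auto simp only: partial_object.simps)
  have "word_class S R (u @ v) \<in> carrier (presented_group S R)"
    using uv by (simp add: presented_group_def)
  then show "x \<otimes>\<^bsub>presented_group S R\<^esub> y \<in> carrier (presented_group S R)"
    using uv by (simp add: presented_group_mult)
next
  show one: "\<one>\<^bsub>presented_group S R\<^esub> \<in> carrier (presented_group S R)"
    by (simp add: presented_group_def)
  have one_eq: "\<one>\<^bsub>presented_group S R\<^esub> = word_class S R []"
    by (simp add: presented_group_def)
  fix x
  assume "x \<in> carrier (presented_group S R)"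
  then obtain u where u: "u \<in> lists (S \<times> UNIV)" "x = word_class S R u"
    unfolding presented_group_def by (auto simp only: partial_object.simps)
  show "\<one>\<^bsub>presented_group S R\<^esub> \<otimes>\<^bsub>presented_group S R\<^esub> x = x"
    using u presented_group_mult[of "[]" S u R] by (simp add: one_eq)
  let ?u' = "map (\<lambda>(g, b). (g, \<not> b)) (rev u)"
  have u': "?u' \<in> lists (S \<times> UNIV)" using u(1) by (auto simp: in_lists_conv_set)
  have "word_class S R ?u' \<otimes>\<^bsub>presented_group S R\<^esub> x = \<one>\<^bsub>presented_group S R\<^esub>"
    using u presented_group_mult[OF u' u(1), of R] word_class_eqI[OF pres_eq_inverse[OF u(1)]]
    by (simp add: one_eq)
  moreover have "word_class S R ?u' \<in> carrier (presented_group S R)"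
    using u' by (simp add: presented_group_def)
  ultimately show "\<exists>y\<in>carrier (presented_group S R).
      y \<otimes>\<^bsub>presented_group S R\<^esub> x = \<one>\<^bsub>presented_group S R\<^esub>" by blast
qed

end

theory Submission
  imports Defs "HOL-Algebra.Bij" "HOL-Algebra.Zassenhaus"
begin

text \<open>The ascending HNN extension is \<open>B \<rtimes> \<int>\<close>, where \<open>B\<close> is the union of the lattices
  \<open>\<phi>\<^sup>-\<^sup>j(A)\<close> in \<open>\<rat>\<^sup>n\<close>. All three conditions are compared with the subgroups \<open>E\<^sub>p\<close> of those
  \<open>a \<in> A\<close> for which the vectors \<open>\<phi>\<^sup>j(a)\<close> become divisible by arbitrarily high powers of \<open>p\<close>.

  Let \<open>0 \<noteq> a \<in> E\<^sub>p\<close>, let \<open>H\<close> be a subgroup of finite index that contains \<open>p a\<close>, and choose \<open>e = p\<^sup>k e'\<close>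
  with \<open>p\<close> not dividing \<open>e'\<close> such that \<open>H\<close> contains all \<open>e\<close>-th powers. Two of the vectors \<open>\<phi>\<^sup>e\<^sup>i(a)\<close> agree
  modulo \<open>H\<close>, so \<open>a\<close> is congruent modulo \<open>H\<close> to elements of \<open>p\<^sup>k B\<close>. Hence \<open>e' a \<in> H\<close> and therefore
  \<open>a \<in> H\<close>, so \<open>\<langle>p a\<rangle>\<close> is not separable. If instead all \<open>E\<^sub>p\<close> vanish, then \<open>\<int> v\<close> is the intersection of
  the subgroups \<open>\<int> v + N B\<close> for each \<open>v \<in> B\<close>, and these give rise to subgroups of finite index because
  \<open>B / N B\<close> is finite. For \<open>g \<notin> B\<close> the finite-index subgroups \<open>N B \<langle>g\<rangle>\<close> separate \<open>\<langle>g\<rangle>\<close>.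

  The span of \<open>E\<^sub>p\<close> is an invariant subspace of \<open>\<rat>\<^sup>n\<close>, so if it is nonzero it covers some
  layer \<open>V\<^sub>i\<^sub>+\<^sub>1 / V\<^sub>i\<close> of the composition series, whence \<open>A\<^sub>i\<^sub>+\<^sub>1 \<subseteq> K\<^sub>p\<^sub>,\<^sub>i\<close>. In that case \<open>\<phi>\<close> acts
  nilpotently modulo \<open>p\<close> on \<open>A\<^sub>i\<^sub>+\<^sub>1 / A\<^sub>i\<close>, and its characteristic polynomial is
  congruent to a power of \<open>x\<close>. Conversely, if \<open>f\<^sub>i = x\<^sup>m + p g\<close>, then \<open>f\<^sub>i(\<phi>)\<close> maps \<open>A\<^sub>i\<close> into
  \<open>A\<^sub>i\<^sub>-\<^sub>1\<close> by Cayley--Hamilton and so has a nonzero kernel. On this kernel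
  \<open>\<phi>\<^sup>m = - p g(\<phi>)\<close>, so it lies in \<open>E\<^sub>p\<close>.\<close>

section \<open>Separability and presentations\<close>

text \<open>Passing from A to B makes the stable letter act by an invertible map, so that every N B
  is invariant under it. The price is that B is in general not finitely generated, and the
  finiteness of B / N B needs an argument: the orbit of a vector of A is eventually periodic modulo
  N, the preperiod can be undone modulo N B, and so each element of B is congruent to one of its own
  images that lie in A.

  Only primes dividing det \<phi> can do harm: for N prime to det \<phi>, divisibility of
  \<phi>^j(x) by N already gives divisibility of x. Hence vectors off the line of v are separated
  from Z v by a modulus prime to det \<phi>, and the condition on E_p enters only for multiples
  (r/s) v, with p a prime divisor of s. This is also why p a is the bad element in the converse: a
  is the multiple 1/p of it.

  Rank and characteristic polynomial of a layer are definite descriptions, so they must be shown to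
  be independent of the basis.\<close>

lemma finite_index_subgroup_carrier:
  assumes "group G" shows "finite_index_subgroup (carrier G) G"
proof -
  interpret group G by fact
  have "rcosets\<^bsub>G\<^esub> (carrier G) \<subseteq> {carrier G}"
    using rcosets_part_G[OF subgroup_self] coset_join2 subgroup_self by (auto simp: RCOSETS_def)
  then show ?thesis
    unfolding finite_index_subgroup_def using subgroup_self finite_subset by blast
qed

text \<open>The largest candidate family, all finite-index subgroups containing \<open>H\<close>,
  decides the question, and the carrier makes it nonempty. Separability becomes a task for one
  element outside \<open>H\<close> at a time.\<close>

lemma separable_subgroup_iff:
  assumes "group G" "subgroup H G"
  shows "separable_subgroup H G \<longleftrightarrow>
    (\<forall>x\<in>carrier G - H. \<exists>K. finite_index_subgroup K G \<and> H \<subseteq> K \<and> x \<notin> K)"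
proof
  assume "separable_subgroup H G"
  then show "\<forall>x\<in>carrier G - H. \<exists>K. finite_index_subgroup K G \<and> H \<subseteq> K \<and> x \<notin> K"
    unfolding separable_subgroup_def by blast
next
  assume sep: "\<forall>x\<in>carrier G - H. \<exists>K. finite_index_subgroup K G \<and> H \<subseteq> K \<and> x \<notin> K"
  have HG: "H \<subseteq> carrier G" using assms(2) by (rule subgroup.subset)
  let ?F = "{K. finite_index_subgroup K G \<and> H \<subseteq> K}"
  have car: "carrier G \<in> ?F" using finite_index_subgroup_carrier[OF assms(1)] HG by simp
  have "\<Inter>?F \<subseteq> H"
  proof
    fix x assume x: "x \<in> \<Inter>?F"
    then have "x \<in> carrier G" using car by blast
    then show "x \<in> H" using x sep by blast
  qed
  then have "H = \<Inter>?F" by blast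
  moreover have "?F \<noteq> {}" using car by blast
  ultimately show "separable_subgroup H G"
    unfolding separable_subgroup_def by (intro exI[of _ ?F]) simp
qed

lemma finite_index_subgroup_image:
  assumes iso: "h \<in> iso G G'" and G: "group G" "group G'" and H: "finite_index_subgroup H G"
  shows "finite_index_subgroup (h ` H) G'"
proof -
  interpret group_hom G G' h
    using iso G by (simp add: group_hom_def group_hom_axioms_def iso_def)
  have sub: "subgroup H G" and fin: "finite (rcosets\<^bsub>G\<^esub> H)"
    using H by (simp_all add: finite_index_subgroup_def)
  have onto: "h ` carrier G = carrier G'"
    using iso by (simp add: iso_def bij_betw_def)
  have coset: "h ` H #>\<^bsub>G'\<^esub> h x = h ` (H #>\<^bsub>G\<^esub> x)" if "x \<in> carrier G" for x
  proof -
    have "h (y \<otimes>\<^bsub>G\<^esub> x) = h y \<otimes>\<^bsub>G'\<^esub> h x" if "y \<in> H" for y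
      using that \<open>x \<in> carrier G\<close> subgroup.mem_carrier[OF sub] by simp
    then show ?thesis unfolding r_coset_def by force
  qed
  have "rcosets\<^bsub>G'\<^esub> (h ` H) \<subseteq> (`) h ` (rcosets\<^bsub>G\<^esub> H)"
    unfolding RCOSETS_def using coset onto[symmetric] by auto
  then show ?thesis
    unfolding finite_index_subgroup_def
    using subgroup_img_is_subgroup[OF sub] fin finite_subset by blast
qed

lemma cyclic_subgroup_separable_iso:
  assumes "G \<cong> G'" "group G" "group G'" "cyclic_subgroup_separable G"
  shows "cyclic_subgroup_separable G'"
  unfolding cyclic_subgroup_separable_def
proof
  obtain h where iso: "h \<in> iso G G'" using assms(1) by (auto simp: is_iso_def)
  interpret group_hom G G' h
    using iso assms by (simp add: group_hom_def group_hom_axioms_def iso_def)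
  have onto: "h ` carrier G = carrier G'" and inj: "inj_on h (carrier G)"
    using iso by (simp_all add: iso_def bij_betw_def)
  fix g' assume "g' \<in> carrier G'"
  then obtain g where g: "g \<in> carrier G" "g' = h g" using onto by blast
  have gen: "generate G' {g'} = h ` generate G {g}"
    using generate_img[of "{g}"] g by simp
  have sub: "subgroup (generate G {g}) G" "subgroup (generate G' {g'}) G'"
    using g \<open>g' \<in> carrier G'\<close> G.generate_is_subgroup[of "{g}"] H.generate_is_subgroup[of "{g'}"]
    by auto
  have sep: "\<forall>x\<in>carrier G - generate G {g}.
      \<exists>K. finite_index_subgroup K G \<and> generate G {g} \<subseteq> K \<and> x \<notin> K"
    using assms(4) g(1) separable_subgroup_iff[OF assms(2) sub(1)]
    unfolding cyclic_subgroup_separable_def by blast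
  show "separable_subgroup (generate G' {g'}) G'"
    unfolding separable_subgroup_iff[OF assms(3) sub(2)]
  proof
    fix x' assume x': "x' \<in> carrier G' - generate G' {g'}"
    then obtain x where x: "x \<in> carrier G" "x' = h x" using onto by blast
    then have "x \<notin> generate G {g}" using x' gen by auto
    then obtain K where K: "finite_index_subgroup K G" "generate G {g} \<subseteq> K" "x \<notin> K"
      using sep x by blast
    have "K \<subseteq> carrier G" using K(1) subgroup.subset finite_index_subgroup_def by blast
    then have "x' \<notin> h ` K" using K(3) x inj by (auto dest: inj_onD)
    then show "\<exists>K. finite_index_subgroup K G' \<and> generate G' {g'} \<subseteq> K \<and> x' \<notin> K"
      using finite_index_subgroup_image[OF iso assms(2,3) K(1)] K(2) gen by blast
  qed
qed

text \<open>One more element than there are cosets. The bound on \<open>j\<close> keeps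
  \<open>j - i\<close> bounded independently of the sequence, which is what yields a uniform
  exponent below.\<close>

lemma finite_index_subgroup_pigeonhole:
  fixes G (structure) and x :: "nat \<Rightarrow> 'a"
  assumes "group G" "finite_index_subgroup H G" "\<And>j. x j \<in> carrier G"
  obtains i j where "i < j" "j \<le> card (rcosets\<^bsub>G\<^esub> H)" "x j \<otimes>\<^bsub>G\<^esub> inv\<^bsub>G\<^esub> x i \<in> H"
proof -
  interpret group G by fact
  have sub: "subgroup H G" and fin: "finite (rcosets H)"
    using assms(2) by (simp_all add: finite_index_subgroup_def)
  let ?k = "card (rcosets H)"
  have "(\<lambda>j. H #> x j) ` {..?k} \<subseteq> rcosets H"
    using assms(3) sub by (auto intro: rcosetsI[OF subgroup.subset])
  then have "card ((\<lambda>j. H #> x j) ` {..?k}) < card {..?k}"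
    using card_mono[OF fin] by (simp add: less_Suc_eq_le)
  then have "\<not> inj_on (\<lambda>j. H #> x j) {..?k}" using pigeonhole by blast
  then obtain i j where ij: "i \<le> ?k" "j \<le> ?k" "i < j" "H #> x i = H #> x j"
    unfolding inj_on_def by (metis atMost_iff linorder_neqE_nat)
  have "x j \<in> H #> x i" using ij(4) rcos_self[OF assms(3) sub, of j] by simp
  then have "x j \<otimes> inv x i \<in> H"
    using subgroup.rcos_module_imp[OF sub is_group] assms(3) by blast
  then show ?thesis using that ij by blast
qed

text \<open>\<open>H\<close> need not be normal, so there is no quotient group whose order could
  serve. For each \<open>g\<close> some power with exponent \<open>j - i\<close>, at most the index,
  lies in \<open>H\<close>, and the factorial of the index is a multiple of all these
  exponents.\<close>

lemma finite_index_subgroup_exponent: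
  fixes G (structure)
  assumes "group G" "finite_index_subgroup H G"
  shows "\<exists>e > 0. \<forall>g\<in>carrier G. g [^] (e :: nat) \<in> H"
proof (intro exI conjI ballI)
  interpret group G by fact
  have sub: "subgroup H G" using assms(2) by (simp add: finite_index_subgroup_def)
  let ?k = "card (rcosets H)"
  show "(fact ?k :: nat) > 0" by simp
  fix g assume g: "g \<in> carrier G"
  obtain i j where ij: "i < j" "j \<le> ?k" "g [^] j \<otimes> inv (g [^] i) \<in> H"
    using finite_index_subgroup_pigeonhole[OF assms, of "\<lambda>j. g [^] j"] g by auto
  have "g [^] j \<otimes> inv (g [^] i) = g [^] (j - i)"
    using g ij(1) nat_pow_mult[OF g, of "j - i" i] by (simp add: inv_solve_right')
  then have mem: "g [^] (j - i) \<in> H" using ij(3) by simp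
  have "j - i dvd fact ?k" using ij by (intro dvd_fact) auto
  then obtain c where "fact ?k = (j - i) * c" by blast
  then have "g [^] (fact ?k :: nat) = (g [^] (j - i)) [^] c" using g by (simp add: nat_pow_pow)
  moreover have "(g [^] (j - i)) [^] c \<in> H"
    using subgroup.one_closed[OF sub] subgroup.m_closed[OF sub _ mem] by (induction c) auto
  ultimately show "g [^] (fact ?k :: nat) \<in> H" by simp
qed

lemma finite_index_subgroupI:
  fixes G (structure)
  assumes "group G" "subgroup H G" "finite F" "F \<subseteq> carrier G"
    and cover: "\<And>x. x \<in> carrier G \<Longrightarrow> \<exists>f\<in>F. x \<otimes>\<^bsub>G\<^esub> inv\<^bsub>G\<^esub> f \<in> H"
  shows "finite_index_subgroup H G"
proof -
  interpret group G by fact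
  have "H #> x \<in> (\<lambda>f. H #> f) ` F" if x: "x \<in> carrier G" for x
  proof -
    obtain f where f: "f \<in> F" "x \<otimes> inv f \<in> H" using cover x by blast
    then have "x \<in> H #> f"
      using subgroup.rcos_module_rev[OF assms(2) is_group] x assms(4) by blast
    then have "H #> f = H #> x" using repr_independence[OF _ _ assms(2)] f assms(4) by blast
    then show ?thesis using f by blast
  qed
  then have "rcosets H \<subseteq> (\<lambda>f. H #> f) ` F" by (auto simp: RCOSETS_def)
  then show ?thesis
    unfolding finite_index_subgroup_def using assms(2,3) finite_subset by blast
qed

section \<open>The universal property of a presentation\<close>

definition eval_word :: "('b, 'c) monoid_scheme \<Rightarrow> ('g \<Rightarrow> 'b) \<Rightarrow> 'g word \<Rightarrow> 'b" where
  "eval_word K f w =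
     foldr (\<lambda>(g, b) y. (if b then f g else inv\<^bsub>K\<^esub> f g) \<otimes>\<^bsub>K\<^esub> y) w \<one>\<^bsub>K\<^esub>"

lemma eval_word_simps [simp]:
  "eval_word K f [] = \<one>\<^bsub>K\<^esub>"
  "eval_word K f ((g, b) # w) = (if b then f g else inv\<^bsub>K\<^esub> f g) \<otimes>\<^bsub>K\<^esub> eval_word K f w"
  by (simp_all add: eval_word_def)

lemma eval_word_closed:
  assumes "group K" "f \<in> S \<rightarrow> carrier K" "w \<in> lists (S \<times> UNIV)"
  shows "eval_word K f w \<in> carrier K"
proof -
  interpret group K by fact
  show ?thesis using assms(3)
  proof (induction rule: lists.induct)
    case (Cons x w)
    obtain g b where x: "x = (g, b)" by force
    then have "f g \<in> carrier K" using Cons.hyps assms(2) by auto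
    then show ?case using Cons.IH by (simp add: x)
  qed simp
qed

lemma eval_word_append:
  assumes "group K" "f \<in> S \<rightarrow> carrier K" "u \<in> lists (S \<times> UNIV)" "v \<in> lists (S \<times> UNIV)"
  shows "eval_word K f (u @ v) = eval_word K f u \<otimes>\<^bsub>K\<^esub> eval_word K f v"
proof -
  interpret group K by fact
  have v: "eval_word K f v \<in> carrier K" by (rule eval_word_closed[OF assms(1,2,4)])
  show ?thesis using assms(3)
  proof (induction rule: lists.induct)
    case (Cons x u)
    obtain g b where x: "x = (g, b)" by force
    then have "f g \<in> carrier K" using Cons.hyps assms(2) by auto
    then show ?case
      using Cons v eval_word_closed[OF assms(1,2) Cons.hyps(2)] by (simp add: x m_assoc)
  qed (simp add: v)
qed

lemma eval_word_pres_eq: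
  assumes K: "group K" and f: "f \<in> S \<rightarrow> carrier K"
    and R: "R \<subseteq> lists (S \<times> UNIV) \<times> lists (S \<times> UNIV)"
    and rels: "\<And>u v. (u, v) \<in> R \<Longrightarrow> eval_word K f u = eval_word K f v"
    and eq: "pres_eq S R u v"
  shows "eval_word K f u = eval_word K f v"
proof -
  interpret group K by fact
  show ?thesis using eq
  proof (induction rule: pres_eq.induct)
    case (cancel g b)
    then have "f g \<in> carrier K" using f by blast
    then show ?case by simp
  next
    case (append u v u' v')
    then show ?case
      using pres_eq_words[OF R append.hyps(1)] pres_eq_words[OF R append.hyps(2)]
      by (simp only: eval_word_append[OF K f])
  qed (simp_all add: rels)
qed

text \<open>Von Dyck's theorem. The image of a class is read off from a chosen representative, and
  \<open>eval_word_pres_eq\<close> makes the choice irrelevant.\<close>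

lemma presented_group_hom:
  assumes K: "group K" and f: "f \<in> S \<rightarrow> carrier K"
    and R: "R \<subseteq> lists (S \<times> UNIV) \<times> lists (S \<times> UNIV)"
    and rels: "\<And>u v. (u, v) \<in> R \<Longrightarrow> eval_word K f u = eval_word K f v"
  obtains F where "F \<in> hom (presented_group S R) K"
    "\<And>w. w \<in> lists (S \<times> UNIV) \<Longrightarrow> F (word_class S R w) = eval_word K f w"
proof
  define F where "F C = eval_word K f (SOME w. w \<in> C)" for C
  show F: "F (word_class S R w) = eval_word K f w" if "w \<in> lists (S \<times> UNIV)" for w
  proof -
    have "w \<in> word_class S R w" using that by (simp add: word_class_def pres_eq.refl)
    then have "(SOME u. u \<in> word_class S R w) \<in> word_class S R w" by (rule someI)
    then show ?thesis
      unfolding F_def word_class_def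
      using eval_word_pres_eq[OF K f R rels, of w] by simp
  qed
  have car: "carrier (presented_group S R) = word_class S R ` lists (S \<times> UNIV)"
    by (simp add: presented_group_def)
  show "F \<in> hom (presented_group S R) K"
  proof (rule homI)
    fix x assume "x \<in> carrier (presented_group S R)"
    then show "F x \<in> carrier K" unfolding car using F eval_word_closed[OF K f] by fastforce
  next
    fix x y assume "x \<in> carrier (presented_group S R)" "y \<in> carrier (presented_group S R)"
    then obtain u v where uv: "u \<in> lists (S \<times> UNIV)" "v \<in> lists (S \<times> UNIV)"
      "x = word_class S R u" "y = word_class S R v" unfolding car by blast
    moreover have "u @ v \<in> lists (S \<times> UNIV)" using uv(1,2) by (simp only: append_in_lists_conv)
    ultimately show "F (x \<otimes>\<^bsub>presented_group S R\<^esub> y) = F x \<otimes>\<^bsub>K\<^esub> F y"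
      by (simp only: presented_group_mult F eval_word_append[OF K f])
  qed
qed

section \<open>Subgroups and homomorphisms of free abelian groups\<close>

lemma inv_monoid_vec:
  fixes x :: "'a :: ab_group_add vec"
  assumes "x \<in> carrier_vec n"
  shows "inv\<^bsub>monoid_vec TYPE('a) n\<^esub> x = - x"
proof -
  interpret comm_group "monoid_vec TYPE('a) n" by (rule comm_group_vec)
  show ?thesis by (rule inv_equality) (use assms in \<open>auto simp: monoid_vec_simps\<close>)
qed

lemma subgroup_monoid_vec_iff:
  fixes N :: "'a :: ab_group_add vec set"
  shows "subgroup N (monoid_vec TYPE('a) n) \<longleftrightarrow>
    N \<subseteq> carrier_vec n \<and> 0\<^sub>v n \<in> N \<and> (\<forall>x\<in>N. \<forall>y\<in>N. x + y \<in> N) \<and> (\<forall>x\<in>N. - x \<in> N)"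
  unfolding subgroup_def using inv_monoid_vec[where 'a = 'a]
  by (auto simp: monoid_vec_simps subset_iff)

lemma subgroup_vec_minus:
  fixes N :: "'a :: ab_group_add vec set"
  assumes "subgroup N (monoid_vec TYPE('a) n)" "x \<in> N" "y \<in> N"
  shows "x - y \<in> N"
proof -
  have "x - y = x + - y" using assms by (intro eq_vecI) (auto simp: subgroup_monoid_vec_iff)
  then show ?thesis using assms by (simp add: subgroup_monoid_vec_iff)
qed

lemma subgroup_vec_of_int_smult:
  fixes N :: "'a :: comm_ring_1 vec set"
  assumes "subgroup N (monoid_vec TYPE('a) n)" "x \<in> N"
  shows "of_int c \<cdot>\<^sub>v x \<in> N"
proof (induction c rule: int_induct[where k = 0])
  case base
  have "x \<in> carrier_vec n" using assms by (auto simp: subgroup_monoid_vec_iff)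
  then have "0 \<cdot>\<^sub>v x = 0\<^sub>v n" by auto
  then show ?case using assms by (simp add: subgroup_monoid_vec_iff)
next
  case (step1 i)
  then show ?case using assms by (simp add: add_smult_distrib_vec subgroup_monoid_vec_iff)
next
  case (step2 i)
  have "of_int (i - 1) \<cdot>\<^sub>v x = of_int i \<cdot>\<^sub>v x - x" by (intro eq_vecI) (auto simp: algebra_simps)
  then show ?case using step2 subgroup_vec_minus assms by metis
qed

lemma subgroup_Zn_smult:
  assumes "subgroup N (Zn n)" "x \<in> N"
  shows "c \<cdot>\<^sub>v x \<in> N"
  using subgroup_vec_of_int_smult[OF assms, of c] by simp

lemma hom_Zn_simps:
  assumes "h \<in> hom (Zn m) (Zn n)" "x \<in> carrier_vec m" "y \<in> carrier_vec m"
  shows "h x \<in> carrier_vec n" "h (x + y) = h x + h y"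
  using assms by (auto simp: hom_def monoid_vec_simps)

lemma hom_Zn_zero:
  assumes "h \<in> hom (Zn m) (Zn n)" shows "h (0\<^sub>v m) = 0\<^sub>v n"
  using hom_one[OF assms comm_group.axioms(2)[OF comm_group_vec] comm_group.axioms(2)[OF comm_group_vec]]
  by (simp add: monoid_vec_simps)

lemma hom_Zn_smult:
  assumes h: "h \<in> hom (Zn m) (Zn n)" and x: "x \<in> carrier_vec m"
  shows "h (c \<cdot>\<^sub>v x) = c \<cdot>\<^sub>v h x"
proof (induction c rule: int_induct[where k = 0])
  case base
  have "0 \<cdot>\<^sub>v x = 0\<^sub>v m" "0 \<cdot>\<^sub>v h x = 0\<^sub>v n" using x hom_Zn_simps(1)[OF h x x] by auto
  then show ?case using hom_Zn_zero[OF h] by simp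
next
  case (step1 i)
  then show ?case using hom_Zn_simps[OF h, of "i \<cdot>\<^sub>v x" x] x by (simp add: add_smult_distrib_vec)
next
  case (step2 i)
  have "i \<cdot>\<^sub>v x = (i - 1) \<cdot>\<^sub>v x + x" by (intro eq_vecI) (auto simp: algebra_simps)
  then have eq: "h (i \<cdot>\<^sub>v x) = h ((i - 1) \<cdot>\<^sub>v x) + h x"
    using hom_Zn_simps(2)[OF h, of "(i - 1) \<cdot>\<^sub>v x" x] x by simp
  have "h ((i - 1) \<cdot>\<^sub>v x) \<in> carrier_vec n" "h x \<in> carrier_vec n"
    using hom_Zn_simps(1)[OF h] x by auto
  then have "h ((i - 1) \<cdot>\<^sub>v x) = (h ((i - 1) \<cdot>\<^sub>v x) + h x) - h x" by (intro eq_vecI) auto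
  also have "\<dots> = i \<cdot>\<^sub>v h x - h x" using eq step2 by simp
  also have "\<dots> = (i - 1) \<cdot>\<^sub>v h x" by (intro eq_vecI) (auto simp: algebra_simps)
  finally show ?case .
qed

lemma hom_Zn_minus:
  assumes h: "h \<in> hom (Zn m) (Zn n)" and x: "x \<in> carrier_vec m" "y \<in> carrier_vec m"
  shows "h (- x) = - h x" "h (x - y) = h x - h y"
proof -
  have neg: "h (- z) = - h z" if "z \<in> carrier_vec m" for z
  proof -
    have "- z = (-1) \<cdot>\<^sub>v z" "- h z = (-1) \<cdot>\<^sub>v h z" by auto
    then show ?thesis using hom_Zn_smult[OF h that, of "-1"] by metis
  qed
  show "h (- x) = - h x" by (rule neg[OF x(1)])
  have "x - y = x + - y" using x by (intro eq_vecI) auto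
  then have "h (x - y) = h x + - h y" using hom_Zn_simps(2)[OF h x(1), of "- y"] neg x by simp
  also have "\<dots> = h x - h y" using hom_Zn_simps(1)[OF h] x by (intro eq_vecI) auto
  finally show "h (x - y) = h x - h y" .
qed

lemma hom_Zn_matrix:
  assumes h: "h \<in> hom (Zn m) (Zn n)" and x: "x \<in> carrier_vec m"
  shows "h x = mat n m (\<lambda>(i, j). h (unit_vec m j) $ i) *\<^sub>v x"
proof -
  \<comment> \<open>\<open>y k\<close> keeps the first \<open>k\<close> coordinates of
    \<open>x\<close>, so the induction adds one multiple of a unit vector at a time.\<close>
  define y where "y k = vec m (\<lambda>i. if i < k then x $ i else 0)" for k
  have y_Suc: "y (Suc k) = y k + x $ k \<cdot>\<^sub>v unit_vec m k" if "k < m" for k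
    using that by (intro eq_vecI) (auto simp: y_def less_Suc_eq)
  have "h (y k) $ i = (\<Sum>j<k. h (unit_vec m j) $ i * x $ j)" if "k \<le> m" "i < n" for i k
    using that(1)
  proof (induction k)
    case 0
    have "y 0 = 0\<^sub>v m" by (auto simp: y_def)
    then show ?case using hom_Zn_zero[OF h] that(2) by simp
  next
    case (Suc k)
    have "y k \<in> carrier_vec m" by (simp add: y_def)
    then have "h (y (Suc k)) = h (y k) + x $ k \<cdot>\<^sub>v h (unit_vec m k)"
      using Suc.prems by (simp add: y_Suc hom_Zn_simps[OF h] hom_Zn_smult[OF h])
    then show ?case
      using Suc that(2) hom_Zn_simps(1)[OF h, of "unit_vec m k" "unit_vec m k"] by simp
  qed
  moreover have "y m = x" using x by (auto simp: y_def)
  ultimately have "h x $ i = (\<Sum>j<m. h (unit_vec m j) $ i * x $ j)" if "i < n" for i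
    using that by force
  then show ?thesis
    using x hom_Zn_simps(1)[OF h x x]
    by (intro eq_vecI) (auto simp: scalar_prod_def lessThan_atLeast0)
qed

section \<open>Pure subgroups and free subgroups of Z^n, one coordinate at a time\<close>

definition vec_tl :: "'a vec \<Rightarrow> 'a vec" where
  "vec_tl v = vec (dim_vec v - 1) (\<lambda>i. v $ Suc i)"

lemma vec_tl_vCons [simp]: "vec_tl (vCons a v) = v"
  by (auto simp: vec_tl_def)

lemma vCons_vec_tl: "v \<in> carrier_vec (Suc n) \<Longrightarrow> vCons (v $ 0) (vec_tl v) = v"
  by (cases v) auto

lemma vec_tl_closed: "v \<in> carrier_vec (Suc n) \<Longrightarrow> vec_tl v \<in> carrier_vec n"
  by (auto simp: vec_tl_def)

lemma vec_tl_add: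
  "v \<in> carrier_vec (Suc n) \<Longrightarrow> w \<in> carrier_vec (Suc n) \<Longrightarrow> vec_tl (v + w) = vec_tl v + vec_tl w"
  by (auto simp: vec_tl_def)

lemma vCons_add: "dim_vec v = dim_vec w \<Longrightarrow> vCons a v + vCons b w = vCons (a + b) (v + w)"
  by (intro eq_vecI) (auto simp: vec_index_vCons)

lemma vCons_uminus: "- vCons a v = vCons (- a) (- (v :: 'a :: group_add vec))"
  by (intro eq_vecI) (auto simp: vec_index_vCons)

lemma vCons_smult: "c \<cdot>\<^sub>v vCons a v = vCons (c * a) (c \<cdot>\<^sub>v v)"
  by (intro eq_vecI) (auto simp: vec_index_vCons)

lemma subgroup_vCons:
  assumes "subgroup N (Zn (Suc n))"
  shows "subgroup {v \<in> carrier_vec n. vCons 0 v \<in> N} (Zn n)"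
  unfolding subgroup_monoid_vec_iff
proof (intro conjI ballI)
  show "0\<^sub>v n \<in> {v \<in> carrier_vec n. vCons 0 v \<in> N}"
    using assms by (simp add: subgroup_monoid_vec_iff zero_vec_Suc)
next
  fix v w assume "v \<in> {v \<in> carrier_vec n. vCons 0 v \<in> N}" "w \<in> {v \<in> carrier_vec n. vCons 0 v \<in> N}"
  then have "vCons 0 v + vCons 0 w \<in> N" "v \<in> carrier_vec n" "w \<in> carrier_vec n"
    using assms by (auto simp: subgroup_monoid_vec_iff)
  then show "v + w \<in> {v \<in> carrier_vec n. vCons 0 v \<in> N}" by (simp add: vCons_add)
next
  fix v assume "v \<in> {v \<in> carrier_vec n. vCons 0 v \<in> N}"
  then have "- vCons 0 v \<in> N" "v \<in> carrier_vec n"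
    using assms by (auto simp: subgroup_monoid_vec_iff)
  then show "- v \<in> {v \<in> carrier_vec n. vCons 0 v \<in> N}" by (simp add: vCons_uminus)
qed auto

text \<open>Purity says that Z^n / N is torsion-free, so it embeds into some Z^k. The embedding is
  built by elimination on the first coordinate; \<open>q\<close> need not be onto, and its image is
  handled by \<open>subgroup_Zn_is_free\<close>.\<close>

lemma pure_subgroup_is_kernel:
  assumes "subgroup N (Zn n)"
    and "\<And>c a. c \<noteq> 0 \<Longrightarrow> a \<in> carrier_vec n \<Longrightarrow> c \<cdot>\<^sub>v a \<in> N \<Longrightarrow> a \<in> N"
  shows "\<exists>k. \<exists>q\<in>hom (Zn n) (Zn k). \<forall>x\<in>carrier_vec n. q x = 0\<^sub>v k \<longleftrightarrow> x \<in> N"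
  using assms
proof (induction n arbitrary: N)
  case 0
  then have "(\<lambda>x. x) \<in> hom (Zn 0) (Zn 0)" "\<forall>x\<in>carrier_vec 0. x = 0\<^sub>v 0 \<longleftrightarrow> x \<in> N"
    by (auto simp: hom_def subgroup_monoid_vec_iff)
  then show ?case by (intro exI[of _ 0] bexI[of _ "\<lambda>x. x"])
next
  case (Suc n)
  let ?N = "{v \<in> carrier_vec n. vCons 0 v \<in> N}"
  have "a \<in> ?N" if "c \<noteq> 0" "a \<in> carrier_vec n" "c \<cdot>\<^sub>v a \<in> ?N" for c a
    using Suc.prems(2)[of c "vCons 0 a"] that by (simp add: vCons_smult)
  then obtain k q where q: "q \<in> hom (Zn n) (Zn k)"
    "\<And>x. x \<in> carrier_vec n \<Longrightarrow> q x = 0\<^sub>v k \<longleftrightarrow> vCons 0 x \<in> N"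
    using Suc.IH[OF subgroup_vCons[OF Suc.prems(1)]] by blast
  show ?case
  proof (cases "\<forall>x\<in>N. x $ 0 = 0")
    case True
    \<comment> \<open>There is no pivot: the first coordinate vanishes on \<open>N\<close> and
      becomes a further coordinate of the map.\<close>
    let ?q = "\<lambda>x. vCons (x $ 0) (q (vec_tl x))"
    have "?q \<in> hom (Zn (Suc n)) (Zn (Suc k))"
    proof (rule homI)
      fix x y assume "x \<in> carrier (Zn (Suc n))" "y \<in> carrier (Zn (Suc n))"
      then have xy: "x \<in> carrier_vec (Suc n)" "y \<in> carrier_vec (Suc n)"
        by (simp_all add: monoid_vec_simps)
      note tl = vec_tl_closed[OF xy(1)] vec_tl_closed[OF xy(2)]
      show "?q (x \<otimes>\<^bsub>Zn (Suc n)\<^esub> y) = ?q x \<otimes>\<^bsub>Zn (Suc k)\<^esub> ?q y"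
        using xy hom_Zn_simps[OF q(1) tl(1) tl(2)] hom_Zn_simps(1)[OF q(1) tl(2) tl(2)]
        by (simp add: monoid_vec_simps vec_tl_add vCons_add)
    next
      fix x assume "x \<in> carrier (Zn (Suc n))"
      then have "x \<in> carrier_vec (Suc n)" by (simp only: monoid_vec_simps)
      then have x: "vec_tl x \<in> carrier_vec n" by (rule vec_tl_closed)
      show "?q x \<in> carrier (Zn (Suc k))"
        using hom_Zn_simps(1)[OF q(1) x x] by (simp add: monoid_vec_simps)
    qed
    moreover have "?q x = 0\<^sub>v (Suc k) \<longleftrightarrow> x \<in> N" if x: "x \<in> carrier_vec (Suc n)" for x
    proof -
      have "?q x = 0\<^sub>v (Suc k) \<longleftrightarrow> x $ 0 = 0 \<and> vCons 0 (vec_tl x) \<in> N"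
        using q(2)[OF vec_tl_closed[OF x]] by (simp add: zero_vec_Suc)
      also have "\<dots> \<longleftrightarrow> x \<in> N" using True vCons_vec_tl[OF x] by metis
      finally show ?thesis .
    qed
    ultimately show ?thesis by (intro exI[of _ "Suc k"] bexI[of _ ?q]) simp_all
  next
    case False
    then obtain v0 where v0: "v0 \<in> N" "v0 $ 0 \<noteq> 0" by blast
    let ?d = "v0 $ 0"
    have v0c: "v0 \<in> carrier_vec (Suc n)" using v0 Suc.prems(1) by (auto simp: subgroup_monoid_vec_iff)
    \<comment> \<open>Fraction-free elimination with pivot \<open>v0\<close>: \<open>?r x\<close> is
      the tail of a combination of \<open>x\<close> and \<open>v0\<close> whose first coordinate is
      zero. The factor \<open>?d\<close> on \<open>x\<close> is harmless because \<open>N\<close> is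
      pure.\<close>
    let ?r = "\<lambda>x. ?d \<cdot>\<^sub>v vec_tl x - x $ 0 \<cdot>\<^sub>v vec_tl v0"
    have r: "?r x \<in> carrier_vec n" if "x \<in> carrier_vec (Suc n)" for x
      using vec_tl_closed[OF that] vec_tl_closed[OF v0c] by simp
    have "(\<lambda>x. q (?r x)) \<in> hom (Zn (Suc n)) (Zn k)"
    proof (rule homI)
      fix x y assume "x \<in> carrier (Zn (Suc n))" "y \<in> carrier (Zn (Suc n))"
      then have xy: "x \<in> carrier_vec (Suc n)" "y \<in> carrier_vec (Suc n)"
        by (simp_all add: monoid_vec_simps)
      have "?r (x + y) = ?r x + ?r y"
        using xy v0c by (intro eq_vecI) (auto simp: vec_tl_def algebra_simps)
      then show "q (?r (x \<otimes>\<^bsub>Zn (Suc n)\<^esub> y)) = q (?r x) \<otimes>\<^bsub>Zn k\<^esub> q (?r y)"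
        using hom_Zn_simps(2)[OF q(1) r[OF xy(1)] r[OF xy(2)]] by (simp add: monoid_vec_simps)
    next
      fix x assume "x \<in> carrier (Zn (Suc n))"
      then have x: "?r x \<in> carrier_vec n" by (intro r) (simp add: monoid_vec_simps)
      show "q (?r x) \<in> carrier (Zn k)"
        using hom_Zn_simps(1)[OF q(1) x x] by (simp add: monoid_vec_simps)
    qed
    moreover have "q (?r x) = 0\<^sub>v k \<longleftrightarrow> x \<in> N" if x: "x \<in> carrier_vec (Suc n)" for x
    proof -
      have eq: "vCons 0 (?r x) = ?d \<cdot>\<^sub>v x - x $ 0 \<cdot>\<^sub>v v0"
        using x v0c by (intro eq_vecI) (auto simp: vec_tl_def vec_index_vCons)
      have eq': "?d \<cdot>\<^sub>v x = vCons 0 (?r x) + x $ 0 \<cdot>\<^sub>v v0"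
        unfolding eq using x v0c by (intro eq_vecI) auto
      have mult: "x $ 0 \<cdot>\<^sub>v v0 \<in> N" using subgroup_Zn_smult[OF Suc.prems(1) v0(1)] .
      have "vCons 0 (?r x) \<in> N \<longleftrightarrow> ?d \<cdot>\<^sub>v x \<in> N"
      proof
        assume "vCons 0 (?r x) \<in> N"
        then show "?d \<cdot>\<^sub>v x \<in> N"
          unfolding eq' using mult Suc.prems(1) by (simp add: subgroup_monoid_vec_iff)
      next
        assume "?d \<cdot>\<^sub>v x \<in> N"
        then show "vCons 0 (?r x) \<in> N"
          unfolding eq using mult subgroup_vec_minus[OF Suc.prems(1)] by blast
      qed
      also have "\<dots> \<longleftrightarrow> x \<in> N"
        using Suc.prems(2)[OF v0(2) x] subgroup_Zn_smult[OF Suc.prems(1)] by blast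
      finally show ?thesis using q(2)[OF r[OF x]] by simp
    qed
    ultimately show ?thesis by (intro exI[of _ k] bexI[of _ "\<lambda>x. q (?r x)"]) auto
  qed
qed

text \<open>The first coordinates of \<open>H\<close> form an ideal of Z. If it is nonzero, a member
  of \<open>H\<close> whose first coordinate generates it is added to a basis of the part with first
  coordinate zero.\<close>

lemma subgroup_Zn_is_free:
  assumes "subgroup H (Zn n)"
  shows "\<exists>m. \<exists>s\<in>hom (Zn m) (Zn n). inj_on s (carrier_vec m) \<and> s ` carrier_vec m = H"
  using assms
proof (induction n arbitrary: H)
  case 0
  have c0: "carrier_vec 0 = {0\<^sub>v 0 :: int vec}" by auto
  have "(\<lambda>x. x) \<in> hom (Zn 0) (Zn 0)" by (auto simp: hom_def)
  moreover have "H = {0\<^sub>v 0}" using 0 unfolding subgroup_monoid_vec_iff c0 by blast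
  ultimately show ?case by (intro exI[of _ 0] bexI[of _ "\<lambda>x. x"]) (simp_all add: c0)
next
  case (Suc n)
  let ?H = "{v \<in> carrier_vec n. vCons 0 v \<in> H}"
  obtain m s where s: "s \<in> hom (Zn m) (Zn n)" "inj_on s (carrier_vec m)" "s ` carrier_vec m = ?H"
    using Suc.IH[OF subgroup_vCons[OF Suc.prems]] by blast
  have H: "H \<subseteq> carrier_vec (Suc n)" using Suc.prems by (simp add: subgroup_monoid_vec_iff)
  have s_closed: "s x \<in> carrier_vec n" if "x \<in> carrier_vec m" for x
    using hom_Zn_simps(1)[OF s(1) that that] .
  have s_H: "vCons 0 (s x) \<in> H" if "x \<in> carrier_vec m" for x using s(3) that by blast
  show ?case
  proof (cases "\<forall>x\<in>H. x $ 0 = 0")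
    case True
    let ?s = "\<lambda>x. vCons 0 (s x)"
    have "?s \<in> hom (Zn m) (Zn (Suc n))"
    proof (rule homI)
      fix x y assume "x \<in> carrier (Zn m)" "y \<in> carrier (Zn m)"
      then have xy: "x \<in> carrier_vec m" "y \<in> carrier_vec m"
        by (simp_all add: monoid_vec_simps)
      then show "?s (x \<otimes>\<^bsub>Zn m\<^esub> y) = ?s x \<otimes>\<^bsub>Zn (Suc n)\<^esub> ?s y"
        using s_closed[OF xy(1)] s_closed[OF xy(2)]
        by (simp add: monoid_vec_simps vCons_add hom_Zn_simps(2)[OF s(1)])
    qed (use s_closed in \<open>auto simp: monoid_vec_simps\<close>)
    moreover have "inj_on ?s (carrier_vec m)" using s(2) by (auto simp: inj_on_def)
    moreover have "?s ` carrier_vec m = H"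
    proof
      show "?s ` carrier_vec m \<subseteq> H" using s_H by blast
      show "H \<subseteq> ?s ` carrier_vec m"
      proof
        fix x assume x: "x \<in> H"
        then have "vCons 0 (vec_tl x) = x" using True H vCons_vec_tl[of x n] by auto
        then have "vec_tl x \<in> ?H" "x = vCons 0 (vec_tl x)" using x H vec_tl_closed[of x n] by auto
        moreover from this obtain z where "z \<in> carrier_vec m" "s z = vec_tl x"
          using s(3) by (metis (no_types, lifting) imageE)
        ultimately show "x \<in> ?s ` carrier_vec m" by (intro image_eqI[of _ _ z]) simp_all
      qed
    qed
    ultimately show ?thesis by (intro exI[of _ m] bexI[of _ ?s]) simp_all
  next
    case False
    \<comment> \<open>The ideal is generated by the least positive first coordinate; division with
      remainder shows below that it divides all others.\<close>
    let ?P = "\<lambda>k. k > 0 \<and> (\<exists>x\<in>H. x $ 0 = int k)"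
    obtain x where x: "x \<in> H" "x $ 0 \<noteq> 0" using False by blast
    have "- x \<in> H" using x Suc.prems by (simp add: subgroup_monoid_vec_iff)
    then have "\<exists>y\<in>H. y $ 0 > 0"
      using x H by (cases "x $ 0 > 0") (force simp: subset_iff)+
    then obtain y where "y \<in> H" "y $ 0 > 0" by blast
    then have "?P (nat (y $ 0))" by auto
    then have least: "?P (LEAST k. ?P k)" by (rule LeastI)
    then obtain h where h: "h \<in> H" "h $ 0 = int (LEAST k. ?P k)" by blast
    have pos: "h $ 0 > 0" using least h by simp
    have hc: "h \<in> carrier_vec (Suc n)" using h H by blast
    have h_dvd: "h $ 0 dvd x $ 0" if x: "x \<in> H" for x
    proof (rule ccontr)
      assume "\<not> h $ 0 dvd x $ 0"
      then have nz: "x $ 0 mod h $ 0 \<noteq> 0" by (simp add: dvd_eq_mod_eq_0)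
      let ?z = "x - (x $ 0 div h $ 0) \<cdot>\<^sub>v h"
      have "?z \<in> H" using subgroup_vec_minus[OF Suc.prems x subgroup_Zn_smult[OF Suc.prems h(1)]] .
      moreover have "?z $ 0 = x $ 0 mod h $ 0"
        using hc by (simp add: minus_div_mult_eq_mod)
      moreover have bounds: "0 \<le> x $ 0 mod h $ 0" "x $ 0 mod h $ 0 < h $ 0" using pos by auto
      ultimately have "?P (nat (x $ 0 mod h $ 0))" using nz by auto
      then have "(LEAST k. ?P k) \<le> nat (x $ 0 mod h $ 0)" by (rule Least_le)
      then have "int (LEAST k. ?P k) \<le> x $ 0 mod h $ 0" using bounds(1) by linarith
      then show False using h(2) bounds(2) by linarith
    qed
    let ?s = "\<lambda>y. y $ 0 \<cdot>\<^sub>v h + vCons 0 (s (vec_tl y))"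
    have s_tl: "s (vec_tl y) \<in> carrier_vec n" if "y \<in> carrier_vec (Suc m)" for y
      using s_closed[OF vec_tl_closed[OF that]] .
    have "?s \<in> hom (Zn (Suc m)) (Zn (Suc n))"
    proof (rule homI)
      fix x y assume "x \<in> carrier (Zn (Suc m))" "y \<in> carrier (Zn (Suc m))"
      then have xy: "x \<in> carrier_vec (Suc m)" "y \<in> carrier_vec (Suc m)"
        by (simp_all add: monoid_vec_simps)
      have "s (vec_tl (x + y)) = s (vec_tl x) + s (vec_tl y)"
        using hom_Zn_simps(2)[OF s(1) vec_tl_closed[OF xy(1)] vec_tl_closed[OF xy(2)]]
        by (simp add: vec_tl_add[OF xy])
      then show "?s (x \<otimes>\<^bsub>Zn (Suc m)\<^esub> y) = ?s x \<otimes>\<^bsub>Zn (Suc n)\<^esub> ?s y"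
        using hc xy s_tl[OF xy(1)] s_tl[OF xy(2)]
        by (intro eq_vecI) (auto simp: monoid_vec_simps vec_index_vCons algebra_simps)
    qed (use s_tl hc in \<open>auto simp: monoid_vec_simps\<close>)
    moreover have "inj_on ?s (carrier_vec (Suc m))"
    proof (rule inj_onI)
      fix x y assume xy: "x \<in> carrier_vec (Suc m)" "y \<in> carrier_vec (Suc m)" and eq: "?s x = ?s y"
      have "?s x $ 0 = x $ 0 * h $ 0" "?s y $ 0 = y $ 0 * h $ 0" using hc by auto
      then have x0: "x $ 0 = y $ 0" using eq pos by simp
      have "vCons 0 (s (vec_tl x)) = ?s x - x $ 0 \<cdot>\<^sub>v h"
        using hc s_tl[OF xy(1)] by (intro eq_vecI) auto
      also have "\<dots> = ?s y - y $ 0 \<cdot>\<^sub>v h" by (subst eq) (simp only: x0)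
      also have "\<dots> = vCons 0 (s (vec_tl y))"
        using hc s_tl[OF xy(2)] by (intro eq_vecI) auto
      finally have "s (vec_tl x) = s (vec_tl y)" by simp
      then have "vec_tl x = vec_tl y"
        using inj_onD[OF s(2)] vec_tl_closed[OF xy(1)] vec_tl_closed[OF xy(2)] by blast
      then show "x = y" using x0 vCons_vec_tl[OF xy(1)] vCons_vec_tl[OF xy(2)] by metis
    qed
    moreover have "?s ` carrier_vec (Suc m) = H"
    proof
      show "?s ` carrier_vec (Suc m) \<subseteq> H"
      proof
        fix x assume "x \<in> ?s ` carrier_vec (Suc m)"
        then obtain y where y: "x = ?s y" "y \<in> carrier_vec (Suc m)" by blast
        then show "x \<in> H"
          using s_H[OF vec_tl_closed[OF y(2)]] subgroup_Zn_smult[OF Suc.prems h(1)] Suc.prems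
          unfolding subgroup_monoid_vec_iff by simp
      qed
      show "H \<subseteq> ?s ` carrier_vec (Suc m)"
      proof
        fix x assume x: "x \<in> H"
        then obtain c where c: "x $ 0 = h $ 0 * c" using h_dvd by blast
        let ?y = "x - c \<cdot>\<^sub>v h"
        have y: "?y \<in> H" using subgroup_vec_minus[OF Suc.prems x subgroup_Zn_smult[OF Suc.prems h(1)]] .
        have y0: "?y $ 0 = 0" using c hc by simp
        then have "vCons 0 (vec_tl ?y) = ?y" using vCons_vec_tl[of ?y n] y H by auto
        then have "vec_tl ?y \<in> ?H" using y H vec_tl_closed[of ?y n] by auto
        then obtain z where z: "z \<in> carrier_vec m" "s z = vec_tl ?y"
          using s(3) by (metis (no_types, lifting) imageE)
        have "?s (vCons c z) = c \<cdot>\<^sub>v h + ?y"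
          using z \<open>vCons 0 (vec_tl ?y) = ?y\<close> by simp
        also have "\<dots> = x" using x H hc by (intro eq_vecI) auto
        finally show "x \<in> ?s ` carrier_vec (Suc m)"
          using z(1) by (intro image_eqI[of _ _ "vCons c z"]) simp_all
      qed
    qed
    ultimately show ?thesis by (intro exI[of _ "Suc m"] bexI[of _ ?s]) simp_all
  qed
qed

section \<open>Polynomials in a matrix and characteristic polynomials\<close>

text \<open>The vector f(M) v, computed by Horner's scheme, so that induction over
  \<open>pCons\<close> follows the recursion and no polynomial in matrices has to be formed.\<close>

definition poly_act :: "'a :: comm_ring_1 mat \<Rightarrow> 'a poly \<Rightarrow> 'a vec \<Rightarrow> 'a vec" where
  "poly_act M f v = fold_coeffs (\<lambda>c y. c \<cdot>\<^sub>v v + M *\<^sub>v y) f (0\<^sub>v (dim_vec v))"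

lemma poly_act_0 [simp]: "poly_act M 0 v = 0\<^sub>v (dim_vec v)"
  by (simp add: poly_act_def)

lemma mult_mat_zero_vec: "M \<in> carrier_mat m n \<Longrightarrow> M *\<^sub>v 0\<^sub>v n = (0\<^sub>v m :: 'a :: comm_ring_1 vec)"
  by (intro eq_vecI) auto

lemma mult_mat_smult_vec:
  fixes M :: "'a :: comm_ring_1 mat"
  assumes "M \<in> carrier_mat m n" "v \<in> carrier_vec n"
  shows "M *\<^sub>v (c \<cdot>\<^sub>v v) = c \<cdot>\<^sub>v (M *\<^sub>v v)"
  using assms by (intro eq_vecI) auto

lemma poly_act_pCons:
  assumes "M \<in> carrier_mat n n" "v \<in> carrier_vec n"
  shows "poly_act M (pCons c f) v = c \<cdot>\<^sub>v v + M *\<^sub>v poly_act M f v"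
\<comment> \<open>\<open>pCons 0 0\<close> is the zero polynomial, on which
  \<open>fold_coeffs\<close> performs no step at all.\<close>
proof (cases "c = 0 \<and> f = 0")
  case True
  then show ?thesis using assms by (auto simp: mult_mat_zero_vec)
next
  case False
  then show ?thesis by (auto simp: poly_act_def)
qed

lemma poly_act_closed [simp]:
  assumes "M \<in> carrier_mat n n" "v \<in> carrier_vec n"
  shows "poly_act M f v \<in> carrier_vec n"
  using assms by (induction f) (auto simp: poly_act_pCons)

lemma poly_act_in_subgroup:
  assumes M: "M \<in> carrier_mat n n" and H: "H \<subseteq> carrier_vec n" "0\<^sub>v n \<in> H" "v \<in> H"
    and closed: "\<And>x y. x \<in> H \<Longrightarrow> y \<in> H \<Longrightarrow> x + y \<in> H" "\<And>c x. x \<in> H \<Longrightarrow> c \<cdot>\<^sub>v x \<in> H"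
      "\<And>x. x \<in> H \<Longrightarrow> M *\<^sub>v x \<in> H"
  shows "poly_act M f v \<in> H"
proof -
  have v: "v \<in> carrier_vec n" using H by blast
  show ?thesis
    using v H closed by (induction f) (auto simp: poly_act_pCons[OF M])
qed

lemma poly_act_add:
  assumes M: "M \<in> carrier_mat n n" and v: "v \<in> carrier_vec n"
  shows "poly_act M (f + g) v = poly_act M f v + poly_act M g v"
proof (induction f g rule: poly_induct2)
  case 0
  then show ?case using v by auto
next
  case (pCons a p b q)
  have "poly_act M p v \<in> carrier_vec n" "poly_act M q v \<in> carrier_vec n" using M v by auto
  then show ?case
    using pCons M v
    by (intro eq_vecI) (auto simp: poly_act_pCons[OF M v] mult_add_distrib_mat_vec[OF M] algebra_simps)
qed

lemma poly_act_smult: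
  assumes M: "M \<in> carrier_mat n n" and v: "v \<in> carrier_vec n"
  shows "poly_act M (Polynomial.smult c f) v = c \<cdot>\<^sub>v poly_act M f v"
proof (induction f)
  case 0
  then show ?case using v by auto
next
  case (pCons a p)
  have "poly_act M p v \<in> carrier_vec n" using M v by auto
  then show ?case
    using pCons M v
    by (intro eq_vecI) (auto simp: poly_act_pCons[OF M v] mult_mat_smult_vec[OF M] algebra_simps)
qed

lemma poly_act_monom:
  assumes M: "M \<in> carrier_mat n n" and v: "v \<in> carrier_vec n"
  shows "poly_act M (monom 1 k) v = ((*\<^sub>v) M ^^ k) v"
proof (induction k)
  case 0
  then show ?case using v M by (auto simp: monom_0 poly_act_pCons[OF M v] mult_mat_zero_vec)
next
  case (Suc k)
  have "((*\<^sub>v) M ^^ k) v \<in> carrier_vec n" using M v by (induction k) auto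
  then show ?case using Suc v M by (auto simp: monom_Suc poly_act_pCons[OF M v])
qed

lemma poly_act_vec_add:
  assumes M: "M \<in> carrier_mat n n" and v: "v \<in> carrier_vec n" and w: "w \<in> carrier_vec n"
  shows "poly_act M f (v + w) = poly_act M f v + poly_act M f w"
proof (induction f)
  case 0
  then show ?case using v w by auto
next
  case (pCons a p)
  have "poly_act M p v \<in> carrier_vec n" "poly_act M p w \<in> carrier_vec n" using M v w by auto
  then show ?case
    using pCons M v w
    by (intro eq_vecI)
      (auto simp: poly_act_pCons[OF M] mult_add_distrib_mat_vec[OF M] algebra_simps)
qed

lemma poly_act_commute:
  assumes M: "M \<in> carrier_mat n n" and v: "v \<in> carrier_vec n"
  shows "M *\<^sub>v poly_act M f v = poly_act M f (M *\<^sub>v v)"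
proof (induction f)
  case 0
  then show ?case using v M by (auto simp: mult_mat_zero_vec)
next
  case (pCons a p)
  have Mv: "M *\<^sub>v v \<in> carrier_vec n" using M v by auto
  have "poly_act M p v \<in> carrier_vec n" using M v by auto
  then show ?case
    using pCons M v Mv
    by (simp add: poly_act_pCons[OF M v] poly_act_pCons[OF M Mv] mult_add_distrib_mat_vec[OF M]
        mult_mat_smult_vec[OF M v])
qed

text \<open>The hypotheses on \<open>q\<close> are confined to an \<open>M\<close>-stable set
  \<open>H\<close>, because the quotient map of a layer is defined only on A_i. With a polynomial in
  \<open>M\<close> in the place of \<open>q\<close>, it also shows that polynomials in
  \<open>M\<close> commute.\<close>

lemma poly_act_intertwine:
  fixes q :: "int vec \<Rightarrow> int vec"
  assumes M: "M \<in> carrier_mat n n" and M': "M' \<in> carrier_mat m m"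
    and H: "H \<subseteq> carrier_vec n" "0\<^sub>v n \<in> H" "v \<in> H"
    and closed: "\<And>x y. x \<in> H \<Longrightarrow> y \<in> H \<Longrightarrow> x + y \<in> H" "\<And>c x. x \<in> H \<Longrightarrow> c \<cdot>\<^sub>v x \<in> H"
      "\<And>x. x \<in> H \<Longrightarrow> M *\<^sub>v x \<in> H"
    and q: "\<And>x. x \<in> H \<Longrightarrow> q x \<in> carrier_vec m" "\<And>x y. x \<in> H \<Longrightarrow> y \<in> H \<Longrightarrow> q (x + y) = q x + q y"
      "\<And>c x. x \<in> H \<Longrightarrow> q (c \<cdot>\<^sub>v x) = c \<cdot>\<^sub>v q x" "\<And>x. x \<in> H \<Longrightarrow> q (M *\<^sub>v x) = M' *\<^sub>v q x"
  shows "q (poly_act M f v) = poly_act M' f (q v)"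
proof (induction f)
  have v: "v \<in> carrier_vec n" using H by blast
  case 0
  have "0\<^sub>v n = 0 \<cdot>\<^sub>v v" using v by auto
  then have "q (0\<^sub>v n) = 0 \<cdot>\<^sub>v q v" using q(3)[OF H(3)] by metis
  then show ?case using v q(1)[OF H(3)] by auto
next
  have v: "v \<in> carrier_vec n" using H by blast
  case (pCons a p)
  have mem: "poly_act M p v \<in> H" by (rule poly_act_in_subgroup[OF M H closed])
  show ?case
    using pCons q closed H(3) mem
    by (simp add: poly_act_pCons[OF M v] poly_act_pCons[OF M' q(1)[OF H(3)]])
qed

text \<open>If \<open>f e = (x - M) d\<close> for a polynomial vector \<open>d\<close>, then the intermediate values of Horner's
  scheme for \<open>f(M) e\<close> are the coefficients of \<open>d\<close>.\<close>

lemma poly_act_horner: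
  assumes M: "M \<in> carrier_mat n n" and e: "e \<in> carrier_vec n"
    and d: "\<And>k. d k \<in> carrier_vec n" "\<And>k. k \<ge> K \<Longrightarrow> d k = 0\<^sub>v n"
    and eq: "\<And>k. coeff f k \<cdot>\<^sub>v e = d k - M *\<^sub>v d (Suc k)"
  shows "poly_act M f e = d 0"
  using d eq
proof (induction f arbitrary: d K)
  case (0 d K)
  have zero: "0 \<cdot>\<^sub>v e = 0\<^sub>v n" using e by auto
  have step: "d k = M *\<^sub>v d (Suc k)" for k
  proof -
    have "d k - M *\<^sub>v d (Suc k) = 0\<^sub>v n" using 0(3)[of k] zero by simp
    moreover have "d k \<in> carrier_vec n" "M *\<^sub>v d (Suc k) \<in> carrier_vec n" using 0(1) M by auto
    ultimately show ?thesis by (auto simp: vec_eq_iff)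
  qed
  \<comment> \<open>For the zero polynomial each \<open>d k\<close> is the image under
    \<open>M\<close> of \<open>d (Suc k)\<close>; since \<open>d\<close> vanishes from
    \<open>K\<close> on, it vanishes all the way down to 0.\<close>
  have "d (K - k) = 0\<^sub>v n" for k
  proof (induction k)
    case (Suc k)
    then show ?case
      using step[of "K - Suc k"] 0(2) M
      by (cases "k < K") (auto simp: Suc_diff_Suc mult_mat_zero_vec)
  qed (simp add: 0(2))
  from this[of K] show ?case using e by simp
next
  case (pCons c f d K)
  have "poly_act M f e = (\<lambda>k. d (Suc k)) 0"
  proof (rule pCons.IH[of _ K])
    show "d (Suc k) = 0\<^sub>v n" if "k \<ge> K" for k using that by (intro pCons.prems(2)) simp
    show "coeff f k \<cdot>\<^sub>v e = d (Suc k) - M *\<^sub>v d (Suc (Suc k))" for k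
      using pCons.prems(3)[of "Suc k"] by simp
  qed (rule pCons.prems(1))
  then have IH: "poly_act M f e = d 1" by simp
  have "c \<cdot>\<^sub>v e = d 0 - M *\<^sub>v d 1" using pCons.prems(3)[of 0] by simp
  moreover have "x - y + y = x" if "x \<in> carrier_vec n" "y \<in> carrier_vec n" for x y :: "'a vec"
    using that by (intro eq_vecI) auto
  ultimately have "c \<cdot>\<^sub>v e + M *\<^sub>v d 1 = d 0" using pCons.prems(1) M by simp
  then show ?case by (simp only: poly_act_pCons[OF M e] IH)
qed

section \<open>The Cayley-Hamilton theorem via the adjugate\<close>

lemma char_poly_matrix_index:
  assumes "M \<in> carrier_mat n n" "i < n" "j < n"
  shows "char_poly_matrix M $$ (i, j) = (if i = j then [:0, 1:] else 0) - [:M $$ (i, j):]"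
  using assms by (auto simp: char_poly_matrix_def)

lemma sum_delta_diff_mult:
  fixes a :: "nat \<Rightarrow> 'a :: comm_ring_1"
  assumes "i < n"
  shows "(\<Sum>j<n. ((if i = j then x else 0) - a j) * b j) = x * b i - (\<Sum>j<n. a j * b j)"
proof -
  have "(\<Sum>j<n. ((if i = j then x else 0) - a j) * b j)
      = (\<Sum>j<n. if i = j then x * b j else 0) - (\<Sum>j<n. a j * b j)"
    unfolding sum_subtractf[symmetric] by (intro sum.cong) (auto simp: algebra_simps)
  then show ?thesis using assms by simp
qed

text \<open>For the adjugate C of x - M, the product (x - M) C is f times the identity. Reading
  column \<open>s\<close> coefficient by coefficient in x gives the recursion that
  \<open>poly_act_horner\<close> asks for.\<close>

lemma Cayley_Hamilton_unit_vec:
  fixes M :: "'a :: comm_ring_1 mat"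
  assumes M: "M \<in> carrier_mat n n" and s: "s < n"
  shows "poly_act M (char_poly M) (unit_vec n s) = 0\<^sub>v n"
proof -
  let ?f = "char_poly M"
  define C where "C = adj_mat (char_poly_matrix M)"
  have cpm: "char_poly_matrix M \<in> carrier_mat n n" using M by simp
  have C: "C \<in> carrier_mat n n" "char_poly_matrix M * C = ?f \<cdot>\<^sub>m 1\<^sub>m n"
    unfolding C_def char_poly_def using adj_mat[OF cpm] by auto
  have entry: "(if i = s then ?f else 0) = [:0, 1:] * C $$ (i, s) - (\<Sum>j<n. [:M $$ (i, j):] * C $$ (j, s))"
    if i: "i < n" for i
  proof -
    have "(if i = s then ?f else 0) = (char_poly_matrix M * C) $$ (i, s)"
      unfolding C(2) using i s by simp
    also have "\<dots> = (\<Sum>j<n. ((if i = j then [:0, 1:] else 0) - [:M $$ (i, j):]) * C $$ (j, s))"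
      using i s C(1) carrier_matD[OF cpm]
      by (simp add: scalar_prod_def char_poly_matrix_index[OF M] lessThan_atLeast0)
    also have "\<dots> = [:0, 1:] * C $$ (i, s) - (\<Sum>j<n. [:M $$ (i, j):] * C $$ (j, s))"
      by (rule sum_delta_diff_mult[OF i])
    finally show ?thesis .
  qed
  \<comment> \<open>The coefficients are shifted by one place: \<open>d (Suc k)\<close> is the
    coefficient of x^k in column \<open>s\<close>, and \<open>d 0 = 0\<close>. Thus
    \<open>d k\<close> minus the \<open>M\<close>-image of \<open>d (Suc k)\<close> is the
    coefficient of x^k in (x - M) C, and the final Horner value is zero.\<close>
  define d where "d k = (case k of 0 \<Rightarrow> 0\<^sub>v n | Suc k \<Rightarrow> vec n (\<lambda>i. coeff (C $$ (i, s)) k))" for k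
  \<comment> \<open>The sum of the degrees is a common degree bound for the column; one successor
    pays for the shift, the other for strictness.\<close>
  define K where "K = Suc (Suc (\<Sum>i<n. degree (C $$ (i, s))))"
  have "poly_act M ?f (unit_vec n s) = d 0"
  proof (rule poly_act_horner[OF M, of _ d K])
    show "unit_vec n s \<in> carrier_vec n" by simp
    show dc: "d k \<in> carrier_vec n" for k by (cases k) (simp_all add: d_def)
    show "d k = 0\<^sub>v n" if "k \<ge> K" for k
    proof -
      obtain k' where k': "k = Suc k'" "k' > (\<Sum>i<n. degree (C $$ (i, s)))"
        using \<open>k \<ge> K\<close> by (cases k) (auto simp: K_def)
      have "coeff (C $$ (i, s)) k' = 0" if "i < n" for i
      proof -
        have "degree (C $$ (i, s)) \<le> (\<Sum>i<n. degree (C $$ (i, s)))"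
          using that by (intro member_le_sum) auto
        then show ?thesis using k'(2) by (intro coeff_eq_0) linarith
      qed
      then show ?thesis by (auto simp: d_def k'(1))
    qed
    show "coeff ?f k \<cdot>\<^sub>v unit_vec n s = d k - M *\<^sub>v d (Suc k)" for k
    proof (rule eq_vecI)
      fix i assume "i < dim_vec (d k - M *\<^sub>v d (Suc k))"
      then have i: "i < n" using M by auto
      have "(M *\<^sub>v d (Suc k)) $ i = (\<Sum>j<n. M $$ (i, j) * coeff (C $$ (j, s)) k)"
        using i M by (simp add: d_def scalar_prod_def lessThan_atLeast0)
      moreover have "d k $ i = coeff ([:0, 1:] * C $$ (i, s)) k"
        using i by (cases k) (simp_all add: d_def coeff_pCons)
      moreover have "(coeff ?f k \<cdot>\<^sub>v unit_vec n s) $ i = coeff (if i = s then ?f else 0) k"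
        using i s by (simp add: unit_vec_def)
      ultimately show "(coeff ?f k \<cdot>\<^sub>v unit_vec n s) $ i = (d k - M *\<^sub>v d (Suc k)) $ i"
        using i M entry[OF i] dc[of k] by (simp add: coeff_sum)
    qed (use M in auto)
  qed
  then show ?thesis by (simp add: d_def)
qed

section \<open>Characteristic polynomials modulo a prime\<close>

lemma dvd_prod_diff:
  fixes f g :: "nat \<Rightarrow> 'a :: comm_ring_1"
  assumes "\<And>i. i < n \<Longrightarrow> p dvd f i - g i"
  shows "p dvd (\<Prod>i<n. f i) - (\<Prod>i<n. g i)"
  using assms
proof (induction n)
  case (Suc n)
  have "(\<Prod>i<Suc n. f i) - (\<Prod>i<Suc n. g i)
      = ((\<Prod>i<n. f i) - (\<Prod>i<n. g i)) * f n + (\<Prod>i<n. g i) * (f n - g n)"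
    by (simp add: algebra_simps)
  then show ?case using Suc by simp
qed simp

lemma dvd_det_diff:
  fixes X Y :: "'a :: comm_ring_1 mat"
  assumes X: "X \<in> carrier_mat n n" and Y: "Y \<in> carrier_mat n n"
    and dvd: "\<And>i j. i < n \<Longrightarrow> j < n \<Longrightarrow> p dvd X $$ (i, j) - Y $$ (i, j)"
  shows "p dvd det X - det Y"
proof -
  have "det X - det Y = (\<Sum>\<pi> | \<pi> permutes {0..<n}.
      signof \<pi> * ((\<Prod>i = 0..<n. X $$ (i, \<pi> i)) - (\<Prod>i = 0..<n. Y $$ (i, \<pi> i))))"
    unfolding det_def'[OF X] det_def'[OF Y] by (simp add: sum_subtractf[symmetric] algebra_simps)
  moreover have "p dvd (\<Prod>i = 0..<n. X $$ (i, \<pi> i)) - (\<Prod>i = 0..<n. Y $$ (i, \<pi> i))"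
    if "\<pi> permutes {0..<n}" for \<pi>
    unfolding atLeast0LessThan
    using permutes_in_image[OF that] by (intro dvd_prod_diff dvd) auto
  ultimately show ?thesis by (auto intro!: dvd_sum)
qed

lemma const_poly_sum: "[:\<Sum>k\<in>A. f k:] = (\<Sum>k\<in>A. [:f k:])"
  by (rule poly_eqI) (simp add: coeff_sum coeff_pCons split: nat.split)

text \<open>The matrix \<open>x - M\<close> divides \<open>x\<^sup>j - M\<^sup>j\<close>; take determinants.\<close>

lemma char_poly_dvd_power:
  fixes M :: "'a :: comm_ring_1 mat"
  assumes M: "M \<in> carrier_mat n n"
  shows "char_poly M dvd
    det (mat n n (\<lambda>(i, l). (if i = l then monom 1 j else 0) - [:(M ^\<^sub>m j) $$ (i, l):]))"
    (is "_ dvd det (?X j)")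
proof -
  have cpm: "char_poly_matrix M \<in> carrier_mat n n" using M by simp
  have "\<exists>S\<in>carrier_mat n n. S * char_poly_matrix M = ?X j"
  proof (induction j)
    case 0
    have "0\<^sub>m n n * char_poly_matrix M = 0\<^sub>m n n" by (rule left_mult_zero_mat[OF cpm])
    also have "\<dots> = ?X 0" using M by (intro eq_matI) (auto simp: monom_0)
    finally show ?case by (intro bexI[of _ "0\<^sub>m n n"]) simp_all
  next
    case (Suc j)
    then obtain S where S: "S \<in> carrier_mat n n" "S * char_poly_matrix M = ?X j" by (elim bexE)
    \<comment> \<open>From x^(j+1) - M^(j+1) = x (x^j - M^j) + M^j (x - M): the cofactor S becomes x
      S + M^j.\<close>
    define S' where "S' = mat n n (\<lambda>(i, l). [:0, 1:] * S $$ (i, l) + [:(M ^\<^sub>m j) $$ (i, l):])"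
    have Mj: "M ^\<^sub>m j \<in> carrier_mat n n" using M by simp
    have cpm_sum: "(B * char_poly_matrix M) $$ (i, l)
        = [:0, 1:] * B $$ (i, l) - (\<Sum>k<n. [:M $$ (k, l):] * B $$ (i, k))"
      if "B \<in> carrier_mat n n" "i < n" "l < n" for B i l
    proof -
      have "(B * char_poly_matrix M) $$ (i, l)
          = (\<Sum>k<n. ((if l = k then [:0, 1:] else 0) - [:M $$ (k, l):]) * B $$ (i, k))"
        using that carrier_matD[OF cpm]
        by (auto simp: scalar_prod_def char_poly_matrix_index[OF M] lessThan_atLeast0 intro!: sum.cong)
      also have "\<dots> = [:0, 1:] * B $$ (i, l) - (\<Sum>k<n. [:M $$ (k, l):] * B $$ (i, k))"
        by (rule sum_delta_diff_mult[OF \<open>l < n\<close>])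
      finally show ?thesis .
    qed
    have "S' * char_poly_matrix M = ?X (Suc j)"
    proof (rule eq_matI)
      fix i l assume "i < dim_row (?X (Suc j))" "l < dim_col (?X (Suc j))"
      then have il: "i < n" "l < n" by auto
      have S': "S' \<in> carrier_mat n n" by (simp add: S'_def)
      have "(M ^\<^sub>m Suc j) $$ (i, l) = (\<Sum>k<n. (M ^\<^sub>m j) $$ (i, k) * M $$ (k, l))"
        using il M Mj by (simp add: scalar_prod_def lessThan_atLeast0)
      also have "\<dots> = (\<Sum>k<n. M $$ (k, l) * (M ^\<^sub>m j) $$ (i, k))"
        by (intro sum.cong HOL.refl mult.commute)
      finally have pow: "[:(M ^\<^sub>m Suc j) $$ (i, l):]
          = (\<Sum>k<n. [:M $$ (k, l):] * [:(M ^\<^sub>m j) $$ (i, k):])"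
        by (simp only: const_poly_sum) (simp add: mult.commute)
      have "(S' * char_poly_matrix M) $$ (i, l)
          = [:0, 1:] * ([:0, 1:] * S $$ (i, l) + [:(M ^\<^sub>m j) $$ (i, l):])
            - (\<Sum>k<n. [:M $$ (k, l):] * ([:0, 1:] * S $$ (i, k) + [:(M ^\<^sub>m j) $$ (i, k):]))"
        unfolding cpm_sum[OF S' il] using il by (simp add: S'_def)
      also have "\<dots> = [:0, 1:] * ([:0, 1:] * S $$ (i, l) - (\<Sum>k<n. [:M $$ (k, l):] * S $$ (i, k)))
            + [:0, 1:] * [:(M ^\<^sub>m j) $$ (i, l):] - [:(M ^\<^sub>m Suc j) $$ (i, l):]"
        unfolding pow by (simp only: distrib_left sum.distrib sum_distrib_left right_diff_distrib
            mult.left_commute[of "[:_:]" "[:0, 1:]"]) (simp add: algebra_simps)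
      also have "[:0, 1:] * S $$ (i, l) - (\<Sum>k<n. [:M $$ (k, l):] * S $$ (i, k)) = ?X j $$ (i, l)"
        using cpm_sum[OF S(1) il] S(2) by simp
      also have "[:0, 1:] * ?X j $$ (i, l) + [:0, 1:] * [:(M ^\<^sub>m j) $$ (i, l):] - [:(M ^\<^sub>m Suc j) $$ (i, l):]
          = ?X (Suc j) $$ (i, l)"
        using il by (simp add: monom_Suc right_diff_distrib)
      finally show "(S' * char_poly_matrix M) $$ (i, l) = ?X (Suc j) $$ (i, l)" .
    qed (use carrier_matD[OF cpm] in \<open>auto simp: S'_def\<close>)
    moreover have "S' \<in> carrier_mat n n" by (simp add: S'_def)
    ultimately show ?case by (intro bexI)
  qed
  then obtain S where S: "S \<in> carrier_mat n n" "S * char_poly_matrix M = ?X j" by (elim bexE)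
  have "det (?X j) = det S * char_poly M"
    unfolding S(2)[symmetric] char_poly_def by (rule det_mult[OF S(1) cpm])
  then show ?thesis by (simp only: dvd_triv_right)
qed

text \<open>In F_p[x] a divisor of x^N is a constant times a power of x. The lowest terms of
  \<open>f\<close> and \<open>g\<close> that survive modulo \<open>p\<close>, and likewise the
  highest ones, multiply to a surviving term, so both products sit at exponent N. This pushes the
  lowest surviving exponent of \<open>f\<close> up to \<open>m\<close>.\<close>

lemma monic_dvd_monom_mod:
  fixes f g :: "int poly"
  assumes p: "prime p" and f: "degree f = m" "coeff f m = 1"
    and fg: "\<And>k. [coeff (f * g) k = coeff (monom 1 N) k] (mod int p)"
    and k: "k < m"
  shows "int p dvd coeff f k"
proof (rule ccontr)
  assume nk: "\<not> int p dvd coeff f k"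
  have pp: "prime (int p)" using p by simp
  let ?F = "{k. \<not> int p dvd coeff f k}" and ?G = "{k. \<not> int p dvd coeff g k}"
  define a where "a = (LEAST k. k \<in> ?F)"
  have a: "a \<in> ?F" unfolding a_def by (rule LeastI[of _ k]) (use nk in simp)
  have a_less: "int p dvd coeff f i" if "i < a" for i
    using not_less_Least[of i "\<lambda>k. k \<in> ?F"] that by (auto simp: a_def)
  have "a \<le> k" unfolding a_def by (rule Least_le) (use nk in simp)
  have fin: "finite ?G"
    by (rule finite_subset[of _ "{..degree g}"]) (auto intro: le_degree)
  have coeff_N: "\<not> int p dvd coeff (f * g) N"
  proof
    assume "int p dvd coeff (f * g) N"
    then have "int p dvd 1" using fg[of N] by (simp add: cong_dvd_iff)
    then show False using pp by (simp add: prime_int_iff)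
  qed
  have ne: "?G \<noteq> {}"
  proof
    assume "?G = {}"
    then have "int p dvd coeff (f * g) N" unfolding coeff_mult by (intro dvd_sum) auto
    then show False using coeff_N by blast
  qed
  have index: "j = N" if j: "\<not> int p dvd coeff (f * g) j" for j
    using fg[of j] j by (cases "j = N") (auto simp: cong_dvd_iff)
  define b where "b = (LEAST k. k \<in> ?G)"
  have b: "b \<in> ?G" unfolding b_def using ne by (metis LeastI ex_in_conv)
  have b_less: "int p dvd coeff g i" if "i < b" for i
    using not_less_Least[of i "\<lambda>k. k \<in> ?G"] that by (auto simp: b_def)
  have "a + b = N"
  proof (rule index)
    have "coeff (f * g) (a + b) = coeff f a * coeff g b + (\<Sum>i\<in>{..a + b} - {a}. coeff f i * coeff g (a + b - i))"
      unfolding coeff_mult by (subst sum.remove[of _ a]) auto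
    moreover have "int p dvd (\<Sum>i\<in>{..a + b} - {a}. coeff f i * coeff g (a + b - i))"
    proof (rule dvd_sum)
      fix i assume "i \<in> {..a + b} - {a}"
      then consider "i < a" | "a + b - i < b" by force
      then show "int p dvd coeff f i * coeff g (a + b - i)" using a_less b_less by cases auto
    qed
    moreover have "\<not> int p dvd coeff f a * coeff g b" using a b pp by (simp add: prime_dvd_mult_iff)
    ultimately show "\<not> int p dvd coeff (f * g) (a + b)" by (simp add: dvd_add_left_iff)
  qed
  moreover have "m + Max ?G = N"
  proof (rule index)
    let ?b = "Max ?G"
    have b': "?b \<in> ?G" using fin ne by (rule Max_in)
    have "coeff (f * g) (m + ?b) = coeff f m * coeff g ?b + (\<Sum>i\<in>{..m + ?b} - {m}. coeff f i * coeff g (m + ?b - i))"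
      unfolding coeff_mult by (subst sum.remove[of _ m]) auto
    moreover have "int p dvd (\<Sum>i\<in>{..m + ?b} - {m}. coeff f i * coeff g (m + ?b - i))"
    proof (rule dvd_sum)
      fix i assume "i \<in> {..m + ?b} - {m}"
      then consider "i > m" | "m + ?b - i > ?b" by force
      then show "int p dvd coeff f i * coeff g (m + ?b - i)"
      proof cases
        case 1
        then show ?thesis using f by (simp add: coeff_eq_0)
      next
        case 2
        then have "m + ?b - i \<notin> ?G" using Max_ge[OF fin, of "m + ?b - i"] by linarith
        then show ?thesis by simp
      qed
    qed
    moreover have "\<not> int p dvd coeff f m * coeff g ?b" using f b' by simp
    ultimately show "\<not> int p dvd coeff (f * g) (m + ?b)" by (simp add: dvd_add_left_iff)
  qed
  moreover have "b \<le> Max ?G" using fin b by (rule Max_ge)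
  ultimately show False using \<open>a \<le> k\<close> k by linarith
qed

text \<open>If M^j vanishes modulo \<open>p\<close>, then x^j - M^j is congruent to a scalar matrix
  with determinant x^(jm). The characteristic polynomial divides the determinant of x^j - M^j, so
  modulo \<open>p\<close> it is a monic divisor of x^(jm).\<close>

lemma char_poly_nilpotent_mod:
  fixes M :: "int mat"
  assumes M: "M \<in> carrier_mat m m" and p: "prime p"
    and nil: "\<And>i l. i < m \<Longrightarrow> l < m \<Longrightarrow> int p dvd (M ^\<^sub>m j) $$ (i, l)"
  shows "poly_cong (char_poly M) (monom 1 m) (int p)"
proof -
  let ?X = "mat m m (\<lambda>(i, l). (if i = l then monom 1 j else 0) - [:(M ^\<^sub>m j) $$ (i, l):])"
  let ?Y = "monom 1 j \<cdot>\<^sub>m 1\<^sub>m m :: int poly mat"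
  obtain g where g: "det ?X = char_poly M * g" using char_poly_dvd_power[OF M] by blast
  have "[:int p:] dvd det ?X - det ?Y"
  proof (rule dvd_det_diff)
    fix i l assume il: "i < m" "l < m"
    then have "?X $$ (i, l) - ?Y $$ (i, l) = - [:(M ^\<^sub>m j) $$ (i, l):]" by simp
    then show "[:int p:] dvd ?X $$ (i, l) - ?Y $$ (i, l)"
      using nil[OF il] by (simp add: const_poly_dvd_const_poly_iff)
  qed auto
  moreover have "det ?Y = monom 1 (j * m)" by (simp add: monom_power)
  ultimately have "int p dvd coeff (char_poly M * g - monom 1 (j * m)) k" for k
    unfolding g by (simp add: const_poly_dvd_iff)
  then have cong: "[coeff (char_poly M * g) k = coeff (monom 1 (j * m)) k] (mod int p)" for k
    by (simp add: cong_iff_dvd_diff)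
  have deg: "degree (char_poly M) = m" "coeff (char_poly M) m = 1"
    using degree_monic_char_poly[OF M] by auto
  show ?thesis
    unfolding poly_cong_def
  proof
    fix k
    consider "k < m" | "k = m" | "k > m" by linarith
    then show "[coeff (char_poly M) k = coeff (monom 1 m) k] (mod int p)"
    proof cases
      case 1
      then show ?thesis
        using monic_dvd_monom_mod[OF p deg cong] by (simp add: cong_iff_dvd_diff)
    next
      case 3
      then show ?thesis using deg by (simp add: coeff_eq_0)
    qed (simp add: deg)
  qed
qed

section \<open>Endomorphisms of quotients\<close>

lemma mat_eqI_mult_vec:
  fixes A B :: "'a :: comm_ring_1 mat"
  assumes A: "A \<in> carrier_mat m n" and B: "B \<in> carrier_mat m n"
    and eq: "\<And>v. v \<in> carrier_vec n \<Longrightarrow> A *\<^sub>v v = B *\<^sub>v v"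
  shows "A = B"
proof (rule eq_matI)
  fix i j assume "i < dim_row B" "j < dim_col B"
  then have ij: "i < m" "j < n" using B by auto
  have "(A *\<^sub>v unit_vec n j) $ i = (B *\<^sub>v unit_vec n j) $ i" using eq by simp
  then show "A $$ (i, j) = B $$ (i, j)" using ij A B by simp
qed (use A B in auto)

lemma iso_Zn_matrix:
  assumes h: "h \<in> iso (Zn m) (Zn m')"
  obtains P P' where "m' = m" "P \<in> carrier_mat m m" "P' \<in> carrier_mat m m"
    "P * P' = 1\<^sub>m m" "P' * P = 1\<^sub>m m" "\<And>x. x \<in> carrier_vec m \<Longrightarrow> h x = P *\<^sub>v x"
proof -
  have grp: "group (Zn m)" using comm_group.axioms(2)[OF comm_group_vec] .
  let ?k = "inv_into (carrier_vec m) h"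
  have k: "?k \<in> iso (Zn m') (Zn m)"
    using group.iso_set_sym[OF grp h] by (simp add: monoid_vec_simps)
  have hom: "h \<in> hom (Zn m) (Zn m')" "?k \<in> hom (Zn m') (Zn m)" using h k by (auto simp: iso_def)
  have bij: "bij_betw h (carrier_vec m) (carrier_vec m')"
    using h by (simp add: iso_def monoid_vec_simps)
  define P where "P = mat m' m (\<lambda>(i, j). h (unit_vec m j) $ i)"
  define P' where "P' = mat m m' (\<lambda>(i, j). ?k (unit_vec m' j) $ i)"
  have P: "P \<in> carrier_mat m' m" and P': "P' \<in> carrier_mat m m'" by (simp_all add: P_def P'_def)
  have hP: "h x = P *\<^sub>v x" if "x \<in> carrier_vec m" for x
    unfolding P_def by (rule hom_Zn_matrix[OF hom(1) that])
  have kP: "?k x = P' *\<^sub>v x" if "x \<in> carrier_vec m'" for x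
    unfolding P'_def by (rule hom_Zn_matrix[OF hom(2) that])
  have PP': "P * P' = 1\<^sub>m m'"
  proof (rule mat_eqI_mult_vec)
    fix v :: "int vec" assume v: "v \<in> carrier_vec m'"
    then have kv: "?k v \<in> carrier_vec m" using hom_Zn_simps(1)[OF hom(2)] by blast
    have "(P * P') *\<^sub>v v = P *\<^sub>v (P' *\<^sub>v v)" using P P' v by simp
    also have "\<dots> = h (?k v)" using kP[OF v] hP[OF kv] by simp
    also have "\<dots> = v" using bij_betw_inv_into_right[OF bij v] .
    finally show "(P * P') *\<^sub>v v = 1\<^sub>m m' *\<^sub>v v" using v by simp
  qed (use P P' in auto)
  have P'P: "P' * P = 1\<^sub>m m"
  proof (rule mat_eqI_mult_vec)
    fix v :: "int vec" assume v: "v \<in> carrier_vec m"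
    then have hv: "h v \<in> carrier_vec m'" using hom_Zn_simps(1)[OF hom(1)] by blast
    have "(P' * P) *\<^sub>v v = P' *\<^sub>v (P *\<^sub>v v)" using P P' v by simp
    also have "\<dots> = ?k (h v)" using kP[OF hv] hP[OF v] by simp
    also have "\<dots> = v" using bij_betw_inv_into_left[OF bij v] .
    finally show "(P' * P) *\<^sub>v v = 1\<^sub>m m *\<^sub>v v" using v by simp
  qed (use P P' in auto)
  \<comment> \<open>The ranks agree because both are traces: m = tr(P' P) = tr(P P') = m'.\<close>
  have "int m = (\<Sum>i<m. (P' * P) $$ (i, i))" unfolding P'P by simp
  also have "\<dots> = (\<Sum>i<m. \<Sum>j<m'. P' $$ (i, j) * P $$ (j, i))"
    using P P' by (simp add: scalar_prod_def lessThan_atLeast0)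
  also have "\<dots> = (\<Sum>j<m'. \<Sum>i<m. P $$ (j, i) * P' $$ (i, j))"
    by (subst sum.swap) (simp add: mult.commute)
  also have "\<dots> = (\<Sum>j<m'. (P * P') $$ (j, j))"
    using P P' by (simp add: scalar_prod_def lessThan_atLeast0)
  also have "\<dots> = int m'" unfolding PP' by simp
  finally have "m' = m" by simp
  then show ?thesis using that P P' PP' P'P hP by simp
qed

lemma free_rank_eq:
  assumes "group Q" "h \<in> iso Q (Zn m)"
  shows "free_rank Q = m"
  unfolding free_rank_def
proof (rule the_equality)
  show "Q \<cong> Zn m" using assms(2) by (auto simp: is_iso_def)
  fix m' assume "Q \<cong> Zn m'"
  then obtain h' where "h' \<in> iso Q (Zn m')" by (auto simp: is_iso_def)
  then have "h' \<circ> inv_into (carrier Q) h \<in> iso (Zn m) (Zn m')"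
    by (rule iso_set_trans[OF group.iso_set_sym[OF assms]])
  then show "m' = m" by (rule iso_Zn_matrix)
qed

text \<open>Two coordinate systems differ by an isomorphism of Z^m, hence by an invertible integer
  matrix, so the representing matrices are similar. This gives the definite description
  \<open>endo_char_poly\<close> its value.\<close>

lemma represents_endo_char_poly_unique:
  assumes Q: "group Q" and \<psi>: "\<psi> \<in> carrier Q \<rightarrow> carrier Q"
    and r: "represents_endo Q \<psi> m M" "represents_endo Q \<psi> m' M'"
  shows "char_poly M' = char_poly M"
proof -
  obtain h h' where h: "h \<in> iso Q (Zn m)" "\<And>x. x \<in> carrier Q \<Longrightarrow> h (\<psi> x) = M *\<^sub>v h x"
    and h': "h' \<in> iso Q (Zn m')" "\<And>x. x \<in> carrier Q \<Longrightarrow> h' (\<psi> x) = M' *\<^sub>v h' x"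
    and M: "M \<in> carrier_mat m m" "M' \<in> carrier_mat m' m'"
    using r unfolding represents_endo_def by blast
  define \<theta> where "\<theta> = h' \<circ> inv_into (carrier Q) h"
  have \<theta>: "\<theta> \<in> iso (Zn m) (Zn m')"
    unfolding \<theta>_def using iso_set_trans[OF group.iso_set_sym[OF Q h(1)] h'(1)] .
  obtain P P' where eq: "m' = m" and P: "P \<in> carrier_mat m m" "P' \<in> carrier_mat m m"
    "P * P' = 1\<^sub>m m" "P' * P = 1\<^sub>m m" "\<And>x. x \<in> carrier_vec m \<Longrightarrow> \<theta> x = P *\<^sub>v x"
    using iso_Zn_matrix[OF \<theta>] by blast
  have bij: "bij_betw h (carrier Q) (carrier_vec m)"
    using h(1) by (simp add: iso_def monoid_vec_simps)
  have \<theta>h: "\<theta> (h x) = h' x" if "x \<in> carrier Q" for x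
  proof -
    have "h x \<in> carrier_vec m" using that bij by (auto simp: bij_betw_def)
    then show ?thesis
      using bij_betw_inv_into_left[OF bij that] by (simp add: \<theta>_def)
  qed
  have "P * M = M' * P"
  proof (rule mat_eqI_mult_vec)
    fix v :: "int vec" assume v: "v \<in> carrier_vec m"
    then obtain x where x: "x \<in> carrier Q" "v = h x" using bij by (auto simp: bij_betw_def)
    have \<psi>x: "\<psi> x \<in> carrier Q" using \<psi> x(1) by (rule funcset_mem)
    then have h\<psi>: "h (\<psi> x) \<in> carrier_vec m" using bij by (auto simp: bij_betw_def)
    have "(P * M) *\<^sub>v v = P *\<^sub>v h (\<psi> x)" using P(1) M v x h(2) by simp
    also have "\<dots> = \<theta> (h (\<psi> x))" using P(5)[OF h\<psi>] by simp
    also have "\<dots> = h' (\<psi> x)" using \<theta>h[OF \<psi>x] .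
    also have "\<dots> = M' *\<^sub>v h' x" using h'(2) x(1) .
    also have "h' x = P *\<^sub>v v" using \<theta>h[OF x(1)] P(5)[OF v] x(2) by simp
    finally show "(P * M) *\<^sub>v v = (M' * P) *\<^sub>v v" using P(1) M eq v by simp
  qed (use P M eq in auto)
  then have "P' * (M' * P) = P' * (P * M)" by simp
  also have "\<dots> = (P' * P) * M" by (rule assoc_mult_mat[OF P(2,1) M(1), symmetric])
  also have "\<dots> = M" unfolding P(4) by (rule left_mult_one_mat[OF M(1)])
  also have "P' * (M' * P) = P' * M' * P"
    using assoc_mult_mat[OF P(2) _ P(1), of M'] M(2) eq by simp
  finally have "M = P' * M' * P" by simp
  then have "similar_mat M M'"
    by (intro similar_matI[of _ _ P' P m]) (use P M eq in auto)
  then show ?thesis using char_poly_similar by metis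
qed

text \<open>By purity H / N embeds into some Z^k, and its image there is free; \<open>q\<close> is
  the quotient map written in a basis of that image. Later arguments see a layer only through
  \<open>q\<close> and \<open>M\<close> and never touch cosets.\<close>

lemma quotient_of_Zn_representation:
  assumes H: "subgroup H (Zn n)" and N: "subgroup N (Zn n)" "N \<subseteq> H"
    and pure: "\<And>c a. c \<noteq> 0 \<Longrightarrow> a \<in> carrier_vec n \<Longrightarrow> c \<cdot>\<^sub>v a \<in> N \<Longrightarrow> a \<in> N"
    and \<phi>: "\<phi> \<in> hom (Zn n) (Zn n)" "\<phi> ` H \<subseteq> H" "\<phi> ` N \<subseteq> N"
  obtains m M q where "M \<in> carrier_mat m m" "q ` H = carrier_vec m"
    "\<And>x y. x \<in> H \<Longrightarrow> y \<in> H \<Longrightarrow> q (x + y) = q x + q y"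
    "\<And>c x. x \<in> H \<Longrightarrow> q (c \<cdot>\<^sub>v x) = c \<cdot>\<^sub>v q x"
    "\<And>x. x \<in> H \<Longrightarrow> q x = 0\<^sub>v m \<longleftrightarrow> x \<in> N"
    "\<And>x. x \<in> H \<Longrightarrow> q (\<phi> x) = M *\<^sub>v q x"
    "free_rank (quotient_group (Zn n) H N) = m"
    "endo_char_poly (quotient_group (Zn n) H N) (quotient_endo (Zn n) N \<phi>) = char_poly M"
proof -
  have "\<exists>k. \<exists>q1\<in>hom (Zn n) (Zn k). \<forall>x\<in>carrier_vec n. q1 x = 0\<^sub>v k \<longleftrightarrow> x \<in> N"
    by (rule pure_subgroup_is_kernel[OF N(1)]) (rule pure)
  then obtain k q1 where q1: "q1 \<in> hom (Zn n) (Zn k)"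
    and q1_zero: "\<forall>x\<in>carrier_vec n. q1 x = 0\<^sub>v k \<longleftrightarrow> x \<in> N"
    by (elim exE bexE)
  have grp: "group (Zn j)" for j using comm_group.axioms(2)[OF comm_group_vec] .
  have Hc: "x \<in> carrier_vec n" if "x \<in> H" for x using H that by (auto simp: subgroup_monoid_vec_iff)
  have Hadd: "x + y \<in> H" if "x \<in> H" "y \<in> H" for x y
    using H that by (simp add: subgroup_monoid_vec_iff)
  have "group_hom (Zn n) (Zn k) q1" using grp q1 by (simp add: group_hom_def group_hom_axioms_def)
  then have "subgroup (q1 ` H) (Zn k)" using group_hom.subgroup_img_is_subgroup H by blast
  then have "\<exists>m. \<exists>s\<in>hom (Zn m) (Zn k). inj_on s (carrier_vec m) \<and> s ` carrier_vec m = q1 ` H"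
    by (rule subgroup_Zn_is_free)
  then obtain m s where s: "s \<in> hom (Zn m) (Zn k)" "inj_on s (carrier_vec m)" "s ` carrier_vec m = q1 ` H"
    by (elim exE bexE conjE)
  define q where "q x = inv_into (carrier_vec m) s (q1 x)" for x
  have q_closed: "q x \<in> carrier_vec m" and sq: "s (q x) = q1 x" if "x \<in> H" for x
  proof -
    have "q1 x \<in> s ` carrier_vec m" using s(3) that by simp
    then show "q x \<in> carrier_vec m" "s (q x) = q1 x"
      unfolding q_def by (auto intro: inv_into_into f_inv_into_f)
  qed
  have q_eqI: "q x = y" if "x \<in> H" "y \<in> carrier_vec m" "q1 x = s y" for x y
    using inj_onD[OF s(2)] sq q_closed that by metis
  have q_add: "q (x + y) = q x + q y" if "x \<in> H" "y \<in> H" for x y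
    using that q_closed
    by (intro q_eqI) (simp_all add: Hadd hom_Zn_simps(2)[OF s(1)] hom_Zn_simps(2)[OF q1] Hc sq)
  have q_smult: "q (c \<cdot>\<^sub>v x) = c \<cdot>\<^sub>v q x" if "x \<in> H" for c x
    using that q_closed subgroup_Zn_smult[OF H]
    by (intro q_eqI) (simp_all add: hom_Zn_smult[OF s(1)] hom_Zn_smult[OF q1] Hc sq)
  have q_zero: "q x = 0\<^sub>v m \<longleftrightarrow> x \<in> N" if "x \<in> H" for x
  proof -
    have "q x = 0\<^sub>v m \<longleftrightarrow> s (q x) = s (0\<^sub>v m)"
      using inj_onD[OF s(2)] q_closed[OF that] zero_carrier_vec by metis
    then show ?thesis using sq[OF that] hom_Zn_zero[OF s(1)] bspec[OF q1_zero Hc[OF that]] by simp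
  qed
  have q_onto: "q ` H = carrier_vec m"
  proof
    show "q ` H \<subseteq> carrier_vec m" using q_closed by blast
    show "carrier_vec m \<subseteq> q ` H"
    proof
      fix y :: "int vec" assume y: "y \<in> carrier_vec m"
      then obtain x where x: "x \<in> H" "s y = q1 x" using s(3) by (metis imageE imageI)
      then show "y \<in> q ` H" using q_eqI[OF x(1) y] by auto
    qed
  qed
  let ?G = "(Zn n)\<lparr>carrier := H\<rparr>"
  have G: "group ?G" using group.subgroup_imp_group[OF grp H] .
  have qhom: "q \<in> hom ?G (Zn m)"
    by (rule homI) (use q_closed q_add in \<open>auto simp: monoid_vec_simps\<close>)
  interpret q: group_hom ?G "Zn m" q
    using G grp qhom by (simp add: group_hom_def group_hom_axioms_def)
  have kernel: "kernel ?G (Zn m) q = N"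
    using q_zero N(2) by (auto simp: kernel_def monoid_vec_simps)
  let ?Q = "quotient_group (Zn n) H N" and ?\<psi> = "quotient_endo (Zn n) N \<phi>"
  have Q: "group ?Q"
    unfolding quotient_group_def kernel[symmetric] by (rule normal.factorgroup_is_group[OF q.normal_kernel])
  let ?h = "\<lambda>X. the_elem (q ` X)"
  have iso: "?h \<in> iso ?Q (Zn m)"
    unfolding quotient_group_def kernel[symmetric]
    by (rule q.FactGroup_iso_set) (simp add: q_onto monoid_vec_simps)
  have carQ: "carrier ?Q = (\<lambda>x. N #>\<^bsub>Zn n\<^esub> x) ` H"
    by (auto simp: quotient_group_def FactGroup_def RCOSETS_def r_coset_def)
  have coset_mem: "x \<in> N #>\<^bsub>Zn n\<^esub> x" if "x \<in> H" for x
    using N(1) Hc[OF that] by (auto simp: r_coset_def monoid_vec_simps subgroup_monoid_vec_iff intro!: bexI[of _ "0\<^sub>v n"])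
  have coset_q: "a \<in> H \<and> q a = q x" if x: "x \<in> H" and a: "a \<in> N #>\<^bsub>Zn n\<^esub> x" for x a
  proof -
    obtain b where b: "b \<in> N" "a = b + x" using a by (auto simp: r_coset_def monoid_vec_simps)
    have "b \<in> H" using b N(2) by blast
    moreover have "q b = 0\<^sub>v m" using b q_zero[OF \<open>b \<in> H\<close>] by simp
    ultimately have "q a = q x" using q_add[OF \<open>b \<in> H\<close> x] q_closed[OF x] b(2) by simp
    then show ?thesis using Hadd[OF \<open>b \<in> H\<close> x] b(2) by simp
  qed
  have hq: "?h (N #>\<^bsub>Zn n\<^esub> x) = q x" if x: "x \<in> H" for x
  proof (rule the_elem_image_unique)
    show "N #>\<^bsub>Zn n\<^esub> x \<noteq> {}" using coset_mem[OF x] by blast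
    show "q a = q x" if "a \<in> N #>\<^bsub>Zn n\<^esub> x" for a using coset_q[OF x that] by simp
  qed
  have \<phi>c: "\<phi> x \<in> H" if "x \<in> H" for x using \<phi>(2) that by blast
  have \<psi>: "?\<psi> (N #>\<^bsub>Zn n\<^esub> x) = N #>\<^bsub>Zn n\<^esub> \<phi> x" if x: "x \<in> H" for x
  proof -
    have "N #>\<^bsub>Zn n\<^esub> \<phi> a = N #>\<^bsub>Zn n\<^esub> \<phi> x" if a: "a \<in> N #>\<^bsub>Zn n\<^esub> x" for a
    proof -
      obtain b where b: "b \<in> N" "a = b + x" using a by (auto simp: r_coset_def monoid_vec_simps)
      have "\<phi> a = \<phi> b + \<phi> x" using b N(2) Hc x hom_Zn_simps(2)[OF \<phi>(1)] by auto
      moreover have "\<phi> b \<in> N" using b \<phi>(3) by blast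
      ultimately have "\<phi> a \<in> N #>\<^bsub>Zn n\<^esub> \<phi> x" by (auto simp: r_coset_def monoid_vec_simps)
      then show ?thesis
        using group.repr_independence[OF grp _ _ N(1), of "\<phi> a" "\<phi> x"] Hc[OF \<phi>c[OF x]]
        by (simp add: monoid_vec_simps)
    qed
    then show ?thesis unfolding quotient_endo_def using coset_mem[OF x] by blast
  qed
  have q_cong: "q (\<phi> x) = q (\<phi> y)" if xy: "x \<in> H" "y \<in> H" "q x = q y" for x y
  proof -
    have my: "- y \<in> H" using H xy by (simp add: subgroup_monoid_vec_iff)
    have "x - y = x + (-1) \<cdot>\<^sub>v y" using Hc xy by (intro eq_vecI) auto
    then have "q (x - y) = q x + (-1) \<cdot>\<^sub>v q y"
      using q_add[OF xy(1) subgroup_Zn_smult[OF H xy(2)]] q_smult[OF xy(2)] by simp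
    also have "\<dots> = 0\<^sub>v m" using xy(3) q_closed[OF xy(2)] by (intro eq_vecI) auto
    finally have "q (x - y) = 0\<^sub>v m" .
    then have d: "x - y \<in> N" using q_zero subgroup_vec_minus[OF H xy(1,2)] by blast
    have "x = (x - y) + y" using Hc[OF xy(1)] Hc[OF xy(2)] by (intro eq_vecI) auto
    then have "\<phi> x = \<phi> (x - y) + \<phi> y"
      using hom_Zn_simps(2)[OF \<phi>(1), of "x - y" y] Hc[OF xy(1)] Hc[OF xy(2)] by simp
    moreover have dN: "\<phi> (x - y) \<in> N" using d \<phi>(3) by blast
    moreover have dH: "\<phi> (x - y) \<in> H" using dN N(2) by blast
    ultimately have "q (\<phi> x) = 0\<^sub>v m + q (\<phi> y)"
      using q_add[OF dH \<phi>c[OF xy(2)]] q_zero[OF dH] by simp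
    then show ?thesis using q_closed[OF \<phi>c[OF xy(2)]] by simp
  qed
  \<comment> \<open>The map induced by \<open>\<phi>\<close> on Z^m; \<open>q_cong\<close> makes the
    chosen preimage irrelevant.\<close>
  define g where "g y = q (\<phi> (inv_into H q y))" for y
  have g: "g (q x) = q (\<phi> x)" if "x \<in> H" for x
    unfolding g_def using that by (intro q_cong) (auto intro: inv_into_into f_inv_into_f)
  have q_ex: "\<exists>x\<in>H. y = q x" if "y \<in> carrier (Zn m)" for y
    using that q_onto by (auto simp: monoid_vec_simps)
  have g_hom: "g \<in> hom (Zn m) (Zn m)"
  proof (rule homI)
    fix y assume "y \<in> carrier (Zn m)"
    then obtain x where "x \<in> H" "y = q x" using q_ex by blast
    then show "g y \<in> carrier (Zn m)" using g \<phi>c q_closed by (simp add: monoid_vec_simps)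
  next
    fix y y' assume "y \<in> carrier (Zn m)" "y' \<in> carrier (Zn m)"
    then obtain x x' where x: "x \<in> H" "y = q x" "x' \<in> H" "y' = q x'" using q_ex by meson
    have "g (y + y') = g (q (x + x'))" by (simp only: x(2,4) q_add[OF x(1,3)])
    also have "\<dots> = q (\<phi> x + \<phi> x')"
      by (simp only: g[OF Hadd[OF x(1,3)]] hom_Zn_simps(2)[OF \<phi>(1) Hc[OF x(1)] Hc[OF x(3)]])
    also have "\<dots> = g y + g y'"
      by (simp only: x(2,4) g[OF x(1)] g[OF x(3)] q_add[OF \<phi>c[OF x(1)] \<phi>c[OF x(3)]])
    finally show "g (y \<otimes>\<^bsub>Zn m\<^esub> y') = g y \<otimes>\<^bsub>Zn m\<^esub> g y'" by (simp add: monoid_vec_simps)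
  qed
  define M where "M = mat m m (\<lambda>(i, j). g (unit_vec m j) $ i)"
  have M: "M \<in> carrier_mat m m" by (simp add: M_def)
  have gM: "g y = M *\<^sub>v y" if "y \<in> carrier_vec m" for y
    unfolding M_def by (rule hom_Zn_matrix[OF g_hom that])
  have qM: "q (\<phi> x) = M *\<^sub>v q x" if "x \<in> H" for x using gM[OF q_closed[OF that]] g[OF that] by simp
  have rep: "represents_endo ?Q ?\<psi> m M"
    unfolding represents_endo_def
  proof (intro conjI bexI[OF _ iso] ballI M)
    fix X assume "X \<in> carrier ?Q"
    then obtain x where "x \<in> H" "X = N #>\<^bsub>Zn n\<^esub> x" using carQ by blast
    then show "?h (?\<psi> X) = M *\<^sub>v ?h X" using \<psi> hq \<phi>c qM by simp
  qed
  have \<psi>_closed: "?\<psi> \<in> carrier ?Q \<rightarrow> carrier ?Q"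
  proof
    fix X assume "X \<in> carrier ?Q"
    then obtain x where x: "x \<in> H" "X = N #>\<^bsub>Zn n\<^esub> x" using carQ by blast
    then show "?\<psi> X \<in> carrier ?Q" using \<psi>[OF x(1)] \<phi>c[OF x(1)] carQ by simp
  qed
  have "endo_char_poly ?Q ?\<psi> = char_poly M"
    unfolding endo_char_poly_def
  proof (rule the_equality)
    show "\<exists>m' M'. represents_endo ?Q ?\<psi> m' M' \<and> char_poly M = char_poly M'" using rep by blast
    fix f assume "\<exists>m' M'. represents_endo ?Q ?\<psi> m' M' \<and> f = char_poly M'"
    then show "f = char_poly M" using represents_endo_char_poly_unique[OF Q \<psi>_closed rep] by auto
  qed
  then show ?thesis
    using that[OF M q_onto q_add q_smult q_zero qM free_rank_eq[OF Q iso]] by blast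
qed

section \<open>Collapsing vectors\<close>

definition vec_dvd :: "int \<Rightarrow> int vec \<Rightarrow> bool" where
  "vec_dvd d x \<longleftrightarrow> (\<forall>i<dim_vec x. d dvd x $ i)"

lemma vec_dvd_iff_smult:
  "vec_dvd d x \<longleftrightarrow> (\<exists>c\<in>carrier_vec (dim_vec x). x = d \<cdot>\<^sub>v c)"
proof
  assume x: "vec_dvd d x"
  show "\<exists>c\<in>carrier_vec (dim_vec x). x = d \<cdot>\<^sub>v c"
  proof (cases "d = 0")
    case True
    then show ?thesis using x by (intro bexI[of _ "0\<^sub>v (dim_vec x)"]) (auto simp: vec_dvd_def)
  next
    case False
    then have "x = d \<cdot>\<^sub>v vec (dim_vec x) (\<lambda>i. x $ i div d)"
      using x by (intro eq_vecI) (auto simp: vec_dvd_def)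
    then show ?thesis by (intro bexI[of _ "vec (dim_vec x) (\<lambda>i. x $ i div d)"]) simp_all
  qed
next
  assume "\<exists>c\<in>carrier_vec (dim_vec x). x = d \<cdot>\<^sub>v c"
  then obtain c where "c \<in> carrier_vec (dim_vec x)" "x = d \<cdot>\<^sub>v c" by blast
  then show "vec_dvd d x" by (metis carrier_vecD dvd_triv_left index_smult_vec(1) vec_dvd_def)
qed

lemma vec_dvd_smult [simp]: "vec_dvd d (d \<cdot>\<^sub>v x)"
  by (simp add: vec_dvd_def)

lemma vec_dvd_add:
  "x \<in> carrier_vec n \<Longrightarrow> y \<in> carrier_vec n \<Longrightarrow> vec_dvd d x \<Longrightarrow> vec_dvd d y \<Longrightarrow> vec_dvd d (x + y)"
  by (auto simp: vec_dvd_def)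

lemma vec_dvd_uminus: "vec_dvd d x \<Longrightarrow> vec_dvd d (- x)"
  by (auto simp: vec_dvd_def)

lemma vec_dvd_smult_right: "vec_dvd d x \<Longrightarrow> vec_dvd d (c \<cdot>\<^sub>v x)"
  by (auto simp: vec_dvd_def)

lemma vec_dvd_hom:
  assumes h: "h \<in> hom (Zn m) (Zn n)" and x: "x \<in> carrier_vec m" "vec_dvd d x"
  shows "vec_dvd d (h x)"
proof -
  obtain c where "c \<in> carrier_vec m" "x = d \<cdot>\<^sub>v c" using x by (auto simp: vec_dvd_iff_smult)
  then show ?thesis using hom_Zn_smult[OF h] by simp
qed

lemma funpow_hom_Zn:
  assumes "h \<in> hom (Zn n) (Zn n)" shows "h ^^ j \<in> hom (Zn n) (Zn n)"
proof (induction j)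
  case 0
  show ?case by (auto simp: hom_def)
next
  case (Suc j)
  then show ?case using assms by (auto simp: hom_def Pi_iff)
qed

lemma mult_mat_vec_hom:
  assumes "M \<in> carrier_mat m n" shows "(*\<^sub>v) M \<in> hom (Zn n) (Zn m)"
  using assms by (auto simp: hom_def monoid_vec_simps mult_add_distrib_mat_vec)

lemma pow_mat_mult_vec:
  assumes M: "M \<in> carrier_mat n n" and v: "v \<in> carrier_vec n"
  shows "(M ^\<^sub>m j) *\<^sub>v v = ((*\<^sub>v) M ^^ j) v"
  using v
proof (induction j arbitrary: v)
  case 0
  then show ?case using M by simp
next
  case (Suc j)
  have "M ^\<^sub>m j \<in> carrier_mat n n" using M by simp
  then have "(M ^\<^sub>m Suc j) *\<^sub>v v = (M ^\<^sub>m j) *\<^sub>v (M *\<^sub>v v)"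
    using assoc_mult_mat_vec[OF _ M Suc.prems] by simp
  also have "\<dots> = ((*\<^sub>v) M ^^ j) (M *\<^sub>v v)" using M Suc.prems by (intro Suc.IH) simp
  finally show ?case by (simp add: funpow_swap1)
qed

lemma vec_eq_uminusI:
  fixes x y :: "'a :: ab_group_add vec"
  assumes "x \<in> carrier_vec n" "y \<in> carrier_vec n" "x + y = 0\<^sub>v n"
  shows "x = - y"
proof (rule eq_vecI)
  fix i assume "i < dim_vec (- y)"
  then have i: "i < n" using assms by simp
  have "(x + y) $ i = 0" unfolding assms(3) using i by simp
  then show "x $ i = (- y) $ i" using i assms(1,2) by (simp add: eq_neg_iff_add_eq_0)
qed (use assms in simp)

text \<open>The vectors whose images under iterates of \<open>\<phi>\<close> become divisible by arbitrarily high powers of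
  \<open>p\<close>, the only obstruction to separability.\<close>

definition collapsing :: "nat \<Rightarrow> (int vec \<Rightarrow> int vec) \<Rightarrow> nat \<Rightarrow> int vec set" where
  "collapsing n \<phi> p = {a \<in> carrier_vec n. \<forall>k. \<exists>j. vec_dvd (int p ^ k) ((\<phi> ^^ j) a)}"

text \<open>By injectivity F h(F) = 0 forces h(F) = 0, so factors x can be cancelled from an
  annihilating polynomial until its constant term is nonzero.\<close>

lemma poly_act_cancel_X:
  fixes F :: "'a :: comm_ring_1 mat"
  assumes F: "F \<in> carrier_mat n n"
    and inj: "\<And>v. v \<in> carrier_vec n \<Longrightarrow> F *\<^sub>v v = 0\<^sub>v n \<Longrightarrow> v = 0\<^sub>v n"
    and g: "g \<noteq> 0" "\<And>v. v \<in> carrier_vec n \<Longrightarrow> poly_act F g v = 0\<^sub>v n"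
  shows "\<exists>g'. coeff g' 0 \<noteq> 0 \<and> (\<forall>v\<in>carrier_vec n. poly_act F g' v = 0\<^sub>v n)"
  using g
proof (induction g)
  case (pCons c h)
  show ?case
  proof (cases "c = 0")
    case True
    have "poly_act F h v = 0\<^sub>v n" if v: "v \<in> carrier_vec n" for v
    proof (rule inj)
      show hv: "poly_act F h v \<in> carrier_vec n" using F v by simp
      have "0\<^sub>v n = 0 \<cdot>\<^sub>v v + F *\<^sub>v poly_act F h v"
        using pCons.prems(2)[OF v] True by (simp add: poly_act_pCons[OF F v])
      also have "\<dots> = F *\<^sub>v poly_act F h v" using F v hv by (intro eq_vecI) auto
      finally show "F *\<^sub>v poly_act F h v = 0\<^sub>v n" by simp
    qed
    moreover have "h \<noteq> 0" using pCons.prems(1) True by simp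
    ultimately show ?thesis using pCons.IH by blast
  next
    case False
    then show ?thesis using pCons.prems(2) by (intro exI[of _ "pCons c h"]) simp
  qed
qed simp

lemma poly_act_hom:
  assumes "M \<in> carrier_mat n n"
  shows "poly_act M f \<in> hom (Zn n) (Zn n)"
  using assms by (auto simp: hom_def monoid_vec_simps poly_act_vec_add)

lemma Cayley_Hamilton:
  fixes M :: "int mat"
  assumes M: "M \<in> carrier_mat n n" and v: "v \<in> carrier_vec n"
  shows "poly_act M (char_poly M) v = 0\<^sub>v n"
proof -
  have "mat n n (\<lambda>(i, j). poly_act M (char_poly M) (unit_vec n j) $ i) = 0\<^sub>m n n"
    using Cayley_Hamilton_unit_vec[OF M] by (intro eq_matI) auto
  then have "poly_act M (char_poly M) v = 0\<^sub>m n n *\<^sub>v v"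
    using hom_Zn_matrix[OF poly_act_hom[OF M] v] by metis
  also have "\<dots> = 0\<^sub>v n" using v by (intro eq_vecI) auto
  finally show ?thesis .
qed

lemma collapsing_nontrivial:
  assumes \<phi>: "\<phi> \<in> hom (Zn n) (Zn n)"
    and H: "subgroup H (Zn n)" "\<phi> ` H \<subseteq> H" and N: "subgroup N (Zn n)" "N \<subset> H"
    and pure: "\<And>c a. c \<noteq> 0 \<Longrightarrow> a \<in> carrier_vec n \<Longrightarrow> c \<cdot>\<^sub>v a \<in> N \<Longrightarrow> a \<in> N"
    and M: "M \<in> carrier_mat m m"
    and q: "q ` H \<subseteq> carrier_vec m" "\<And>x y. x \<in> H \<Longrightarrow> y \<in> H \<Longrightarrow> q (x + y) = q x + q y"
      "\<And>c x. x \<in> H \<Longrightarrow> q (c \<cdot>\<^sub>v x) = c \<cdot>\<^sub>v q x" "\<And>x. x \<in> H \<Longrightarrow> q x = 0\<^sub>v m \<longleftrightarrow> x \<in> N"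
      "\<And>x. x \<in> H \<Longrightarrow> q (\<phi> x) = M *\<^sub>v q x"
    and cong: "poly_cong (char_poly M) (monom 1 m) (int p)"
  shows "\<exists>a\<in>collapsing n \<phi> p. a \<noteq> 0\<^sub>v n"
proof -
  define P where "P = mat n n (\<lambda>(i, j). \<phi> (unit_vec n j) $ i)"
  have P: "P \<in> carrier_mat n n" by (simp add: P_def)
  have \<phi>P: "\<phi> x = P *\<^sub>v x" if "x \<in> carrier_vec n" for x
    unfolding P_def by (rule hom_Zn_matrix[OF \<phi> that])
  let ?f = "char_poly M"
  define F where "F = mat n n (\<lambda>(i, j). poly_act P ?f (unit_vec n j) $ i)"
  have F: "F \<in> carrier_mat n n" by (simp add: F_def)
  have FP: "F *\<^sub>v x = poly_act P ?f x" if "x \<in> carrier_vec n" for x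
    unfolding F_def by (rule hom_Zn_matrix[OF poly_act_hom[OF P] that, symmetric])
  have Hc: "H \<subseteq> carrier_vec n" "0\<^sub>v n \<in> H" and Hadd: "\<And>x y. x \<in> H \<Longrightarrow> y \<in> H \<Longrightarrow> x + y \<in> H"
    using H(1) by (auto simp: subgroup_monoid_vec_iff)
  note Hsmult = subgroup_Zn_smult[OF H(1)]
  have HP: "P *\<^sub>v x \<in> H" if x: "x \<in> H" for x
  proof -
    have "x \<in> carrier_vec n" using Hc(1) x by blast
    then have "P *\<^sub>v x = \<phi> x" by (simp add: \<phi>P)
    then show ?thesis using H(2) x by auto
  qed
  have FN: "F *\<^sub>v x \<in> N" if x: "x \<in> H" for x
  proof -
    have xc: "x \<in> carrier_vec n" and qx: "q x \<in> carrier_vec m" using Hc(1) q(1) x by auto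
    have mem: "poly_act P ?f x \<in> H" by (rule poly_act_in_subgroup[OF P Hc x Hadd Hsmult HP])
    have "q (poly_act P ?f x) = poly_act M ?f (q x)"
    proof (rule poly_act_intertwine[OF P M Hc x Hadd Hsmult HP])
      fix y assume y: "y \<in> H"
      show "q y \<in> carrier_vec m" using q(1) y by blast
      show "q (P *\<^sub>v y) = M *\<^sub>v q y" using q(5)[OF y] \<phi>P[of y] Hc(1) y by auto
    qed (use q in auto)
    also have "\<dots> = 0\<^sub>v m" by (rule Cayley_Hamilton[OF M qx])
    finally show ?thesis using q(4)[OF mem] FP[OF xc] by simp
  qed
  \<comment> \<open>In place of a rank count: if \<open>F\<close> were injective, some polynomial c
    + x h with nonzero c would annihilate it. For \<open>a\<close> in \<open>H\<close> outside
    \<open>N\<close>, c a = - F h(F) a lies in \<open>N\<close>, and purity puts \<open>a\<close>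
    itself into \<open>N\<close>.\<close>
  have "\<exists>a\<in>carrier_vec n. a \<noteq> 0\<^sub>v n \<and> F *\<^sub>v a = 0\<^sub>v n"
  proof (rule ccontr)
    assume "\<not> ?thesis"
    then have inj: "\<And>v. v \<in> carrier_vec n \<Longrightarrow> F *\<^sub>v v = 0\<^sub>v n \<Longrightarrow> v = 0\<^sub>v n" by blast
    have "char_poly F \<noteq> 0" using degree_monic_char_poly[OF F] by auto
    then obtain g where g: "coeff g 0 \<noteq> 0" "\<forall>v\<in>carrier_vec n. poly_act F g v = 0\<^sub>v n"
      using poly_act_cancel_X[OF F inj _ Cayley_Hamilton[OF F]] by blast
    obtain c h where gc: "g = pCons c h" by (cases g)
    then have c: "c \<noteq> 0" using g(1) by simp
    obtain a where a: "a \<in> H" "a \<notin> N" using N(2) by blast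
    have ac: "a \<in> carrier_vec n" using a Hc by blast
    have FH: "F *\<^sub>v x \<in> H" if "x \<in> H" for x using FN[OF that] N(2) by blast
    have "poly_act F h a \<in> H" by (rule poly_act_in_subgroup[OF F Hc a(1) Hadd Hsmult FH])
    then have y: "F *\<^sub>v poly_act F h a \<in> N" by (rule FN)
    have "c \<cdot>\<^sub>v a + F *\<^sub>v poly_act F h a = 0\<^sub>v n"
      using bspec[OF g(2) ac] by (simp add: gc poly_act_pCons[OF F ac])
    moreover have "F *\<^sub>v poly_act F h a \<in> carrier_vec n" using F ac by auto
    ultimately have "c \<cdot>\<^sub>v a = - (F *\<^sub>v poly_act F h a)"
      using vec_eq_uminusI[of "c \<cdot>\<^sub>v a" n] ac by simp
    then have "c \<cdot>\<^sub>v a \<in> N" using y N(1) by (simp add: subgroup_monoid_vec_iff)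
    then show False using pure[OF c ac] a(2) by blast
  qed
  then obtain a where a: "a \<in> carrier_vec n" "a \<noteq> 0\<^sub>v n" "F *\<^sub>v a = 0\<^sub>v n" by blast
  have "[:int p:] dvd ?f - monom 1 m"
    using cong by (simp add: const_poly_dvd_iff poly_cong_def cong_iff_dvd_diff)
  then obtain g where "?f - monom 1 m = [:int p:] * g" by blast
  then have f: "?f = monom 1 m + Polynomial.smult (int p) g" by (simp add: algebra_simps)
  \<comment> \<open>The whole kernel of \<open>F\<close> is treated at once: it is stable under
    polynomials in \<open>P\<close>, so the step \<phi>^m(x) = p y has \<open>y\<close> in
    \<open>L\<close> again and can be iterated to gain any power of \<open>p\<close>.\<close>
  define L where "L = {x \<in> carrier_vec n. F *\<^sub>v x = 0\<^sub>v n}"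
  have L_step: "\<exists>y\<in>L. (\<phi> ^^ m) x = int p \<cdot>\<^sub>v y" if x: "x \<in> L" for x
  proof -
    have xc: "x \<in> carrier_vec n" using x by (simp add: L_def)
    have gx: "poly_act P g x \<in> carrier_vec n" using P xc by simp
    have pow: "(\<phi> ^^ j) x = ((*\<^sub>v) P ^^ j) x \<and> (\<phi> ^^ j) x \<in> carrier_vec n" for j
      using xc P by (induction j) (auto simp: \<phi>P)
    have zero: "0\<^sub>v n = (\<phi> ^^ m) x + int p \<cdot>\<^sub>v poly_act P g x"
      using x xc pow[of m]
      by (simp add: L_def FP f poly_act_add[OF P xc] poly_act_smult[OF P xc] poly_act_monom[OF P xc])
    have "(\<phi> ^^ m) x = - (int p \<cdot>\<^sub>v poly_act P g x)"
      by (rule vec_eq_uminusI[OF conjunct2[OF pow[of m]] _ zero[symmetric]]) (use gx in simp)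
    also have "\<dots> = int p \<cdot>\<^sub>v (- poly_act P g x)" by (intro eq_vecI) auto
    finally have "(\<phi> ^^ m) x = int p \<cdot>\<^sub>v (- poly_act P g x)" .
    moreover have "- poly_act P g x \<in> L"
    proof -
      have "F *\<^sub>v poly_act P g x = poly_act P ?f (poly_act P g x)" using FP[OF gx] .
      also have "\<dots> = poly_act P g (poly_act P ?f x)"
        using poly_act_intertwine[OF P P, of "carrier_vec n" x "poly_act P g" ?f]
          poly_act_commute[OF P] P xc hom_Zn_smult[OF poly_act_hom[OF P]]
        by (simp add: poly_act_vec_add[OF P])
      also have "\<dots> = 0\<^sub>v n"
        using x FP[OF xc] hom_Zn_zero[OF poly_act_hom[OF P]] by (simp add: L_def)
      finally have "F *\<^sub>v poly_act P g x = 0\<^sub>v n" .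
      then have "F *\<^sub>v (- poly_act P g x) = - 0\<^sub>v n"
        using hom_Zn_minus(1)[OF mult_mat_vec_hom[OF F] gx gx] by simp
      then show ?thesis using gx by (simp add: L_def)
    qed
    ultimately show ?thesis by blast
  qed
  have L_pow: "\<exists>y\<in>L. (\<phi> ^^ (m * k)) x = int p ^ k \<cdot>\<^sub>v y" if "x \<in> L" for x k
    using that
  proof (induction k arbitrary: x)
    case 0
    then show ?case by (intro bexI[of _ x]) auto
  next
    case (Suc k)
    obtain y where y: "y \<in> L" "(\<phi> ^^ m) x = int p \<cdot>\<^sub>v y" using L_step[OF Suc.prems] by blast
    obtain z where z: "z \<in> L" "(\<phi> ^^ (m * k)) y = int p ^ k \<cdot>\<^sub>v z" using Suc.IH[OF y(1)] by blast
    have "(\<phi> ^^ (m * Suc k)) x = (\<phi> ^^ (m * k)) ((\<phi> ^^ m) x)"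
      by (simp add: funpow_add[symmetric, THEN fun_cong, unfolded comp_apply] add.commute)
    also have "\<dots> = int p \<cdot>\<^sub>v (\<phi> ^^ (m * k)) y"
      using y hom_Zn_smult[OF funpow_hom_Zn[OF \<phi>]] by (simp add: L_def)
    also have "\<dots> = int p ^ Suc k \<cdot>\<^sub>v z" using z by (simp add: smult_smult_assoc)
    finally show ?case using z(1) by blast
  qed
  have "a \<in> L" using a by (simp add: L_def)
  then have "\<exists>j. vec_dvd (int p ^ k) ((\<phi> ^^ j) a)" for k
    using L_pow[of a k] by (metis vec_dvd_smult)
  then show ?thesis using a by (auto simp: collapsing_def)
qed

text \<open>Since \<open>q\<close> kills \<open>N\<close>, the condition defining
  \<open>K_set\<close> says that some power of \<open>M\<close> sends \<open>q x\<close> into p Z^m.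
  Applied to the unit vectors, this makes \<open>M\<close> nilpotent modulo
  \<open>p\<close>.\<close>

lemma char_poly_mod_of_K_set:
  assumes \<phi>: "\<phi> \<in> hom (Zn n) (Zn n)" and p: "prime p"
    and H: "subgroup H (Zn n)" "\<phi> ` H \<subseteq> H" and N: "subgroup N (Zn n)" "N \<subseteq> H"
    and pure: "\<And>c a. c \<noteq> 0 \<Longrightarrow> a \<in> carrier_vec n \<Longrightarrow> c \<cdot>\<^sub>v a \<in> H \<Longrightarrow> a \<in> H"
    and M: "M \<in> carrier_mat m m"
    and q: "q ` H = carrier_vec m" "\<And>x y. x \<in> H \<Longrightarrow> y \<in> H \<Longrightarrow> q (x + y) = q x + q y"
      "\<And>c x. x \<in> H \<Longrightarrow> q (c \<cdot>\<^sub>v x) = c \<cdot>\<^sub>v q x" "\<And>x. x \<in> H \<Longrightarrow> q x = 0\<^sub>v m \<longleftrightarrow> x \<in> N"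
      "\<And>x. x \<in> H \<Longrightarrow> q (\<phi> x) = M *\<^sub>v q x"
    and K: "H \<subseteq> K_set n \<phi> p N"
  shows "poly_cong (char_poly M) (monom 1 m) (int p)"
proof -
  have Hc: "x \<in> carrier_vec n" if "x \<in> H" for x using H(1) that by (auto simp: subgroup_monoid_vec_iff)
  have "\<exists>j. vec_dvd (int p) (((*\<^sub>v) M ^^ j) (unit_vec m l))" for l
  proof -
    have "unit_vec m l \<in> q ` H" using q(1) by simp
    then obtain x where x: "x \<in> H" "unit_vec m l = q x" by blast
    then obtain j b c where jbc: "b \<in> N" "c \<in> carrier_vec n" "(\<phi> ^^ j) x = b + int p \<cdot>\<^sub>v c"
      using K by (auto simp: K_set_def)
    have pow: "(\<phi> ^^ i) x \<in> H \<and> q ((\<phi> ^^ i) x) = ((*\<^sub>v) M ^^ i) (q x)" for i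
      using x(1) H(2) q(5) by (induction i) auto
    have bH: "b \<in> H" using jbc N(2) by blast
    \<comment> \<open>\<open>K_set\<close> provides \<open>c\<close> only in the whole lattice;
      purity of \<open>H\<close> brings it into the domain of \<open>q\<close>.\<close>
    have "int p \<cdot>\<^sub>v c = (\<phi> ^^ j) x - b"
      using jbc Hc[OF bH] by (intro eq_vecI) auto
    then have pc: "int p \<cdot>\<^sub>v c \<in> H" using subgroup_vec_minus[OF H(1)] pow bH by metis
    then have cH: "c \<in> H" using pure[of "int p" c] jbc(2) p by (simp add: prime_gt_0_nat)
    have "q ((\<phi> ^^ j) x) = q b + int p \<cdot>\<^sub>v q c"
      using jbc q(2)[OF bH pc] q(3)[OF cH] by simp
    also have "\<dots> = int p \<cdot>\<^sub>v q c"
    proof -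
      have "q c \<in> carrier_vec m" using q(1) cH by blast
      then show ?thesis using q(4)[OF bH] jbc(1) by simp
    qed
    finally have "((*\<^sub>v) M ^^ j) (unit_vec m l) = int p \<cdot>\<^sub>v q c" using pow[of j] x(2) by simp
    then show ?thesis by (metis vec_dvd_smult)
  qed
  then obtain J where J: "\<And>l. vec_dvd (int p) (((*\<^sub>v) M ^^ J l) (unit_vec m l))" by metis
  \<comment> \<open>The sum is a common exponent for all unit vectors, because further applications
    of \<open>M\<close> preserve divisibility.\<close>
  define j where "j = (\<Sum>l<m. J l)"
  have Mh: "(*\<^sub>v) M ^^ i \<in> hom (Zn m) (Zn m)" for i by (rule funpow_hom_Zn[OF mult_mat_vec_hom[OF M]])
  show ?thesis
  proof (rule char_poly_nilpotent_mod[OF M p, of j])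
    fix i l assume il: "i < m" "l < m"
    have "J l \<le> j" unfolding j_def using il(2) by (intro member_le_sum) auto
    then have "((*\<^sub>v) M ^^ j) (unit_vec m l) = ((*\<^sub>v) M ^^ (j - J l)) (((*\<^sub>v) M ^^ J l) (unit_vec m l))"
      by (metis comp_apply funpow_add le_add_diff_inverse2)
    moreover have "((*\<^sub>v) M ^^ J l) (unit_vec m l) \<in> carrier_vec m"
      using hom_Zn_simps(1)[OF Mh, of "unit_vec m l" "unit_vec m l"] by simp
    ultimately have "vec_dvd (int p) (((*\<^sub>v) M ^^ j) (unit_vec m l))"
      using vec_dvd_hom[OF Mh _ J] by metis
    then have "vec_dvd (int p) ((M ^\<^sub>m j) *\<^sub>v unit_vec m l)" by (simp add: pow_mat_mult_vec[OF M])
    then have "int p dvd ((M ^\<^sub>m j) *\<^sub>v unit_vec m l) $ i"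
      using il M by (simp add: vec_dvd_def)
    then show "int p dvd (M ^\<^sub>m j) $$ (i, l)" using il M by simp
  qed
qed

section \<open>Separating a vector of Z^n from a cyclic subgroup\<close>

lemma mon_Zn_matrix:
  assumes "\<phi> \<in> mon (Zn n) (Zn n)"
  obtains P where "P \<in> carrier_mat n n" "det P \<noteq> 0" "\<And>x. x \<in> carrier_vec n \<Longrightarrow> \<phi> x = P *\<^sub>v x"
proof -
  have \<phi>: "\<phi> \<in> hom (Zn n) (Zn n)" and inj: "inj_on \<phi> (carrier_vec n)"
    using assms by (auto simp: mon_def monoid_vec_simps)
  define P where "P = mat n n (\<lambda>(i, j). \<phi> (unit_vec n j) $ i)"
  have P: "P \<in> carrier_mat n n" by (simp add: P_def)
  have \<phi>P: "\<phi> x = P *\<^sub>v x" if "x \<in> carrier_vec n" for x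
    unfolding P_def by (rule hom_Zn_matrix[OF \<phi> that])
  have "v = 0\<^sub>v n" if v: "v \<in> carrier_vec n" "P *\<^sub>v v = 0\<^sub>v n" for v
  proof (rule inj_onD[OF inj])
    show "\<phi> v = \<phi> (0\<^sub>v n)" using v \<phi>P[OF v(1)] hom_Zn_zero[OF \<phi>] by simp
  qed (use v in simp_all)
  then have "det P \<noteq> 0" using det_0_iff_vec_prod_zero[OF P] by blast
  then show ?thesis using that P \<phi>P by blast
qed

lemma vec_dvd_of_mult_mat_vec:
  assumes P: "P \<in> carrier_mat n n" and x: "x \<in> carrier_vec n"
    and "coprime N (det P)" "vec_dvd N (P *\<^sub>v x)"
  shows "vec_dvd N x"
proof -
  have "vec_dvd N (adj_mat P *\<^sub>v (P *\<^sub>v x))"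
    using vec_dvd_hom[OF mult_mat_vec_hom[OF adj_mat(1)[OF P]] _ assms(4)] P x by simp
  also have "adj_mat P *\<^sub>v (P *\<^sub>v x) = (adj_mat P * P) *\<^sub>v x"
    using assoc_mult_mat_vec[OF adj_mat(1)[OF P] P x] by simp
  also have "\<dots> = det P \<cdot>\<^sub>v x"
    unfolding adj_mat(3)[OF P] using x by (intro eq_vecI) auto
  finally show ?thesis
    using assms(3) by (auto simp: vec_dvd_def coprime_dvd_mult_right_iff)
qed

lemma vec_dvd_of_funpow:
  assumes \<phi>: "\<phi> \<in> hom (Zn n) (Zn n)"
    and P: "P \<in> carrier_mat n n" "\<And>x. x \<in> carrier_vec n \<Longrightarrow> \<phi> x = P *\<^sub>v x"
    and N: "coprime N (det P)" and x: "x \<in> carrier_vec n" "vec_dvd N ((\<phi> ^^ j) x)"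
  shows "vec_dvd N x"
  using x(2)
proof (induction j)
  case (Suc j)
  have c: "(\<phi> ^^ j) x \<in> carrier_vec n"
    using hom_Zn_simps(1)[OF funpow_hom_Zn[OF \<phi>] x(1) x(1)] .
  have "vec_dvd N (P *\<^sub>v (\<phi> ^^ j) x)" using Suc.prems P(2)[OF c] by simp
  then show ?case by (rule Suc.IH[OF vec_dvd_of_mult_mat_vec[OF P(1) c N]])
qed simp

lemma coprime_Suc_mult:
  fixes d D :: int
  shows "coprime (\<bar>d\<bar> * \<bar>D\<bar> + 1) d"
proof (rule coprimeI)
  fix c assume "c dvd \<bar>d\<bar> * \<bar>D\<bar> + 1" "c dvd d"
  moreover from this have "c dvd \<bar>d\<bar> * \<bar>D\<bar>" by simp
  ultimately show "is_unit c" using dvd_add_right_iff by blast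
qed

text \<open>Off the line of \<open>v\<close> there is a nonzero D, an entry of \<open>w\<close> if
  \<open>v = 0\<close> and a 2 x 2 minor otherwise, that is divisible by every N dividing some w - c
  v. On the line, s w = r v with coprime s and r, and a power of a prime divisor of s separates
  because \<open>v\<close> does not collapse.\<close>

lemma cyclic_complement_mod:
  assumes \<phi>: "\<phi> \<in> mon (Zn n) (Zn n)"
    and vw: "v \<in> carrier_vec n" "w \<in> carrier_vec n" "\<And>c. w \<noteq> c \<cdot>\<^sub>v v"
    and coll: "v = 0\<^sub>v n \<or> (\<forall>p. prime p \<longrightarrow> v \<notin> collapsing n \<phi> p)"
  shows "\<exists>N\<ge>1. \<forall>c j. \<not> vec_dvd N ((\<phi> ^^ j) (w - c \<cdot>\<^sub>v v))"
proof -
  have hom: "\<phi> \<in> hom (Zn n) (Zn n)" using \<phi> by (simp add: mon_def)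
  obtain P where P: "P \<in> carrier_mat n n" "det P \<noteq> 0" "\<And>x. x \<in> carrier_vec n \<Longrightarrow> \<phi> x = P *\<^sub>v x"
    using mon_Zn_matrix[OF \<phi>] by blast
  \<comment> \<open>The modulus |det P| |D| + 1 is prime to \<open>det P\<close>, so divisibility by
    it can be pulled back along \<phi>^j, and it exceeds |D|, so it cannot divide
    \<open>D\<close>.\<close>
  have minor: ?thesis if D: "D \<noteq> 0" and dvd: "\<And>N c. vec_dvd N (w - c \<cdot>\<^sub>v v) \<Longrightarrow> N dvd D" for D
  proof (intro exI[of _ "\<bar>det P\<bar> * \<bar>D\<bar> + 1"] conjI allI notI)
    fix c j assume "vec_dvd (\<bar>det P\<bar> * \<bar>D\<bar> + 1) ((\<phi> ^^ j) (w - c \<cdot>\<^sub>v v))"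
    then have "vec_dvd (\<bar>det P\<bar> * \<bar>D\<bar> + 1) (w - c \<cdot>\<^sub>v v)"
      using vec_dvd_of_funpow[OF hom P(1) _ coprime_Suc_mult] P(3) vw(1,2) by simp
    then have "\<bar>det P\<bar> * \<bar>D\<bar> + 1 \<le> \<bar>D\<bar>" using dvd D by (intro zdvd_imp_le) auto
    moreover have "1 * \<bar>D\<bar> \<le> \<bar>det P\<bar> * \<bar>D\<bar>" using P(2) by (intro mult_right_mono) auto
    ultimately show False by simp
  qed simp
  have nonzero_entry: "\<exists>i<n. x $ i \<noteq> 0" if "x \<noteq> 0\<^sub>v n" "x \<in> carrier_vec n" for x :: "int vec"
  proof (rule ccontr)
    assume "\<not> (\<exists>i<n. x $ i \<noteq> 0)"
    then have "x = 0\<^sub>v n" using that(2) by (intro eq_vecI) auto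
    then show False using that(1) by blast
  qed
  consider (zero) "v = 0\<^sub>v n" | (indep) i j where "i < n" "j < n" "v $ i * w $ j \<noteq> v $ j * w $ i"
    | (dep) i where "i < n" "v $ i \<noteq> 0" "\<And>j. j < n \<Longrightarrow> v $ i * w $ j = v $ j * w $ i" "v \<noteq> 0\<^sub>v n"
  proof (cases "v = 0\<^sub>v n")
    case False
    then obtain i where i: "i < n" "v $ i \<noteq> 0" using nonzero_entry vw(1) by blast
    then show ?thesis
    proof (cases "\<forall>j<n. v $ i * w $ j = v $ j * w $ i")
      case True
      then show ?thesis by (intro that(3)[of i]) (use i False in simp_all)
    next
      case False
      then obtain j where "j < n" "v $ i * w $ j \<noteq> v $ j * w $ i" by blast
      then show ?thesis by (intro that(2)[of i j] i(1))
    qed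
  qed (rule that(1))
  then show ?thesis
  proof cases
    case zero
    have "w \<noteq> 0\<^sub>v n" using vw(3)[of 1] zero by auto
    then obtain i where i: "i < n" "w $ i \<noteq> 0" using nonzero_entry vw(2) by blast
    show ?thesis
    proof (rule minor[OF i(2)])
      fix N c assume "vec_dvd N (w - c \<cdot>\<^sub>v v)"
      then have "N dvd (w - c \<cdot>\<^sub>v v) $ i" using i(1) vw(1,2) by (simp add: vec_dvd_def)
      then show "N dvd w $ i" using i(1) zero vw(2) by simp
    qed
  next
    case indep
    show ?thesis
    proof (rule minor[of "v $ i * w $ j - v $ j * w $ i"])
      fix N c assume "vec_dvd N (w - c \<cdot>\<^sub>v v)"
      then have dvd: "N dvd w $ i - c * v $ i" "N dvd w $ j - c * v $ j"
        using indep(1,2) vw(1,2) by (simp_all add: vec_dvd_def)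
      have "N dvd v $ i * (w $ j - c * v $ j) - v $ j * (w $ i - c * v $ i)"
        by (intro dvd_diff dvd_mult dvd)
      also have "v $ i * (w $ j - c * v $ j) - v $ j * (w $ i - c * v $ i)
          = v $ i * w $ j - v $ j * w $ i"
        by (simp add: algebra_simps)
      finally show "N dvd v $ i * w $ j - v $ j * w $ i" .
    next
      show "v $ i * w $ j - v $ j * w $ i \<noteq> 0" using indep(3) by linarith
    qed
  next
    case dep
    define g where "g = gcd (v $ i) (w $ i)"
    have "g \<noteq> 0" using dep(2) by (simp add: g_def)
    from gcd_coprime_exists[OF this[unfolded g_def]]
    obtain s r where sr: "v $ i = s * g" "w $ i = r * g" "coprime s r"
      unfolding g_def[symmetric] by (elim exE conjE)
    have g: "g \<noteq> 0" and s: "s \<noteq> 0" using sr(1) dep(2) by auto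
    have sw: "s * w $ j = r * v $ j" if "j < n" for j
    proof -
      have "g * (s * w $ j) = g * (r * v $ j)" using dep(3)[OF that] sr by (simp add: algebra_simps)
      then show ?thesis using g by simp
    qed
    have "\<not> is_unit s"
    proof
      assume "is_unit s"
      then have ss: "s * s = 1" by (metis abs_mult_self_eq zdvd1_eq mult_1)
      have "w $ j = (s * r) * v $ j" if "j < n" for j
      proof -
        have "w $ j = s * s * w $ j" using ss by simp
        also have "\<dots> = (s * r) * v $ j" using sw[OF that] by (simp only: mult.assoc)
        finally show ?thesis .
      qed
      then have "w = (s * r) \<cdot>\<^sub>v v" using vw(1,2) by (intro eq_vecI) auto
      then show False using vw(3) by blast
    qed
    then obtain p' where p': "prime p'" "p' dvd s" using s by (metis prime_divisor_exists)
    define p where "p = nat p'"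
    have p: "prime p" "int p = p'" using p' by (simp_all add: p_def prime_ge_0_int)
    have pr: "\<not> int p dvd r"
      using sr(3) p p' by (metis coprime_common_divisor not_prime_unit)
    have "v \<notin> collapsing n \<phi> p" using coll dep(4) p(1) by blast
    then obtain k where k: "\<And>j. \<not> vec_dvd (int p ^ k) ((\<phi> ^^ j) v)"
      using vw(1) by (auto simp: collapsing_def)
    show ?thesis
    proof (intro exI[of _ "int p ^ k"] conjI allI notI)
      show "1 \<le> int p ^ k" using prime_gt_0_nat[OF p(1)] by simp
      fix c j assume dvd: "vec_dvd (int p ^ k) ((\<phi> ^^ j) (w - c \<cdot>\<^sub>v v))"
      have hj: "\<phi> ^^ j \<in> hom (Zn n) (Zn n)" by (rule funpow_hom_Zn[OF hom])
      have vj: "(\<phi> ^^ j) v \<in> carrier_vec n" using hom_Zn_simps(1)[OF hj vw(1) vw(1)] .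
      \<comment> \<open>As \<open>p\<close> divides \<open>s\<close> but not \<open>r\<close>, the
        number r - s c is prime to \<open>p\<close> for every \<open>c\<close>. A power of
        \<open>p\<close> dividing \<phi>^j(w - c v) therefore divides \<phi>^j(v), uniformly in
        \<open>c\<close>.\<close>
      have "s \<cdot>\<^sub>v (w - c \<cdot>\<^sub>v v) = (r - s * c) \<cdot>\<^sub>v v"
        using vw(1,2) sw by (intro eq_vecI) (auto simp: algebra_simps)
      then have "s \<cdot>\<^sub>v (\<phi> ^^ j) (w - c \<cdot>\<^sub>v v) = (r - s * c) \<cdot>\<^sub>v (\<phi> ^^ j) v"
        using hom_Zn_smult[OF hj] vw(1,2) by (metis minus_carrier_vec smult_carrier_vec)
      then have "vec_dvd (int p ^ k) ((r - s * c) \<cdot>\<^sub>v (\<phi> ^^ j) v)"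
        using vec_dvd_smult_right[OF dvd, of s] by simp
      moreover have "coprime (int p ^ k) (r - s * c)"
      proof -
        have "\<not> int p dvd r - s * c"
          using pr p' p by (metis dvd_diff_right_iff dvd_mult2 dvd_diff_left_iff)
        moreover have "prime (int p)" using p(1) by simp
        ultimately have "coprime (int p) (r - s * c)" by (intro prime_imp_coprime)
        then show ?thesis by simp
      qed
      ultimately have "vec_dvd (int p ^ k) ((\<phi> ^^ j) v)"
        using vj by (auto simp: vec_dvd_def coprime_dvd_mult_right_iff)
      then show False using k by blast
    qed
  qed
qed

section \<open>The union of the lattices\<close>

abbreviation rat_vec :: "int vec \<Rightarrow> rat vec" where
  "rat_vec \<equiv> map_vec rat_of_int"

lemma rat_vec_simps:
  "a \<in> carrier_vec n \<Longrightarrow> b \<in> carrier_vec n \<Longrightarrow> rat_vec (a + b) = rat_vec a + rat_vec b"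
  "a \<in> carrier_vec n \<Longrightarrow> b \<in> carrier_vec n \<Longrightarrow> rat_vec (a - b) = rat_vec a - rat_vec b"
  "rat_vec (- a) = - rat_vec a"
  "rat_vec (c \<cdot>\<^sub>v a) = rat_of_int c \<cdot>\<^sub>v rat_vec a"
  by (auto intro!: eq_vecI)

lemma rat_vec_inject: "rat_vec a = rat_vec b \<longleftrightarrow> a = b"
  by (auto simp: vec_eq_iff)

lemma rat_extension_rat_vec:
  assumes "\<phi> \<in> hom (Zn n) (Zn n)" "a \<in> carrier_vec n"
  shows "rat_extension n \<phi> (rat_vec a) = rat_vec (\<phi> a)"
proof -
  define M where "M = mat n n (\<lambda>(i, j). \<phi> (unit_vec n j) $ i)"
  have "mat n n (\<lambda>(i, j). rat_of_int (\<phi> (unit_vec n j) $ i)) = map_mat rat_of_int M"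
    by (intro eq_matI) (auto simp: M_def)
  moreover have "rat_vec (M *\<^sub>v a) = map_mat rat_of_int M *\<^sub>v rat_vec a"
    by (rule of_int_hom.mult_mat_vec_hom[of _ n n]) (use assms(2) in \<open>auto simp: M_def\<close>)
  moreover have "\<phi> a = M *\<^sub>v a" unfolding M_def by (rule hom_Zn_matrix[OF assms])
  ultimately show ?thesis unfolding rat_extension_def by simp
qed

lemma rat_extension_add:
  assumes "x \<in> carrier_vec n" "y \<in> carrier_vec n"
  shows "rat_extension n \<phi> (x + y) = rat_extension n \<phi> x + rat_extension n \<phi> y"
  using assms unfolding rat_extension_def by (intro mult_add_distrib_mat_vec) auto

lemma rat_extension_closed: "rat_extension n \<phi> x \<in> carrier_vec n"
  unfolding rat_extension_def by (rule carrier_vecI) simp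

lemma bij_betw_rat_extension:
  assumes "\<phi> \<in> mon (Zn n) (Zn n)"
  shows "bij_betw (rat_extension n \<phi>) (carrier_vec n) (carrier_vec n)"
proof -
  obtain M where M: "M \<in> carrier_mat n n" "det M \<noteq> 0" "\<And>x. x \<in> carrier_vec n \<Longrightarrow> \<phi> x = M *\<^sub>v x"
    using mon_Zn_matrix[OF assms] by blast
  let ?M = "map_mat rat_of_int M"
  have eq: "mat n n (\<lambda>(i, j). rat_of_int (\<phi> (unit_vec n j) $ i)) = ?M"
    using M by (intro eq_matI) auto
  have M': "?M \<in> carrier_mat n n" and d: "det ?M \<noteq> 0" using M by auto
  let ?inv = "\<lambda>x. inverse (det ?M) \<cdot>\<^sub>v (adj_mat ?M *\<^sub>v x)"
  have A: "adj_mat ?M \<in> carrier_mat n n" using adj_mat(1)[OF M'] .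
  have one: "inverse (det ?M) \<cdot>\<^sub>v ((det ?M \<cdot>\<^sub>m 1\<^sub>m n) *\<^sub>v x) = x" if "x \<in> carrier_vec n" for x
    using d that by (intro eq_vecI) auto
  show ?thesis
  proof (rule bij_betw_byWitness[of _ ?inv])
    show "\<forall>x\<in>carrier_vec n. ?inv (rat_extension n \<phi> x) = x"
      unfolding rat_extension_def eq
      using one by (simp add: assoc_mult_mat_vec[OF A M', symmetric] adj_mat(3)[OF M'])
    show "\<forall>x\<in>carrier_vec n. rat_extension n \<phi> (?inv x) = x"
      unfolding rat_extension_def eq
      using one mult_mat_vec[OF M'] A
      by (simp add: assoc_mult_mat_vec[OF M' A, symmetric] adj_mat(2)[OF M'])
  qed (use A in \<open>auto simp: rat_extension_closed\<close>)
qed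

locale Zn_monomorphism =
  fixes n :: nat and \<phi> :: "int vec \<Rightarrow> int vec"
  assumes mon: "\<phi> \<in> mon (Zn n) (Zn n)"
begin

abbreviation "T \<equiv> rat_extension n \<phi>"

abbreviation "Qn \<equiv> monoid_vec TYPE(rat) n"

lemma hom: "\<phi> \<in> hom (Zn n) (Zn n)"
  using mon by (simp add: mon_def)

lemma T_auto: "restrict T (carrier_vec n) \<in> carrier (AutoGroup Qn)"
proof -
  have "restrict T (carrier_vec n) \<in> hom Qn Qn"
    by (rule homI) (simp_all add: monoid_vec_simps rat_extension_closed rat_extension_add)
  moreover have "bij_betw (restrict T (carrier_vec n)) (carrier_vec n) (carrier_vec n)"
    using bij_betw_rat_extension[OF mon] by (simp cong: bij_betw_cong)
  ultimately show ?thesis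
    by (simp add: AutoGroup_def auto_def Bij_def monoid_vec_simps)
qed

text \<open>The power T^m for every integer \<open>m\<close>. Powers in the automorphism group
  supply the negative exponents and the exponent law; its elements are extensional functions, hence
  the \<open>restrict\<close>.\<close>

definition shift :: "int \<Rightarrow> rat vec \<Rightarrow> rat vec" where
  "shift m x = (restrict T (carrier_vec n) [^]\<^bsub>AutoGroup Qn\<^esub> m) x"

lemma group_Auto: "group (AutoGroup Qn)"
  by (rule group.AutoGroup) (rule comm_group.axioms(2)[OF comm_group_vec])

lemma shift_auto: "restrict T (carrier_vec n) [^]\<^bsub>AutoGroup Qn\<^esub> (m :: int) \<in> auto Qn"
  using group.int_pow_closed[OF group_Auto T_auto] by (simp add: AutoGroup_def)

lemma shift_closed [simp]: "x \<in> carrier_vec n \<Longrightarrow> shift m x \<in> carrier_vec n"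
  using shift_auto[of m] by (auto simp: shift_def auto_def hom_def monoid_vec_simps)

lemma shift_add: "x \<in> carrier_vec n \<Longrightarrow> y \<in> carrier_vec n \<Longrightarrow> shift m (x + y) = shift m x + shift m y"
  using shift_auto[of m] by (auto simp: shift_def auto_def hom_def monoid_vec_simps)

lemma shift_shift: "x \<in> carrier_vec n \<Longrightarrow> shift m (shift k x) = shift (m + k) x"
proof -
  assume x: "x \<in> carrier_vec n"
  let ?A = "AutoGroup Qn" and ?t = "restrict T (carrier_vec n)"
  have Bij: "?t [^]\<^bsub>?A\<^esub> (j :: int) \<in> Bij (carrier_vec n)" for j
    using shift_auto[of j] by (simp add: auto_def monoid_vec_simps)
  have "?t [^]\<^bsub>?A\<^esub> (m + k) = ?t [^]\<^bsub>?A\<^esub> m \<otimes>\<^bsub>?A\<^esub> ?t [^]\<^bsub>?A\<^esub> k"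
    by (rule group.int_pow_mult[OF group_Auto T_auto])
  also have "\<dots> = compose (carrier_vec n) (?t [^]\<^bsub>?A\<^esub> m) (?t [^]\<^bsub>?A\<^esub> k)"
    using Bij by (simp add: AutoGroup_def BijGroup_def monoid_vec_simps)
  finally show ?thesis using x by (simp add: shift_def compose_def)
qed

lemma shift_0 [simp]: "x \<in> carrier_vec n \<Longrightarrow> shift 0 x = x"
  by (simp add: shift_def AutoGroup_def BijGroup_def monoid_vec_simps)

lemma shift_1: "x \<in> carrier_vec n \<Longrightarrow> shift 1 x = T x"
  using group.int_pow_1[OF group_Auto T_auto] by (simp add: shift_def)

lemma shift_zero [simp]: "shift m (0\<^sub>v n) = 0\<^sub>v n"
proof -
  have "shift m (0\<^sub>v n) + shift m (0\<^sub>v n) = shift m (0\<^sub>v n + 0\<^sub>v n)"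
    by (rule shift_add[symmetric]) simp_all
  also have "0\<^sub>v n + 0\<^sub>v n = (0\<^sub>v n :: rat vec)" by simp
  finally have twice: "shift m (0\<^sub>v n) + shift m (0\<^sub>v n) = shift m (0\<^sub>v n)" .
  have idem: "x = 0\<^sub>v n" if "x + x = x" "x \<in> carrier_vec n" for x :: "rat vec"
  proof (rule eq_vecI)
    fix i assume "i < dim_vec (0\<^sub>v n :: rat vec)"
    then show "x $ i = 0\<^sub>v n $ i"
      using arg_cong[OF that(1), of "\<lambda>v. v $ i"] that(2) by simp
  qed (use that in simp)
  show ?thesis by (rule idem[OF twice]) simp
qed

lemma shift_uminus: "x \<in> carrier_vec n \<Longrightarrow> shift m (- x) = - shift m x"
proof -
  assume x: "x \<in> carrier_vec n"
  have "shift m (- x) + shift m x = shift m (- x + x)"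
    by (rule shift_add[symmetric]) (use x in simp_all)
  also have "- x + x = 0\<^sub>v n" using x by simp
  finally have "shift m (- x) + shift m x = 0\<^sub>v n" by simp
  then show ?thesis using x by (intro vec_eq_uminusI[of _ n]) simp_all
qed

lemma shift_minus:
  assumes x: "x \<in> carrier_vec n" "y \<in> carrier_vec n"
  shows "shift m (x - y) = shift m x - shift m y"
proof -
  have "x - y = x + - y" using x by (intro eq_vecI) auto
  then have "shift m (x - y) = shift m x + - shift m y" using x by (simp add: shift_add shift_uminus)
  also have "\<dots> = shift m x - shift m y" using shift_closed[OF x(1)] shift_closed[OF x(2)] by (intro eq_vecI) auto
  finally show ?thesis .
qed

lemma shift_of_int_smult:
  assumes x: "x \<in> carrier_vec n"
  shows "shift m (of_int c \<cdot>\<^sub>v x) = of_int c \<cdot>\<^sub>v shift m x"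
proof (induction c rule: int_induct[where k = 0])
  case base
  have "0 \<cdot>\<^sub>v y = 0\<^sub>v n" if "y \<in> carrier_vec n" for y :: "rat vec" using that by auto
  then show ?case using x by simp
next
  case (step1 i)
  then show ?case using x by (simp add: add_smult_distrib_vec shift_add)
next
  case (step2 i)
  have eq: "of_int (i - 1) \<cdot>\<^sub>v y = of_int i \<cdot>\<^sub>v y - y" for y :: "rat vec"
    by (intro eq_vecI) (auto simp: algebra_simps)
  show ?case unfolding eq using step2 x by (simp add: shift_minus)
qed

lemma shift_inj:
  assumes "x \<in> carrier_vec n" "y \<in> carrier_vec n" "shift m x = shift m y"
  shows "x = y"
proof -
  have "shift (- m) (shift m x) = x" "shift (- m) (shift m y) = y"
    using assms(1,2) by (simp_all add: shift_shift)
  then show ?thesis using assms(3) by metis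
qed

lemma shift_rat_vec:
  "a \<in> carrier_vec n \<Longrightarrow> shift (int j) (rat_vec a) = rat_vec ((\<phi> ^^ j) a)"
proof (induction j)
  case (Suc j)
  have c: "(\<phi> ^^ j) a \<in> carrier_vec n"
    using hom_Zn_simps(1)[OF funpow_hom_Zn[OF hom] Suc.prems Suc.prems] .
  have "shift (int (Suc j)) (rat_vec a) = shift 1 (shift (int j) (rat_vec a))"
    using Suc.prems by (simp add: shift_shift)
  also have "\<dots> = T (rat_vec ((\<phi> ^^ j) a))" using Suc.IH[OF Suc.prems] c by (simp add: shift_1)
  also have "\<dots> = rat_vec (\<phi> ((\<phi> ^^ j) a))" by (rule rat_extension_rat_vec[OF hom c])
  finally show ?case by simp
qed simp

text \<open>\<open>lattice_mod N\<close> is \<open>N B\<close> for the union \<open>B = lattice_mod 1\<close> of the lattices \<open>T\<^sup>-\<^sup>j \<int>\<^sup>n\<close>.\<close>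

definition lattice_mod :: "int \<Rightarrow> rat vec set" where
  "lattice_mod N = {x \<in> carrier_vec n. \<exists>j. \<exists>a\<in>carrier_vec n. vec_dvd N a \<and> shift (int j) x = rat_vec a}"

lemma lattice_modI:
  "x \<in> carrier_vec n \<Longrightarrow> a \<in> carrier_vec n \<Longrightarrow> vec_dvd N a \<Longrightarrow> shift (int j) x = rat_vec a
    \<Longrightarrow> x \<in> lattice_mod N"
  by (auto simp: lattice_mod_def)

text \<open>Once an image T^j x lies in N Z^n, all later ones do, so several elements can be treated
  with a common exponent.\<close>

lemma lattice_modE:
  assumes "x \<in> lattice_mod N"
  obtains j where "x \<in> carrier_vec n"
    "\<And>k. k \<ge> j \<Longrightarrow> \<exists>a\<in>carrier_vec n. vec_dvd N a \<and> shift (int k) x = rat_vec a"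
proof -
  obtain j a where ja: "x \<in> carrier_vec n" "a \<in> carrier_vec n" "vec_dvd N a" "shift (int j) x = rat_vec a"
    using assms by (auto simp: lattice_mod_def)
  have "\<exists>a\<in>carrier_vec n. vec_dvd N a \<and> shift (int k) x = rat_vec a" if "k \<ge> j" for k
  proof (intro bexI conjI)
    have h: "\<phi> ^^ (k - j) \<in> Group.hom (Zn n) (Zn n)" by (rule funpow_hom_Zn[OF hom])
    show "(\<phi> ^^ (k - j)) a \<in> carrier_vec n" using hom_Zn_simps(1)[OF h ja(2) ja(2)] .
    show "vec_dvd N ((\<phi> ^^ (k - j)) a)" using vec_dvd_hom[OF h ja(2,3)] .
    have "shift (int k) x = shift (int (k - j)) (shift (int j) x)"
      using that ja(1) by (simp add: shift_shift of_nat_diff)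
    then show "shift (int k) x = rat_vec ((\<phi> ^^ (k - j)) a)" using ja by (simp add: shift_rat_vec)
  qed
  then show ?thesis using that ja(1) by blast
qed

lemma lattice_mod_subgroup: "subgroup (lattice_mod N) Qn"
  unfolding subgroup_monoid_vec_iff
proof (intro conjI ballI)
  show "lattice_mod N \<subseteq> carrier_vec n" by (auto simp: lattice_mod_def)
  have "rat_vec (0\<^sub>v n) = 0\<^sub>v n" by (intro eq_vecI) auto
  then show "0\<^sub>v n \<in> lattice_mod N"
    unfolding lattice_mod_def by (auto simp: vec_dvd_def intro!: bexI[of _ "0\<^sub>v n"])
next
  fix x y assume xy: "x \<in> lattice_mod N" "y \<in> lattice_mod N"
  obtain j where j: "x \<in> carrier_vec n"
    "\<And>k. k \<ge> j \<Longrightarrow> \<exists>a\<in>carrier_vec n. vec_dvd N a \<and> shift (int k) x = rat_vec a"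
    using lattice_modE[OF xy(1)] by blast
  obtain i where i: "y \<in> carrier_vec n"
    "\<And>k. k \<ge> i \<Longrightarrow> \<exists>a\<in>carrier_vec n. vec_dvd N a \<and> shift (int k) y = rat_vec a"
    using lattice_modE[OF xy(2)] by blast
  obtain a where a: "a \<in> carrier_vec n" "vec_dvd N a" "shift (int (max i j)) x = rat_vec a"
    using j(2)[of "max i j"] by auto
  obtain b where b: "b \<in> carrier_vec n" "vec_dvd N b" "shift (int (max i j)) y = rat_vec b"
    using i(2)[of "max i j"] by auto
  have "shift (int (max i j)) (x + y) = rat_vec (a + b)"
    using shift_add[OF j(1) i(1)] a b by (simp add: rat_vec_simps(1)[of a n b])
  moreover have "vec_dvd N (a + b)" using vec_dvd_add a b by blast
  ultimately show "x + y \<in> lattice_mod N"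
    using i(1) j(1) a(1) b(1) by (intro lattice_modI[of _ "a + b"]) simp_all
next
  fix x assume "x \<in> lattice_mod N"
  then obtain j a where ja: "x \<in> carrier_vec n" "a \<in> carrier_vec n" "vec_dvd N a" "shift (int j) x = rat_vec a"
    by (auto simp: lattice_mod_def)
  then have "shift (int j) (- x) = rat_vec (- a)" by (simp add: shift_uminus rat_vec_simps)
  then show "- x \<in> lattice_mod N"
    using ja vec_dvd_uminus by (intro lattice_modI[of _ "- a"]) simp_all
qed

lemmas lattice_mod_closed =
  lattice_mod_subgroup[unfolded subgroup_monoid_vec_iff, THEN conjunct1, THEN subsetD]
  lattice_mod_subgroup[unfolded subgroup_monoid_vec_iff, THEN conjunct2, THEN conjunct1]
  lattice_mod_subgroup[unfolded subgroup_monoid_vec_iff, THEN conjunct2, THEN conjunct2, THEN conjunct1, rule_format]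
  lattice_mod_subgroup[unfolded subgroup_monoid_vec_iff, THEN conjunct2, THEN conjunct2, THEN conjunct2, rule_format]
  subgroup_vec_minus[OF lattice_mod_subgroup]
  subgroup_vec_of_int_smult[OF lattice_mod_subgroup]

lemma lattice_mod_shift:
  assumes "x \<in> lattice_mod N" shows "shift m x \<in> lattice_mod N"
proof -
  obtain j where j: "x \<in> carrier_vec n"
    "\<And>k. k \<ge> j \<Longrightarrow> \<exists>a\<in>carrier_vec n. vec_dvd N a \<and> shift (int k) x = rat_vec a"
    using lattice_modE[OF assms] by blast
  let ?i = "nat \<bar>m\<bar> + j"
  define k where "k = nat (int ?i + m)"
  have k: "int k = int ?i + m" "k \<ge> j" unfolding k_def by linarith+
  obtain a where a: "a \<in> carrier_vec n" "vec_dvd N a" "shift (int k) x = rat_vec a"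
    using j(2)[OF k(2)] by blast
  have "shift (int ?i) (shift m x) = rat_vec a"
    unfolding shift_shift[OF j(1)] k(1)[symmetric] by (rule a(3))
  then show ?thesis using a(1,2) j(1) by (intro lattice_modI[of _ a _ ?i]) simp_all
qed

lemma lattice_mod_shift_iff:
  assumes "x \<in> carrier_vec n" shows "shift m x \<in> lattice_mod N \<longleftrightarrow> x \<in> lattice_mod N"
  using lattice_mod_shift[of x N m] lattice_mod_shift[of "shift m x" N "- m"] assms
  by (auto simp: shift_shift)

lemma lattice_mod_subset: "x \<in> lattice_mod N \<Longrightarrow> x \<in> lattice_mod 1"
  unfolding lattice_mod_def vec_dvd_def by auto

text \<open>The bridge between A and B: \<open>a\<close> belongs to
  \<open>collapsing n \<phi> p\<close> exactly when \<open>rat_vec a\<close> lies in p^k B for every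
  \<open>k\<close>.\<close>

lemma rat_vec_in_lattice_mod_iff:
  assumes a: "a \<in> carrier_vec n"
  shows "rat_vec a \<in> lattice_mod N \<longleftrightarrow> (\<exists>j. vec_dvd N ((\<phi> ^^ j) a))"
proof -
  have c: "(\<phi> ^^ j) a \<in> carrier_vec n" for j
    using hom_Zn_simps(1)[OF funpow_hom_Zn[OF hom] a a] .
  show ?thesis
    unfolding lattice_mod_def using a c by (auto simp: shift_rat_vec rat_vec_inject)
qed

lemma rat_vec_in_lattice_modI:
  "a \<in> carrier_vec n \<Longrightarrow> vec_dvd N a \<Longrightarrow> rat_vec a \<in> lattice_mod N"
  by (rule lattice_modI[of _ a _ 0]) simp_all

lemma rat_vec_in_lattice: "a \<in> carrier_vec n \<Longrightarrow> rat_vec a \<in> lattice_mod 1"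
  by (simp add: rat_vec_in_lattice_mod_iff vec_dvd_def)

text \<open>T^(ds) x - x is the sum of T^(di) (T^d x - x) over i < s. The set \<open>S\<close> will
  be N B, or the translations contained in a subgroup of finite index.\<close>

lemma shift_telescope:
  assumes S: "\<And>y z. y \<in> S \<Longrightarrow> z \<in> S \<Longrightarrow> y + z \<in> S" "\<And>y. y \<in> S \<Longrightarrow> shift d y \<in> S" "0\<^sub>v n \<in> S"
    and x: "x \<in> carrier_vec n" "shift d x - x \<in> S"
  shows "shift (d * int s) x - x \<in> S"
proof (induction s)
  case 0
  have "x - x = 0\<^sub>v n" using x by (intro eq_vecI) auto
  then show ?case using x S(3) by simp
next
  case (Suc s)
  have "shift d (shift (d * int s) x - x) + (shift d x - x) = shift (d * int (Suc s)) x - x"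
  proof -
    have "shift d (shift (d * int s) x - x) = shift (d * int (Suc s)) x - shift d x"
      using x(1) by (simp add: shift_minus shift_shift algebra_simps)
    moreover have "(u - v) + (v - x) = u - x" if "u \<in> carrier_vec n" "v \<in> carrier_vec n" for u v
      using that x(1) by (intro eq_vecI) auto
    ultimately show ?thesis using x(1) by simp
  qed
  then show ?case using S(1)[OF S(2)[OF Suc.IH] x(2)] by simp
qed

section \<open>Finiteness of B / N B\<close>

definition box :: "int \<Rightarrow> int vec set" where
  "box N = {a \<in> carrier_vec n. \<forall>i<n. 0 \<le> a $ i \<and> a $ i < N}"

lemma finite_box: "finite (box N)"
proof -
  have "box N \<subseteq> (\<lambda>f. vec n f) ` ({..<n} \<rightarrow>\<^sub>E {0..<N})"
  proof
    fix a assume a: "a \<in> box N"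
    then have "a = vec n (restrict (\<lambda>i. a $ i) {..<n})" by (intro eq_vecI) (auto simp: box_def)
    moreover have "restrict (\<lambda>i. a $ i) {..<n} \<in> {..<n} \<rightarrow>\<^sub>E {0..<N}" using a by (auto simp: box_def)
    ultimately show "a \<in> (\<lambda>f. vec n f) ` ({..<n} \<rightarrow>\<^sub>E {0..<N})" by blast
  qed
  then show ?thesis by (rule finite_subset) (intro finite_imageI finite_PiE, auto)
qed

lemma box_representative:
  assumes "N \<ge> 1" "a \<in> carrier_vec n"
  shows "map_vec (\<lambda>z. z mod N) a \<in> box N" "vec_dvd N (a - map_vec (\<lambda>z. z mod N) a)"
  using assms by (auto simp: box_def vec_dvd_def minus_mod_eq_mult_div)

text \<open>Some image of \<open>x\<close> lies in Z^n, where its orbit repeats modulo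
  \<open>N\<close>. Since N B is invariant under negative powers of T too, the preperiod can be
  undone and \<open>x\<close> itself is periodic modulo N B.\<close>

lemma shift_periodic:
  assumes N: "N \<ge> 1" and x: "x \<in> lattice_mod 1"
  shows "\<exists>r\<ge>1. \<forall>s. shift (int (r * s)) x - x \<in> lattice_mod N"
proof -
  obtain j b where jb: "x \<in> carrier_vec n" "b \<in> carrier_vec n" "shift (int j) x = rat_vec b"
    using x by (auto simp: lattice_mod_def)
  have c: "(\<phi> ^^ i) b \<in> carrier_vec n" for i
    using hom_Zn_simps(1)[OF funpow_hom_Zn[OF hom] jb(2) jb(2)] .
  let ?f = "\<lambda>i. map_vec (\<lambda>z. z mod N) ((\<phi> ^^ i) b)"
  have "range ?f \<subseteq> box N" using box_representative(1)[OF N c] by blast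
  then have "\<not> inj ?f" using finite_box finite_imageD finite_subset infinite_UNIV_nat by blast
  then obtain i i' where "i \<noteq> i'" "?f i = ?f i'" by (auto simp: inj_on_def)
  then obtain i r where r: "r \<ge> 1" "?f i = ?f (i + r)"
    by (metis One_nat_def Suc_leI add_diff_inverse_nat less_imp_not_less linorder_neqE_nat zero_less_diff)
  have "vec_dvd N ((\<phi> ^^ (i + r)) b - (\<phi> ^^ i) b)"
    unfolding vec_dvd_def
  proof (intro allI impI)
    fix k assume "k < dim_vec ((\<phi> ^^ (i + r)) b - (\<phi> ^^ i) b)"
    then have k: "k < n" using c[of i] by simp
    have "?f i $ k = ?f (i + r) $ k" using r(2) by simp
    then have "(\<phi> ^^ (i + r)) b $ k mod N = (\<phi> ^^ i) b $ k mod N"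
      using k carrier_vecD[OF c] by simp
    then show "N dvd ((\<phi> ^^ (i + r)) b - (\<phi> ^^ i) b) $ k"
      using k carrier_vecD[OF c] by (simp add: mod_eq_dvd_iff)
  qed
  moreover have "shift (int i) (shift (int j) (shift (int r) x - x)) = rat_vec ((\<phi> ^^ (i + r)) b - (\<phi> ^^ i) b)"
  proof -
    have "shift (int i) (shift (int j) (shift (int r) x - x))
        = shift (int (i + r)) (shift (int j) x) - shift (int i) (shift (int j) x)"
      using jb(1) by (simp add: shift_minus shift_shift algebra_simps)
    then show ?thesis
      using jb(3) shift_rat_vec[OF jb(2), of "i + r"] shift_rat_vec[OF jb(2), of i]
      by (simp only: rat_vec_simps(2)[OF c c])
  qed
  ultimately have "shift (int i) (shift (int j) (shift (int r) x - x)) \<in> lattice_mod N"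
    using rat_vec_in_lattice_mod_iff[of "(\<phi> ^^ (i + r)) b - (\<phi> ^^ i) b" N] c
    by (metis funpow_0 minus_carrier_vec)
  then have "shift (int r) x - x \<in> lattice_mod N" using jb(1) by (simp add: lattice_mod_shift_iff)
  then have "shift (int r * int s) x - x \<in> lattice_mod N" for s
    by (intro shift_telescope lattice_mod_closed(2,3) lattice_mod_shift jb(1))
  then show ?thesis using r(1) by (intro exI[of _ r]) simp
qed

text \<open>If T^j x is integral and r is a period of \<open>x\<close> modulo N B, then
  \<open>x\<close> is congruent to T^(rj) x, which is integral because rj is at least j. So A maps
  onto B / N B, and reduction modulo \<open>N\<close> leaves finitely many representatives.\<close>

lemma lattice_mod_cover:
  assumes N: "N \<ge> 1" and x: "x \<in> lattice_mod 1"
  shows "\<exists>a\<in>box N. x - rat_vec a \<in> lattice_mod N"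
proof -
  obtain j b where jb: "x \<in> carrier_vec n" "b \<in> carrier_vec n" "shift (int j) x = rat_vec b"
    using x by (auto simp: lattice_mod_def)
  obtain r where r: "r \<ge> 1" "\<forall>s. shift (int (r * s)) x - x \<in> lattice_mod N"
    using shift_periodic[OF N x] by (elim exE conjE)
  have le: "j \<le> r * j" using mult_le_mono1[OF r(1), of j] by simp
  define c where "c = (\<phi> ^^ (r * j - j)) b"
  have c: "c \<in> carrier_vec n"
    unfolding c_def using hom_Zn_simps(1)[OF funpow_hom_Zn[OF hom] jb(2) jb(2)] .
  have "shift (int (r * j)) x = shift (int (r * j - j)) (shift (int j) x)"
    using le jb(1) by (simp only: shift_shift of_nat_diff) simp
  then have eq: "shift (int (r * j)) x = rat_vec c" using jb by (simp add: shift_rat_vec c_def)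
  let ?a = "map_vec (\<lambda>z. z mod N) c"
  have a: "?a \<in> carrier_vec n" "?a \<in> box N" using c box_representative(1)[OF N c] by auto
  have "rat_vec (c - ?a) \<in> lattice_mod N"
    using box_representative(2)[OF N c] c a(1) by (intro rat_vec_in_lattice_modI) simp_all
  then have "rat_vec c - rat_vec ?a \<in> lattice_mod N" by (simp add: rat_vec_simps(2)[OF c a(1)])
  moreover have "rat_vec c - x \<in> lattice_mod N" using spec[OF r(2), of j] by (simp only: eq)
  ultimately have "(rat_vec c - rat_vec ?a) - (rat_vec c - x) \<in> lattice_mod N"
    by (rule lattice_mod_closed(5))
  also have "(rat_vec c - rat_vec ?a) - (rat_vec c - x) = x - rat_vec ?a"
    using c a jb(1) by (intro eq_vecI) auto
  finally show ?thesis using a(2) by blast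
qed

section \<open>The mapping torus\<close>

text \<open>The mapping torus \<open>B \<rtimes> \<int>\<close> of \<open>T\<close> on \<open>B = lattice_mod 1\<close>.\<close>

definition torus :: "(rat vec \<times> int) monoid" where
  "torus = \<lparr>carrier = lattice_mod 1 \<times> UNIV,
     monoid.mult = (\<lambda>(x, m) (y, k). (x + shift m y, m + k)), one = (0\<^sub>v n, 0)\<rparr>"

lemma torus_simps [simp]:
  "(x, m) \<in> carrier torus \<longleftrightarrow> x \<in> lattice_mod 1"
  "(x, m) \<otimes>\<^bsub>torus\<^esub> (y, k) = (x + shift m y, m + k)"
  "\<one>\<^bsub>torus\<^esub> = (0\<^sub>v n, 0)"
  by (simp_all add: torus_def)

lemma carrier_torusE:
  assumes "g \<in> carrier torus"
  obtains x m where "g = (x, m)" "x \<in> lattice_mod 1" "x \<in> carrier_vec n"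
proof -
  obtain x m where g: "g = (x, m)" by force
  then have "x \<in> lattice_mod 1" using assms by simp
  then show ?thesis using that g lattice_mod_closed(1) by blast
qed

lemma group_torus: "group torus"
proof (rule groupI)
  fix g h assume "g \<in> carrier torus" "h \<in> carrier torus"
  then obtain x m y k where "g = (x, m)" "x \<in> lattice_mod 1" "h = (y, k)" "y \<in> lattice_mod 1"
    by (elim carrier_torusE)
  then show "g \<otimes>\<^bsub>torus\<^esub> h \<in> carrier torus"
    by (simp add: lattice_mod_closed(3) lattice_mod_shift)
next
  fix g h i assume "g \<in> carrier torus" "h \<in> carrier torus" "i \<in> carrier torus"
  then obtain x m y k z l where g: "g = (x, m)" "h = (y, k)" "i = (z, l)"
    and c: "x \<in> carrier_vec n" "y \<in> carrier_vec n" "z \<in> carrier_vec n"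
    by (elim carrier_torusE)
  have "x + shift m y + shift (m + k) z = x + (shift m y + shift (m + k) z)"
    by (rule assoc_add_vec[OF c(1) shift_closed[OF c(2)] shift_closed[OF c(3)]])
  then show "g \<otimes>\<^bsub>torus\<^esub> h \<otimes>\<^bsub>torus\<^esub> i = g \<otimes>\<^bsub>torus\<^esub> (h \<otimes>\<^bsub>torus\<^esub> i)"
    using c by (simp add: g shift_add shift_shift)
next
  show "\<one>\<^bsub>torus\<^esub> \<in> carrier torus" by (simp add: lattice_mod_closed(2))
next
  fix g assume "g \<in> carrier torus"
  then obtain x m where g: "g = (x, m)" "x \<in> lattice_mod 1" "x \<in> carrier_vec n"
    by (elim carrier_torusE)
  show "\<one>\<^bsub>torus\<^esub> \<otimes>\<^bsub>torus\<^esub> g = g" using g by simp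
  have "(- shift (- m) x, - m) \<otimes>\<^bsub>torus\<^esub> g = \<one>\<^bsub>torus\<^esub>" using g by simp
  moreover have "(- shift (- m) x, - m) \<in> carrier torus"
    using g by (simp add: lattice_mod_closed(4) lattice_mod_shift)
  ultimately show "\<exists>h\<in>carrier torus. h \<otimes>\<^bsub>torus\<^esub> g = \<one>\<^bsub>torus\<^esub>" by blast
qed

sublocale torus: group torus by (rule group_torus)

lemma inv_torus:
  assumes "x \<in> lattice_mod 1"
  shows "inv\<^bsub>torus\<^esub> (x, m) = (- shift (- m) x, - m)"
proof (rule torus.inv_equality)
  have "x \<in> carrier_vec n" using assms by (rule lattice_mod_closed(1))
  then show "(- shift (- m) x, - m) \<otimes>\<^bsub>torus\<^esub> (x, m) = \<one>\<^bsub>torus\<^esub>" by simp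
qed (use assms in \<open>simp_all add: lattice_mod_closed(4) lattice_mod_shift\<close>)

lemma snd_torus_pow:
  assumes "g \<in> carrier torus" shows "snd (g [^]\<^bsub>torus\<^esub> (k :: int)) = k * snd g"
proof -
  have mult: "snd (g \<otimes>\<^bsub>torus\<^esub> h) = snd g + snd h" for g h
    by (cases g; cases h) simp
  have nat: "snd (g [^]\<^bsub>torus\<^esub> (j :: nat)) = int j * snd g" for j
  proof (induction j)
    case 0
    have "g [^]\<^bsub>torus\<^esub> (0 :: nat) = \<one>\<^bsub>torus\<^esub>" by (rule torus.nat_pow_0)
    then show ?case by simp
  next
    case (Suc j)
    have "g [^]\<^bsub>torus\<^esub> Suc j = g [^]\<^bsub>torus\<^esub> j \<otimes>\<^bsub>torus\<^esub> g" by (rule torus.nat_pow_Suc)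
    then show ?case using Suc.IH by (simp only: mult) (simp add: algebra_simps)
  qed
  obtain j where "k = int j \<or> k = - int j" by (metis int_cases2)
  then show ?thesis
  proof
    assume "k = int j"
    then show ?thesis using nat[of j] by (simp add: int_pow_int)
  next
    assume k: "k = - int j"
    obtain x m where xm: "g [^]\<^bsub>torus\<^esub> j = (x, m)" by force
    then have x: "x \<in> lattice_mod 1" using torus.nat_pow_closed[OF assms, of j] by simp
    have "g [^]\<^bsub>torus\<^esub> k = inv\<^bsub>torus\<^esub> (x, m)"
      unfolding k using torus.int_pow_neg_int[OF assms, of j] xm by simp
    then show ?thesis using nat[of j] xm k by (simp add: inv_torus[OF x])
  qed
qed

lemma torus_pow_translation:
  assumes v: "v \<in> lattice_mod 1"
  shows "(v, 0) [^]\<^bsub>torus\<^esub> (k :: int) = (of_int k \<cdot>\<^sub>v v, 0)"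
proof (induction k rule: int_induct[where k = 0])
  have vc: "v \<in> carrier_vec n" using v by (rule lattice_mod_closed(1))
  have c: "(v, 0) \<in> carrier torus" using v by simp
  case base
  have "0 \<cdot>\<^sub>v v = 0\<^sub>v n" using vc by auto
  then show ?case by simp
next
  have vc: "v \<in> carrier_vec n" using v by (rule lattice_mod_closed(1))
  have c: "(v, 0) \<in> carrier torus" using v by simp
  case (step1 i)
  have "(v, 0) [^]\<^bsub>torus\<^esub> (i + 1) = (v, 0) [^]\<^bsub>torus\<^esub> i \<otimes>\<^bsub>torus\<^esub> (v, 0)"
    using torus.int_pow_mult[OF c, of i 1] torus.int_pow_1[OF c] by simp
  then show ?case using step1 vc by (simp add: add_smult_distrib_vec)
next
  have vc: "v \<in> carrier_vec n" using v by (rule lattice_mod_closed(1))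
  have c: "(v, 0) \<in> carrier torus" using v by simp
  case (step2 i)
  have "(v, 0) [^]\<^bsub>torus\<^esub> (i - 1) = (v, 0) [^]\<^bsub>torus\<^esub> i \<otimes>\<^bsub>torus\<^esub> inv\<^bsub>torus\<^esub> (v, 0)"
    using torus.int_pow_diff[OF c, of i 1] torus.int_pow_1[OF c] by simp
  also have "\<dots> = (of_int i \<cdot>\<^sub>v v + - v, 0)" using step2 vc by (simp add: inv_torus[OF v])
  also have "of_int i \<cdot>\<^sub>v v + - v = of_int (i - 1) \<cdot>\<^sub>v v"
    using vc by (intro eq_vecI) (auto simp: algebra_simps)
  finally show ?case .
qed

lemma torus_pow_stable: "(0\<^sub>v n, 1) [^]\<^bsub>torus\<^esub> (k :: int) = (0\<^sub>v n, k)"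
proof (induction k rule: int_induct[where k = 0])
  have c: "(0\<^sub>v n, 1) \<in> carrier torus" using lattice_mod_closed(2) by simp
  case (step1 i)
  have "(0\<^sub>v n, 1) [^]\<^bsub>torus\<^esub> (i + 1) = (0\<^sub>v n, 1) [^]\<^bsub>torus\<^esub> i \<otimes>\<^bsub>torus\<^esub> (0\<^sub>v n, 1)"
    using torus.int_pow_mult[OF c, of i 1] torus.int_pow_1[OF c] by simp
  then show ?case using step1 by simp
next
  have c: "(0\<^sub>v n, 1) \<in> carrier torus" using lattice_mod_closed(2) by simp
  case (step2 i)
  have "(0\<^sub>v n, 1) [^]\<^bsub>torus\<^esub> (i - 1) = (0\<^sub>v n, 1) [^]\<^bsub>torus\<^esub> i \<otimes>\<^bsub>torus\<^esub> inv\<^bsub>torus\<^esub> (0\<^sub>v n, 1)"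
    using torus.int_pow_diff[OF c, of i 1] torus.int_pow_1[OF c] by simp
  then show ?case using step2 by (simp add: inv_torus[OF lattice_mod_closed(2)])
qed simp

section \<open>Separating cyclic subgroups of the mapping torus\<close>

lemma torus_finite_index:
  assumes H: "subgroup H torus" and N: "N \<ge> 1" "\<And>x. x \<in> lattice_mod N \<Longrightarrow> (x, 0) \<in> H"
    and g: "g \<in> H" "snd g \<noteq> 0"
  shows "finite_index_subgroup H torus"
proof (rule finite_index_subgroupI[OF group_torus H])
  \<comment> \<open>Division with remainder: a power of \<open>g\<close> brings the integer
    component into the range below |snd g|, and N B then brings the vector component into
    \<open>box N\<close>.\<close>
  let ?F = "(\<lambda>a. rat_vec a) ` box N \<times> {0..<\<bar>snd g\<bar>}"
  show "finite ?F" using finite_box by simp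
  show F: "?F \<subseteq> carrier torus" by (auto simp: box_def rat_vec_in_lattice)
  fix h assume h: "h \<in> carrier torus"
  then obtain x y where hxy: "h = (x, y)" "x \<in> lattice_mod 1" "x \<in> carrier_vec n" by (elim carrier_torusE)
  have gc: "g \<in> carrier torus" using H g(1) by (rule subgroup.mem_carrier)
  define r where "r = y mod \<bar>snd g\<bar>"
  have r: "0 \<le> r" "r < \<bar>snd g\<bar>" using g(2) by (simp_all add: r_def)
  have "snd g dvd y - r" unfolding r_def by (metis abs_dvd_iff dvd_minus_mod)
  then obtain k where k: "y - r = k * snd g" by (metis dvd_div_mult_self)
  let ?u = "g [^]\<^bsub>torus\<^esub> k"
  have u: "?u \<in> H" using torus.subgroup_int_pow_closed[OF H g(1)] .
  have uc: "?u \<in> carrier torus" using H u by (rule subgroup.mem_carrier)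
  have su: "snd ?u = y - r" using snd_torus_pow[OF gc] k by simp
  obtain w where w: "?u = (w, y - r)" using su by (metis prod.collapse)
  have wL: "w \<in> lattice_mod 1" using uc w by simp
  define x' where "x' = fst (inv\<^bsub>torus\<^esub> ?u \<otimes>\<^bsub>torus\<^esub> h)"
  have eq: "inv\<^bsub>torus\<^esub> ?u \<otimes>\<^bsub>torus\<^esub> h = (x', r)"
    unfolding x'_def w hxy(1) inv_torus[OF wL] by simp
  then have "(x', r) \<in> carrier torus" using uc h torus.m_closed torus.inv_closed by metis
  then have x': "x' \<in> lattice_mod 1" "x' \<in> carrier_vec n" using lattice_mod_closed(1) by auto
  obtain a where a: "a \<in> box N" "x' - rat_vec a \<in> lattice_mod N" using lattice_mod_cover[OF N(1) x'(1)] by blast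
  have ac: "a \<in> carrier_vec n" using a by (simp add: box_def)
  have f: "(rat_vec a, r) \<in> ?F" using a r by simp
  have fc: "(rat_vec a, r) \<in> carrier torus" using f F by blast
  have diff: "x' - rat_vec a + rat_vec a = x'" using x' ac by (intro eq_vecI) auto
  have "(x' - rat_vec a, 0) \<otimes>\<^bsub>torus\<^esub> (rat_vec a, r) = (x', r)" using ac diff by simp
  moreover have dc: "(x' - rat_vec a, 0) \<in> carrier torus" using lattice_mod_subset[OF a(2)] by simp
  ultimately have "(x', r) \<otimes>\<^bsub>torus\<^esub> inv\<^bsub>torus\<^esub> (rat_vec a, r) = (x' - rat_vec a, 0)"
    using fc by (metis torus.inv_solve_right torus.m_closed)
  moreover have "h = ?u \<otimes>\<^bsub>torus\<^esub> (x', r)"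
    using eq uc h by (metis torus.inv_solve_left torus.m_closed torus.inv_closed)
  ultimately have "h \<otimes>\<^bsub>torus\<^esub> inv\<^bsub>torus\<^esub> (rat_vec a, r) = ?u \<otimes>\<^bsub>torus\<^esub> (x' - rat_vec a, 0)"
    using uc fc x' by (simp only: torus.m_assoc torus.inv_closed torus_simps(1))
  also have "\<dots> \<in> H" using subgroup.m_closed[OF H u N(2)[OF a(2)]] .
  finally show "\<exists>f\<in>?F. h \<otimes>\<^bsub>torus\<^esub> inv\<^bsub>torus\<^esub> f \<in> H" using f by blast
qed

text \<open>A high power of T moves \<open>v\<close> and \<open>w\<close> into Z^n and preserves N
  B, so \<open>cyclic_complement_mod\<close> applies. The alternative \<open>v = 0\<close> separates
  nonzero elements of B from 0; it serves the cyclic subgroups whose generator lies outside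
  B.\<close>

lemma lattice_complement:
  assumes v: "v \<in> lattice_mod 1" and w: "w \<in> lattice_mod 1" "\<And>c. w \<noteq> of_int c \<cdot>\<^sub>v v"
    and coll: "v = 0\<^sub>v n \<or> (\<forall>p. prime p \<longrightarrow> collapsing n \<phi> p \<subseteq> {0\<^sub>v n})"
  shows "\<exists>N\<ge>1. \<forall>c. w - of_int c \<cdot>\<^sub>v v \<notin> lattice_mod N"
proof -
  obtain i where i: "v \<in> carrier_vec n"
    "\<And>k. k \<ge> i \<Longrightarrow> \<exists>a\<in>carrier_vec n. vec_dvd 1 a \<and> shift (int k) v = rat_vec a"
    using lattice_modE[OF v] by blast
  obtain j where j: "w \<in> carrier_vec n"
    "\<And>k. k \<ge> j \<Longrightarrow> \<exists>a\<in>carrier_vec n. vec_dvd 1 a \<and> shift (int k) w = rat_vec a"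
    using lattice_modE[OF w(1)] by blast
  let ?k = "max i j"
  obtain a b where a: "a \<in> carrier_vec n" "shift (int ?k) v = rat_vec a"
    and b: "b \<in> carrier_vec n" "shift (int ?k) w = rat_vec b"
    using i(2)[of ?k] j(2)[of ?k] by auto
  have diff: "shift (int ?k) (w - of_int c \<cdot>\<^sub>v v) = rat_vec (b - c \<cdot>\<^sub>v a)" for c
    using i(1) j(1) a b
    by (simp add: shift_minus shift_of_int_smult rat_vec_simps(4) rat_vec_simps(2)[of _ n])
  have ne: "b \<noteq> c \<cdot>\<^sub>v a" for c
  proof
    assume "b = c \<cdot>\<^sub>v a"
    then have "shift (int ?k) w = shift (int ?k) (of_int c \<cdot>\<^sub>v v)"
      using a b i(1) by (simp add: shift_of_int_smult rat_vec_simps(4))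
    then have "w = of_int c \<cdot>\<^sub>v v" using shift_inj[OF j(1)] i(1) by simp
    then show False using w(2) by blast
  qed
  have "a = 0\<^sub>v n \<or> (\<forall>p. prime p \<longrightarrow> a \<notin> collapsing n \<phi> p)"
  proof (cases "v = 0\<^sub>v n")
    case True
    have "rat_vec (0\<^sub>v n) = 0\<^sub>v n" by (intro eq_vecI) auto
    moreover have "shift (int ?k) v = 0\<^sub>v n" unfolding True by (rule shift_zero)
    ultimately have "rat_vec a = rat_vec (0\<^sub>v n)" using a(2) by metis
    then show ?thesis unfolding rat_vec_inject by (rule disjI1)
  qed (use coll in blast)
  then obtain N where N: "N \<ge> 1" "\<And>c j. \<not> vec_dvd N ((\<phi> ^^ j) (b - c \<cdot>\<^sub>v a))"
    using cyclic_complement_mod[OF mon a(1) b(1) ne] by blast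
  have "w - of_int c \<cdot>\<^sub>v v \<notin> lattice_mod N" for c
  proof
    assume "w - of_int c \<cdot>\<^sub>v v \<in> lattice_mod N"
    then have "rat_vec (b - c \<cdot>\<^sub>v a) \<in> lattice_mod N" using lattice_mod_shift diff by metis
    then show False using N(2) rat_vec_in_lattice_mod_iff[of "b - c \<cdot>\<^sub>v a" N] a b by simp
  qed
  then show ?thesis using N(1) by blast
qed

lemma normal_translations: "normal (lattice_mod N \<times> {0 :: int}) torus"
proof (rule torus.normal_invI)
  have sub: "x \<in> lattice_mod N \<Longrightarrow> x \<in> carrier_vec n" for x by (rule lattice_mod_closed(1))
  show "subgroup (lattice_mod N \<times> {0 :: int}) torus"
  proof (rule torus.subgroupI)
    show "lattice_mod N \<times> {0 :: int} \<subseteq> carrier torus" using lattice_mod_subset by auto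
    show "lattice_mod N \<times> {0 :: int} \<noteq> {}" using lattice_mod_closed(2) by blast
  next
    fix g assume "g \<in> lattice_mod N \<times> {0 :: int}"
    then obtain x where x: "g = (x, 0)" "x \<in> lattice_mod N" by blast
    show "inv\<^bsub>torus\<^esub> g \<in> lattice_mod N \<times> {0 :: int}"
      unfolding x(1) inv_torus[OF lattice_mod_subset[OF x(2)]]
      using sub[OF x(2)] lattice_mod_closed(4)[OF x(2)] by simp
  next
    fix g h assume "g \<in> lattice_mod N \<times> {0 :: int}" "h \<in> lattice_mod N \<times> {0 :: int}"
    then obtain x y where xy: "g = (x, 0)" "x \<in> lattice_mod N" "h = (y, 0)" "y \<in> lattice_mod N" by blast
    show "g \<otimes>\<^bsub>torus\<^esub> h \<in> lattice_mod N \<times> {0 :: int}"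
      unfolding xy(1,3) using sub[OF xy(4)] lattice_mod_closed(3)[OF xy(2,4)] by simp
  qed
  fix g h assume "g \<in> carrier torus" "h \<in> lattice_mod N \<times> {0 :: int}"
  then obtain y k x where g: "g = (y, k)" "y \<in> lattice_mod 1" "y \<in> carrier_vec n"
    and h: "h = (x, 0)" "x \<in> lattice_mod N" by (elim carrier_torusE) blast
  have x: "x \<in> carrier_vec n" using h(2) by (rule sub)
  have "y + shift k x + shift k (- shift (- k) y) = y + shift k x + - y"
    using g x by (simp add: shift_uminus shift_shift)
  also have "\<dots> = shift k x" using g(3) shift_closed[OF x, of k] by (intro eq_vecI) auto
  finally show "g \<otimes>\<^bsub>torus\<^esub> h \<otimes>\<^bsub>torus\<^esub> inv\<^bsub>torus\<^esub> g \<in> lattice_mod N \<times> {0 :: int}"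
    using g h lattice_mod_shift[OF h(2), of k] by (simp add: inv_torus)
qed

text \<open>Because \<open>snd g\<close> is nonzero, the integer component of \<open>h\<close>
  leaves at most one exponent \<open>k\<close> for which \<open>h\<close> can lie in N B g^k. It
  suffices to keep h g^(-k), a nontrivial element of B, out of N B.\<close>

lemma separable_nontranslation:
  assumes g: "g \<in> carrier torus" "snd g \<noteq> 0" and h: "h \<in> carrier torus" "h \<notin> generate torus {g}"
  shows "\<exists>H. finite_index_subgroup H torus \<and> generate torus {g} \<subseteq> H \<and> h \<notin> H"
proof -
  let ?C = "generate torus {g}"
  have C: "?C = {g [^]\<^bsub>torus\<^esub> (k :: int) | k. k \<in> UNIV}" by (rule torus.generate_pow[OF g(1)])
  have sub: "subgroup ?C torus" using g(1) by (intro torus.generate_is_subgroup) simp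
  have gC: "g \<in> ?C" by (rule generate.incl) simp
  have "\<exists>N\<ge>1. \<forall>x\<in>lattice_mod N. \<forall>k :: int. h \<noteq> (x, 0) \<otimes>\<^bsub>torus\<^esub> g [^]\<^bsub>torus\<^esub> k"
  proof (cases "\<exists>k. snd h = k * snd g")
    case True
    then obtain k where k: "snd h = k * snd g" by blast
    have pow: "g [^]\<^bsub>torus\<^esub> k \<in> carrier torus" using g(1) by (rule torus.int_pow_closed)
    let ?d = "h \<otimes>\<^bsub>torus\<^esub> inv\<^bsub>torus\<^esub> (g [^]\<^bsub>torus\<^esub> k)"
    obtain w m where w: "g [^]\<^bsub>torus\<^esub> k = (w, m)" by force
    have wL: "w \<in> lattice_mod 1" and m: "m = k * snd g" using pow w snd_torus_pow[OF g(1), of k] by simp_all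
    have dc: "?d \<in> carrier torus" using h(1) pow by simp
    have "snd ?d = 0" using k by (cases h) (simp add: w inv_torus[OF wL] m)
    then obtain u where u: "?d = (u, 0)" by (metis prod.collapse)
    have uL: "u \<in> lattice_mod 1" using dc u by simp
    have hd: "h = (u, 0) \<otimes>\<^bsub>torus\<^esub> g [^]\<^bsub>torus\<^esub> k"
      using u h(1) pow by (metis torus.inv_solve_right' dc)
    have "u \<noteq> 0\<^sub>v n"
    proof
      assume "u = 0\<^sub>v n"
      then have "h = g [^]\<^bsub>torus\<^esub> k" using hd pow torus.l_one torus_simps(3) by metis
      then show False using h(2) C by blast
    qed
    have zero: "of_int c \<cdot>\<^sub>v 0\<^sub>v n = (0\<^sub>v n :: rat vec)" for c by (intro eq_vecI) auto
    obtain N where N: "N \<ge> 1" "\<And>c. u - of_int c \<cdot>\<^sub>v 0\<^sub>v n \<notin> lattice_mod N"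
      using lattice_complement[OF lattice_mod_closed(2) uL] \<open>u \<noteq> 0\<^sub>v n\<close> zero by metis
    have uN: "u \<notin> lattice_mod N"
    proof -
      have "u - 0\<^sub>v n = u" using lattice_mod_closed(1)[OF uL] by (intro eq_vecI) auto
      then show ?thesis using N(2)[of 0, unfolded zero] by simp
    qed
    have "h \<noteq> (x, 0) \<otimes>\<^bsub>torus\<^esub> g [^]\<^bsub>torus\<^esub> k'" if x: "x \<in> lattice_mod N" for x and k' :: int
    proof
      assume eq: "h = (x, 0) \<otimes>\<^bsub>torus\<^esub> g [^]\<^bsub>torus\<^esub> k'"
      have "snd ((x, 0) \<otimes>\<^bsub>torus\<^esub> q) = snd q" for q by (cases q) simp
      then have "k' * snd g = k * snd g" using k eq snd_torus_pow[OF g(1), of k'] by metis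
      then have "k' = k" using g(2) by simp
      then have "(x, 0) \<otimes>\<^bsub>torus\<^esub> g [^]\<^bsub>torus\<^esub> k = (u, 0) \<otimes>\<^bsub>torus\<^esub> g [^]\<^bsub>torus\<^esub> k" using eq hd by simp
      moreover have "(x, 0) \<in> carrier torus" "(u, 0) \<in> carrier torus" using lattice_mod_subset[OF x] uL by simp_all
      ultimately have "(x, 0 :: int) = (u, 0)" using pow torus.right_cancel by metis
      then show False using x uN by simp
    qed
    then show ?thesis using N(1) by blast
  next
    case False
    have "h \<noteq> (x, 0) \<otimes>\<^bsub>torus\<^esub> g [^]\<^bsub>torus\<^esub> k" for x and k :: int
    proof
      assume eq: "h = (x, 0) \<otimes>\<^bsub>torus\<^esub> g [^]\<^bsub>torus\<^esub> k"
      have "snd ((x, 0) \<otimes>\<^bsub>torus\<^esub> q) = snd q" for q by (cases q) simp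
      then have "snd h = k * snd g" using eq snd_torus_pow[OF g(1), of k] by metis
      then show False using False by blast
    qed
    \<comment> \<open>The integer components already differ, so any modulus will do.\<close>
    then show ?thesis by (intro exI[of _ 1]) simp
  qed
  then obtain N where N: "N \<ge> 1"
    "\<And>x k. x \<in> lattice_mod N \<Longrightarrow> h \<noteq> (x, 0) \<otimes>\<^bsub>torus\<^esub> g [^]\<^bsub>torus\<^esub> (k :: int)" by blast
  let ?H = "(lattice_mod N \<times> {0 :: int}) <#>\<^bsub>torus\<^esub> ?C"
  have H: "subgroup ?H torus" by (rule torus.mult_norm_subgroup[OF normal_translations sub])
  have C_sub: "?C \<subseteq> ?H"
  proof
    fix c assume c: "c \<in> ?C"
    have "\<one>\<^bsub>torus\<^esub> \<otimes>\<^bsub>torus\<^esub> c = c" by (rule torus.l_one[OF subgroup.mem_carrier[OF sub c]])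
    moreover have "\<one>\<^bsub>torus\<^esub> \<in> lattice_mod N \<times> {0 :: int}" using lattice_mod_closed(2) by simp
    ultimately show "c \<in> ?H" using c unfolding set_mult_def by force
  qed
  have trans_sub: "(x, 0) \<in> ?H" if x: "x \<in> lattice_mod N" for x
  proof -
    have "(x, 0) \<otimes>\<^bsub>torus\<^esub> \<one>\<^bsub>torus\<^esub> = (x, 0)"
      using lattice_mod_subset[OF x] by (intro torus.r_one) simp
    moreover have "\<one>\<^bsub>torus\<^esub> \<in> ?C" by (rule generate.one)
    ultimately show ?thesis using x unfolding set_mult_def by force
  qed
  have "finite_index_subgroup ?H torus"
    by (rule torus_finite_index[OF H N(1) trans_sub subsetD[OF C_sub gC] g(2)])
  moreover have "h \<notin> ?H"
  proof
    assume "h \<in> ?H"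
    then obtain x c where xc: "x \<in> lattice_mod N" "c \<in> ?C" "h = (x, 0) \<otimes>\<^bsub>torus\<^esub> c"
      by (auto simp: set_mult_def)
    then obtain k :: int where "c = g [^]\<^bsub>torus\<^esub> k" using C by auto
    then show False using N(2)[OF xc(1), of k] xc(3) by simp
  qed
  ultimately show ?thesis using C_sub by (intro exI[of _ ?H] conjI)
qed

text \<open>\<open>H\<close> is (Z v + N B) \<rtimes> q Z. By the hypothesis on \<open>q\<close>,
  T^q fixes \<open>v\<close> modulo N B, so Z v + N B is stable under the powers of T^q.\<close>

lemma translation_neighbourhood_subgroup:
  assumes v: "v \<in> lattice_mod 1" and q: "shift q v - v \<in> lattice_mod N"
  defines "H \<equiv> {(x, y). x \<in> lattice_mod 1 \<and> q dvd y \<and> (\<exists>c. x - of_int c \<cdot>\<^sub>v v \<in> lattice_mod N)}"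
  shows "subgroup H torus"
proof -
  have vc: "v \<in> carrier_vec n" using v by (rule lattice_mod_closed(1))
  have per: "shift (q * z) v - v \<in> lattice_mod N" for z
  proof (cases "z \<ge> 0")
    case True
    then obtain s where "z = int s" by (metis nonneg_int_cases)
    then show ?thesis
      using q by (auto intro!: shift_telescope lattice_mod_closed(2,3) lattice_mod_shift vc)
  next
    case False
    \<comment> \<open>Telescoping covers only positive multiples of \<open>q\<close>; a negative one
      follows by applying T^(-qs) to the difference for \<open>s\<close>.\<close>
    then obtain s where s: "z = - int s" by (metis int_cases2 le_refl of_nat_0_le_iff)
    have "shift (q * int s) v - v \<in> lattice_mod N"
      using q by (intro shift_telescope lattice_mod_closed(2,3) lattice_mod_shift vc)
    then have "shift (- (q * int s)) (shift (q * int s) v - v) \<in> lattice_mod N" by (rule lattice_mod_shift)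
    also have "shift (- (q * int s)) (shift (q * int s) v - v) = v - shift (q * z) v"
      using vc s by (simp add: shift_minus shift_shift)
    finally have "- (v - shift (q * z) v) \<in> lattice_mod N" by (rule lattice_mod_closed(4))
    also have "- (v - shift (q * z) v) = shift (q * z) v - v"
      using carrier_vecD[OF vc] carrier_vecD[OF shift_closed[OF vc, of "q * z"]]
      by (intro eq_vecI) simp_all
    finally show ?thesis .
  qed
  show ?thesis
  proof (rule torus.subgroupI)
    show "H \<subseteq> carrier torus" by (auto simp: H_def)
    have "0\<^sub>v n - of_int 0 \<cdot>\<^sub>v v = 0\<^sub>v n" using vc by (intro eq_vecI) auto
    then have "(0\<^sub>v n, 0) \<in> H"
      using lattice_mod_closed(2) by (auto simp: H_def intro!: exI[of _ 0])
    then show "H \<noteq> {}" by blast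
  next
    fix g assume "g \<in> H"
    then obtain x y c where g: "g = (x, y)" "x \<in> lattice_mod 1" "q dvd y"
      "x - of_int c \<cdot>\<^sub>v v \<in> lattice_mod N" by (auto simp: H_def)
    have xc: "x \<in> carrier_vec n" using g(2) by (rule lattice_mod_closed(1))
    obtain z where z: "y = q * z" using g(3) by blast
    \<comment> \<open>The vector of the inverse is - T^(-y) x, and T^(-y) x - c v is the sum of
      T^(-y)(x - c v) and c (T^(-y) v - v), both in N B.\<close>
    have "shift (- y) (x - of_int c \<cdot>\<^sub>v v) + of_int c \<cdot>\<^sub>v (shift (q * (- z)) v - v) \<in> lattice_mod N"
      by (intro lattice_mod_closed(3,6) lattice_mod_shift g(4) per)
    then have "- (shift (- y) (x - of_int c \<cdot>\<^sub>v v) + of_int c \<cdot>\<^sub>v (shift (- y) v - v)) \<in> lattice_mod N"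
      using z by (intro lattice_mod_closed(4)) simp
    also have "- (shift (- y) (x - of_int c \<cdot>\<^sub>v v) + of_int c \<cdot>\<^sub>v (shift (- y) v - v))
        = - shift (- y) x - of_int (- c) \<cdot>\<^sub>v v"
    proof -
      have "shift (- y) (x - of_int c \<cdot>\<^sub>v v) = shift (- y) x - of_int c \<cdot>\<^sub>v shift (- y) v"
        using xc vc by (simp add: shift_minus shift_of_int_smult)
      then show ?thesis
        using carrier_vecD[OF shift_closed[OF xc, of "- y"]] carrier_vecD[OF shift_closed[OF vc, of "- y"]]
          carrier_vecD[OF vc]
        by (intro eq_vecI) (simp_all add: algebra_simps)
    qed
    finally have "\<exists>c. - shift (- y) x - of_int c \<cdot>\<^sub>v v \<in> lattice_mod N" by (rule exI)
    moreover have "q dvd - y" using g(3) by simp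
    ultimately show "inv\<^bsub>torus\<^esub> g \<in> H"
      using lattice_mod_closed(4)[OF lattice_mod_shift[OF g(2), of "- y"]]
      unfolding H_def g(1) inv_torus[OF g(2)] by blast
  next
    fix g h assume "g \<in> H" "h \<in> H"
    then obtain x y c x' y' c' where g: "g = (x, y)" "x \<in> lattice_mod 1" "q dvd y"
      "x - of_int c \<cdot>\<^sub>v v \<in> lattice_mod N" and h: "h = (x', y')" "x' \<in> lattice_mod 1" "q dvd y'"
      "x' - of_int c' \<cdot>\<^sub>v v \<in> lattice_mod N" by (auto simp: H_def)
    have xc: "x \<in> carrier_vec n" "x' \<in> carrier_vec n" using g(2) h(2) lattice_mod_closed(1) by auto
    obtain z where z: "y = q * z" using g(3) by blast
    have "(x - of_int c \<cdot>\<^sub>v v) + (shift y (x' - of_int c' \<cdot>\<^sub>v v) + of_int c' \<cdot>\<^sub>v (shift y v - v)) \<in> lattice_mod N"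
      unfolding z by (intro lattice_mod_closed(3,6) lattice_mod_shift g(4) h(4) per)
    also have "(x - of_int c \<cdot>\<^sub>v v) + (shift y (x' - of_int c' \<cdot>\<^sub>v v) + of_int c' \<cdot>\<^sub>v (shift y v - v))
        = x + shift y x' - of_int (c + c') \<cdot>\<^sub>v v"
    proof -
      have "shift y (x' - of_int c' \<cdot>\<^sub>v v) = shift y x' - of_int c' \<cdot>\<^sub>v shift y v"
        using xc vc by (simp add: shift_minus shift_of_int_smult)
      then show ?thesis
        using carrier_vecD[OF shift_closed[OF xc(2), of y]] carrier_vecD[OF shift_closed[OF vc, of y]]
          carrier_vecD[OF vc] carrier_vecD[OF xc(1)]
        by (intro eq_vecI) (simp_all add: algebra_simps)
    qed
    finally have "\<exists>c. x + shift y x' - of_int c \<cdot>\<^sub>v v \<in> lattice_mod N" by blast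
    moreover have "q dvd y + y'" using g(3) h(3) by simp
    moreover have "x + shift y x' \<in> lattice_mod 1"
      using lattice_mod_closed(3)[OF g(2) lattice_mod_shift[OF h(2)]] .
    ultimately show "g \<otimes>\<^bsub>torus\<^esub> h \<in> H" unfolding H_def g(1) h(1) torus_simps(2) by blast
  qed
qed

text \<open>The separating subgroup is (Z v + N B) \<rtimes> q Z. For a translation
  \<open>h\<close>, \<open>N\<close> comes from \<open>lattice_complement\<close> and
  \<open>q\<close> is a period of \<open>v\<close> modulo N B. If \<open>h\<close> has integer
  component s \<noteq> 0, then N = 1 and q = |s| + 1, which does not divide s.\<close>

lemma separable_translation:
  assumes v: "v \<in> lattice_mod 1" and h: "h \<in> carrier torus" "h \<notin> generate torus {(v, 0)}"
    and coll: "\<And>p. prime p \<Longrightarrow> collapsing n \<phi> p \<subseteq> {0\<^sub>v n}"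
  shows "\<exists>H. finite_index_subgroup H torus \<and> generate torus {(v, 0)} \<subseteq> H \<and> h \<notin> H"
proof -
  have vc: "v \<in> carrier_vec n" using v by (rule lattice_mod_closed(1))
  have gc: "(v, 0) \<in> carrier torus" using v by simp
  let ?H = "\<lambda>q N. {(x, y). x \<in> lattice_mod 1 \<and> q dvd y \<and> (\<exists>c. x - of_int c \<cdot>\<^sub>v v \<in> lattice_mod N)}"
  have memI: "(x, y) \<in> ?H q N"
    if "x \<in> lattice_mod 1" "q dvd y" "x - of_int c \<cdot>\<^sub>v v \<in> lattice_mod N" for x y q N c
    using that by blast
  have C: "generate torus {(v, 0)} = {(of_int c \<cdot>\<^sub>v v, 0) | c. c \<in> UNIV}"
    unfolding torus.generate_pow[OF gc] torus_pow_translation[OF v] ..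
  have self: "x - of_int 0 \<cdot>\<^sub>v v = x" if "x \<in> carrier_vec n" for x
    using vc that by (intro eq_vecI) auto
  have minus_self: "x - x = 0\<^sub>v n" if "x \<in> carrier_vec n" for x :: "rat vec"
    using that by (intro eq_vecI) auto
  have fin: "finite_index_subgroup (?H q N) torus \<and> generate torus {(v, 0)} \<subseteq> ?H q N"
    if q: "q > 0" "shift q v - v \<in> lattice_mod N" and N: "N \<ge> 1" for q N
  proof
    have H: "subgroup (?H q N) torus" by (rule translation_neighbourhood_subgroup[OF v q(2)])
    show "finite_index_subgroup (?H q N) torus"
    proof (rule torus_finite_index[OF H N])
      show "(x, 0) \<in> ?H q N" if x: "x \<in> lattice_mod N" for x
      proof -
        have "x - of_int 0 \<cdot>\<^sub>v v \<in> lattice_mod N" using self lattice_mod_closed(1)[OF x] x by simp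
        then show ?thesis by (rule memI[OF lattice_mod_subset[OF x] dvd_0_right])
      qed
      have "0\<^sub>v n - of_int 0 \<cdot>\<^sub>v v \<in> lattice_mod N" using self lattice_mod_closed(2) by simp
      then show "(0\<^sub>v n, q) \<in> ?H q N" by (rule memI[OF lattice_mod_closed(2) dvd_refl])
      show "snd (0\<^sub>v n :: rat vec, q) \<noteq> 0" using q(1) by simp
    qed
    show "generate torus {(v, 0)} \<subseteq> ?H q N"
    proof
      fix g assume "g \<in> generate torus {(v, 0)}"
      then obtain c where g: "g = (of_int c \<cdot>\<^sub>v v, 0)" using C by blast
      have "of_int c \<cdot>\<^sub>v v - of_int c \<cdot>\<^sub>v v \<in> lattice_mod N"
        using minus_self[of "of_int c \<cdot>\<^sub>v v"] vc lattice_mod_closed(2) by simp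
      then show "g \<in> ?H q N" unfolding g by (rule memI[OF lattice_mod_closed(6)[OF v] dvd_0_right])
    qed
  qed
  obtain w s where ws: "h = (w, s)" "w \<in> lattice_mod 1" "w \<in> carrier_vec n"
    using carrier_torusE[OF h(1)] .
  show ?thesis
  proof (cases "s = 0")
    case False
    have "shift (\<bar>s\<bar> + 1) v - v \<in> lattice_mod 1" using lattice_mod_closed(5)[OF lattice_mod_shift[OF v] v] .
    then have "finite_index_subgroup (?H (\<bar>s\<bar> + 1) 1) torus \<and> generate torus {(v, 0)} \<subseteq> ?H (\<bar>s\<bar> + 1) 1"
      by (intro fin) auto
    moreover have "\<not> \<bar>s\<bar> + 1 dvd s"
    proof
      assume "\<bar>s\<bar> + 1 dvd s"
      then have "\<bar>s\<bar> + 1 \<le> \<bar>s\<bar>" using False by (intro zdvd_imp_le) simp_all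
      then show False by simp
    qed
    then have "h \<notin> ?H (\<bar>s\<bar> + 1) 1" using ws(1) by blast
    ultimately show ?thesis by (intro exI[of _ "?H (\<bar>s\<bar> + 1) 1"]) simp
  next
    case True
    have "w \<noteq> of_int c \<cdot>\<^sub>v v" for c using h(2) C ws(1) True by blast
    then obtain N where N: "N \<ge> 1" "\<And>c. w - of_int c \<cdot>\<^sub>v v \<notin> lattice_mod N"
      using lattice_complement[OF v ws(2)] coll by blast
    obtain r where r: "r \<ge> 1" "\<forall>s. shift (int (r * s)) v - v \<in> lattice_mod N"
      using shift_periodic[OF N(1) v] by (elim exE conjE)
    have "shift (int r) v - v \<in> lattice_mod N" using spec[OF r(2), of 1] by simp
    then have "finite_index_subgroup (?H (int r) N) torus \<and> generate torus {(v, 0)} \<subseteq> ?H (int r) N"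
      using r(1) N(1) by (intro fin) auto
    moreover have "h \<notin> ?H (int r) N" using N(2) ws(1) by blast
    ultimately show ?thesis by (intro exI[of _ "?H (int r) N"]) simp
  qed
qed

lemma torus_cyclic_subgroup_separable:
  assumes coll: "\<And>p. prime p \<Longrightarrow> collapsing n \<phi> p \<subseteq> {0\<^sub>v n}"
  shows "cyclic_subgroup_separable torus"
  unfolding cyclic_subgroup_separable_def
proof
  fix g assume g: "g \<in> carrier torus"
  have sub: "subgroup (generate torus {g}) torus" using g by (intro torus.generate_is_subgroup) simp
  show "separable_subgroup (generate torus {g}) torus"
    unfolding separable_subgroup_iff[OF group_torus sub]
  proof
    fix h assume "h \<in> carrier torus - generate torus {g}"
    then have h: "h \<in> carrier torus" "h \<notin> generate torus {g}" by simp_all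
    obtain v m where vm: "g = (v, m)" "v \<in> lattice_mod 1" using carrier_torusE[OF g] .
    show "\<exists>K. finite_index_subgroup K torus \<and> generate torus {g} \<subseteq> K \<and> h \<notin> K"
    proof (cases "m = 0")
      case True
      then show ?thesis
        using separable_translation[OF vm(2) h(1) _ coll] h(2) unfolding vm(1) by blast
    next
      case False
      then show ?thesis using separable_nontranslation[OF g _ h] vm(1) by simp
    qed
  qed
qed

lemma torus_not_cyclic_subgroup_separable:
  assumes p: "prime p" and a: "a \<in> collapsing n \<phi> p" "a \<noteq> 0\<^sub>v n"
  shows "\<not> cyclic_subgroup_separable torus"
proof
  assume css: "cyclic_subgroup_separable torus"
  have ac: "a \<in> carrier_vec n" using a(1) by (simp add: collapsing_def)
  let ?x = "rat_vec a"
  have x: "?x \<in> lattice_mod 1" "?x \<in> carrier_vec n" using rat_vec_in_lattice[OF ac] ac by auto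
  define y where "y = of_int (int p) \<cdot>\<^sub>v ?x"
  have y: "y \<in> lattice_mod 1" unfolding y_def by (rule lattice_mod_closed(6)[OF x(1)])
  have yc: "(y, 0) \<in> carrier torus" and xc: "(?x, 0) \<in> carrier torus" using x(1) y by simp_all
  have "(?x, 0) \<notin> generate torus {(y, 0)}"
  proof
    assume "(?x, 0) \<in> generate torus {(y, 0)}"
    then obtain c where "?x = of_int c \<cdot>\<^sub>v y"
      unfolding torus.generate_pow[OF yc] torus_pow_translation[OF y] by auto
    then have "rat_vec a = rat_vec ((c * int p) \<cdot>\<^sub>v a)"
      unfolding y_def by (simp add: rat_vec_simps(4) smult_smult_assoc)
    then have eq: "a = (c * int p) \<cdot>\<^sub>v a" unfolding rat_vec_inject .
    have "a $ i = 0" if "i < n" for i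
    proof -
      have "a $ i = (c * int p) * a $ i" using arg_cong[OF eq, of "\<lambda>v. v $ i"] that ac by simp
      then have "(c * int p - 1) * a $ i = 0" by (simp add: algebra_simps)
      moreover have "c * int p \<noteq> 1" using p by (auto simp: zmult_eq_1_iff prime_nat_iff)
      ultimately show ?thesis by simp
    qed
    then have "a = 0\<^sub>v n" using ac by (intro eq_vecI) auto
    then show False using a(2) by blast
  qed
  moreover have "subgroup (generate torus {(y, 0)}) torus" using yc by (intro torus.generate_is_subgroup) simp
  moreover have "separable_subgroup (generate torus {(y, 0)}) torus"
    using css yc by (simp add: cyclic_subgroup_separable_def)
  ultimately obtain H where H: "finite_index_subgroup H torus" "generate torus {(y, 0)} \<subseteq> H" "(?x, 0) \<notin> H"
    using separable_subgroup_iff[OF group_torus] xc by blast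
  have sub: "subgroup H torus" using H(1) by (simp add: finite_index_subgroup_def)
  have yH: "(y, 0) \<in> H" using H(2) generate.incl[of "(y, 0)"] by blast
  \<comment> \<open>\<open>S\<close> is the part of \<open>H\<close> inside B, as a set of vectors.
    \<open>H\<close> need not be normal, so invariance of \<open>S\<close> under T^m is obtained
    only for those m for which the m-th power of the stable letter lies in \<open>H\<close>, such as
    the multiples of \<open>e\<close> below.\<close>
  define S where "S = {z \<in> lattice_mod 1. (z, 0) \<in> H}"
  have Sc: "z \<in> carrier_vec n" if "z \<in> S" for z
    using that lattice_mod_closed(1)[of z 1] by (simp add: S_def)
  have S_add: "z + z' \<in> S" if "z \<in> S" "z' \<in> S" for z z'
    using that subgroup.m_closed[OF sub, of "(z, 0)" "(z', 0)"] Sc[OF that(2)]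
    by (simp add: S_def lattice_mod_closed(3))
  have S_smult: "of_int c \<cdot>\<^sub>v z \<in> S" if "z \<in> S" for c z
    using that torus.subgroup_int_pow_closed[OF sub, of "(z, 0)" c] lattice_mod_closed(6)[of z 1 c]
    by (simp add: S_def torus_pow_translation)
  have S_zero: "0\<^sub>v n \<in> S"
    using subgroup.one_closed[OF sub] lattice_mod_closed(2) by (simp add: S_def)
  obtain e :: nat where e: "e > 0" and e_pow: "\<forall>g\<in>carrier torus. g [^]\<^bsub>torus\<^esub> e \<in> H"
    using finite_index_subgroup_exponent[OF group_torus H(1)] by (elim exE conjE)
  have e_S: "of_int (int e) \<cdot>\<^sub>v z \<in> S" if "z \<in> lattice_mod 1" for z
    using bspec[OF e_pow, of "(z, 0)"] torus_pow_translation[OF that, of "int e"] that lattice_mod_closed(6)[OF that, of "int e"]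
    by (simp add: S_def int_pow_int)
  have tc: "(0\<^sub>v n, 1) \<in> carrier torus" using lattice_mod_closed(2) by simp
  then have te1: "(0\<^sub>v n, 1) [^]\<^bsub>torus\<^esub> int e \<in> H" using e_pow by (simp add: int_pow_int)
  have te: "(0\<^sub>v n, 1) [^]\<^bsub>torus\<^esub> (int e * k) \<in> H" for k
    unfolding torus.int_pow_pow[OF tc, symmetric] by (rule torus.subgroup_int_pow_closed[OF sub te1])
  have S_shift: "shift (int e * k) z \<in> S" if z: "z \<in> S" for k z
  proof -
    have zH: "(z, 0) \<in> H" and zL: "z \<in> lattice_mod 1" using z by (simp_all add: S_def)
    have "(0\<^sub>v n, int e * k) \<in> H" "(0\<^sub>v n, - (int e * k)) \<in> H"
      using te[of k] te[of "- k"] unfolding torus_pow_stable by simp_all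
    then have "(0\<^sub>v n, int e * k) \<otimes>\<^bsub>torus\<^esub> (z, 0) \<otimes>\<^bsub>torus\<^esub> (0\<^sub>v n, - (int e * k)) \<in> H"
      using subgroup.m_closed[OF sub] zH by blast
    then show ?thesis using Sc[OF z] lattice_mod_shift[OF zL] by (simp add: S_def)
  qed
  \<comment> \<open>The exponents are multiples of \<open>e\<close>, so a coincidence modulo
    \<open>H\<close> can be shifted back by T^(-ei) without leaving \<open>S\<close>.\<close>
  let ?f = "\<lambda>j :: nat. (shift (int e * int j) ?x, 0 :: int)"
  have fc: "?f j \<in> carrier torus" for j using lattice_mod_shift[OF x(1)] by simp
  obtain i j where ij: "i < j" "?f j \<otimes>\<^bsub>torus\<^esub> inv\<^bsub>torus\<^esub> ?f i \<in> H"
    using finite_index_subgroup_pigeonhole[OF group_torus H(1), of ?f] fc by metis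
  define d where "d = int e * int (j - i)"
  have "shift (int e * int j) ?x - shift (int e * int i) ?x \<in> S"
  proof -
    note dim = carrier_vecD[OF shift_closed[OF x(2)]]
    have L: "shift (int e * int j) ?x - shift (int e * int i) ?x \<in> lattice_mod 1"
      by (intro lattice_mod_closed(5) lattice_mod_shift x(1))
    have "?f j \<otimes>\<^bsub>torus\<^esub> inv\<^bsub>torus\<^esub> ?f i = (shift (int e * int j) ?x + - shift (int e * int i) ?x, 0)"
      using x(2) by (simp add: inv_torus[OF lattice_mod_shift[OF x(1)]])
    also have "shift (int e * int j) ?x + - shift (int e * int i) ?x = shift (int e * int j) ?x - shift (int e * int i) ?x"
      by (intro eq_vecI) (simp_all add: dim)
    finally show ?thesis using ij(2) L by (simp add: S_def)
  qed
  then have "shift (int e * - int i) (shift (int e * int j) ?x - shift (int e * int i) ?x) \<in> S"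
    by (rule S_shift)
  also have "shift (int e * - int i) (shift (int e * int j) ?x - shift (int e * int i) ?x) = shift d ?x - ?x"
    using x(2) ij(1) by (simp add: shift_minus shift_shift d_def of_nat_diff algebra_simps)
  finally have dS: "shift d ?x - ?x \<in> S" .
  have tele: "shift (d * int s) ?x - ?x \<in> S" for s
    by (rule shift_telescope) (use S_add S_shift S_zero x(2) dS in \<open>auto simp: d_def\<close>)
  \<comment> \<open>\<open>S\<close> contains e B = e' p^k B, so for an image of \<open>x\<close>
    divisible by p^k, multiplication by e' alone already leads into \<open>S\<close>.\<close>
  define k where "k = multiplicity (int p) (int e)"
  obtain e' where e': "int e = int p ^ k * e'" "\<not> int p dvd e'"
  proof (rule multiplicity_decompose'[of "int e" "int p"])
    show "int e \<noteq> 0" using e by simp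
    show "\<not> is_unit (int p)" using prime_gt_1_nat[OF p] by simp
  qed (use that in \<open>simp_all add: k_def\<close>)
  obtain j0 where j0: "vec_dvd (int p ^ k) ((\<phi> ^^ j0) a)" using a(1) by (auto simp: collapsing_def)
  have d_pos: "d \<ge> 1" using e ij(1) by (simp add: d_def int_one_le_iff_zero_less)
  \<comment> \<open>The exponent is a multiple of \<open>d\<close>, which keeps the image of
    \<open>x\<close> congruent to \<open>x\<close> modulo \<open>S\<close>, and at least
    \<open>j0\<close>, which keeps it divisible by p^k.\<close>
  define i0 where "i0 = nat (d * int j0)"
  have i0: "int i0 = d * int j0" "j0 \<le> i0"
  proof -
    show *: "int i0 = d * int j0" using d_pos by (simp add: i0_def)
    have "1 * int j0 \<le> d * int j0" using d_pos by (intro mult_right_mono) auto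
    then show "j0 \<le> i0" using * by linarith
  qed
  have h: "\<phi> ^^ i \<in> Group.hom (Zn n) (Zn n)" for i by (rule funpow_hom_Zn[OF hom])
  have "(\<phi> ^^ i0) a = (\<phi> ^^ (i0 - j0)) ((\<phi> ^^ j0) a)"
    using i0(2) by (metis comp_apply funpow_add le_add_diff_inverse2)
  then have "vec_dvd (int p ^ k) ((\<phi> ^^ i0) a)"
    using vec_dvd_hom[OF h hom_Zn_simps(1)[OF h ac ac] j0] by simp
  then obtain c where c: "c \<in> carrier_vec n" "(\<phi> ^^ i0) a = int p ^ k \<cdot>\<^sub>v c"
    using vec_dvd_iff_smult hom_Zn_simps(1)[OF h ac ac] by (metis carrier_vecD)
  have "shift (d * int j0) ?x = rat_vec (int p ^ k \<cdot>\<^sub>v c)"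
    unfolding i0(1)[symmetric] using shift_rat_vec[OF ac, of i0] c(2) by simp
  then have "of_int e' \<cdot>\<^sub>v shift (d * int j0) ?x = of_int (int e) \<cdot>\<^sub>v rat_vec c"
    unfolding e'(1) by (simp add: rat_vec_simps(4) smult_smult_assoc mult.commute)
  then have 1: "of_int e' \<cdot>\<^sub>v shift (d * int j0) ?x \<in> S" using e_S[OF rat_vec_in_lattice[OF c(1)]] by simp
  have "of_int (- e') \<cdot>\<^sub>v (shift (d * int j0) ?x - ?x) \<in> S" by (rule S_smult[OF tele])
  from S_add[OF 1 this]
  have "of_int e' \<cdot>\<^sub>v shift (d * int j0) ?x + of_int (- e') \<cdot>\<^sub>v (shift (d * int j0) ?x - ?x) \<in> S" .
  also have "of_int e' \<cdot>\<^sub>v shift (d * int j0) ?x + of_int (- e') \<cdot>\<^sub>v (shift (d * int j0) ?x - ?x) = of_int e' \<cdot>\<^sub>v ?x"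
    using carrier_vecD[OF x(2)] carrier_vecD[OF shift_closed[OF x(2), of "d * int j0"]]
    by (intro eq_vecI) (simp_all add: algebra_simps)
  finally have 2: "of_int e' \<cdot>\<^sub>v ?x \<in> S" .
  have 3: "y \<in> S" using yH y by (simp add: S_def)
  \<comment> \<open>Both p x = y and e' x lie in \<open>S\<close> and the factors are coprime, so
    \<open>x\<close> lies in \<open>S\<close>.\<close>
  have "coprime (int p) e'" using e'(2) p by (intro prime_imp_coprime) simp_all
  then obtain \<alpha> \<beta> where bez: "\<alpha> * int p + \<beta> * e' = 1" using bezout_int[of "int p" e'] by auto
  have "of_int \<alpha> \<cdot>\<^sub>v y + of_int \<beta> \<cdot>\<^sub>v (of_int e' \<cdot>\<^sub>v ?x) \<in> S" by (intro S_add S_smult 2 3)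
  also have "of_int \<alpha> \<cdot>\<^sub>v y + of_int \<beta> \<cdot>\<^sub>v (of_int e' \<cdot>\<^sub>v ?x) = of_int (\<alpha> * int p + \<beta> * e') \<cdot>\<^sub>v ?x"
    unfolding y_def by (intro eq_vecI) (auto simp: algebra_simps)
  also have "\<dots> = ?x" unfolding bez by simp
  finally show False using H(3) by (simp add: S_def)
qed

section \<open>Normal forms in the HNN extension\<close>

abbreviation "hnn \<equiv> ascending_HNN (Zn n) \<phi>"

abbreviation "hnn_class \<equiv> word_class (hnn_gens (Zn n)) (hnn_rels (Zn n) \<phi>)"

definition base :: "int vec \<Rightarrow> int vec hnn_gen word set" where
  "base a = hnn_class [(Base a, True)]"

definition stable_letter :: "int vec hnn_gen word set" where
  "stable_letter = hnn_class [(Stable, True)]"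

lemma hnn_gens_iff [simp]:
  "Stable \<in> hnn_gens (Zn n)" "Base a \<in> hnn_gens (Zn n) \<longleftrightarrow> a \<in> carrier_vec n"
  by (auto simp: hnn_gens_def monoid_vec_simps)

lemma \<phi>_closed: "a \<in> carrier_vec n \<Longrightarrow> \<phi> a \<in> carrier_vec n"
  using hom_Zn_simps(1)[OF hom] by blast

lemma hnn_rels_words:
  "hnn_rels (Zn n) \<phi> \<subseteq> lists (hnn_gens (Zn n) \<times> UNIV) \<times> lists (hnn_gens (Zn n) \<times> UNIV)"
  by (auto simp: hnn_rels_def monoid_vec_simps \<phi>_closed)

sublocale hnn: group hnn
  unfolding ascending_HNN_def by (rule presented_group_is_group)

lemma carrier_hnn: "carrier hnn = hnn_class ` lists (hnn_gens (Zn n) \<times> UNIV)"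
  by (simp add: ascending_HNN_def presented_group_def)

lemma hnn_mult:
  "u \<in> lists (hnn_gens (Zn n) \<times> UNIV) \<Longrightarrow> v \<in> lists (hnn_gens (Zn n) \<times> UNIV)
    \<Longrightarrow> hnn_class u \<otimes>\<^bsub>hnn\<^esub> hnn_class v = hnn_class (u @ v)"
  unfolding ascending_HNN_def by (rule presented_group_mult)

lemma hnn_one: "\<one>\<^bsub>hnn\<^esub> = hnn_class []"
  by (simp add: ascending_HNN_def presented_group_def)

lemma hnn_closed [simp]: "stable_letter \<in> carrier hnn" "a \<in> carrier_vec n \<Longrightarrow> base a \<in> carrier hnn"
  unfolding stable_letter_def base_def carrier_hnn by (auto intro!: imageI)

lemma inv_generator:
  assumes "g \<in> hnn_gens (Zn n)"
  shows "inv\<^bsub>hnn\<^esub> hnn_class [(g, True)] = hnn_class [(g, False)]"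
proof (rule hnn.inv_equality)
  have "hnn_class [(g, False)] \<otimes>\<^bsub>hnn\<^esub> hnn_class [(g, True)] = hnn_class [(g, False), (g, True)]"
    using assms by (subst hnn_mult) auto
  also have "\<dots> = \<one>\<^bsub>hnn\<^esub>"
    unfolding hnn_one by (rule word_class_eqI) (use pres_eq.cancel[OF assms, of _ False] in simp)
  finally show "hnn_class [(g, False)] \<otimes>\<^bsub>hnn\<^esub> hnn_class [(g, True)] = \<one>\<^bsub>hnn\<^esub>" .
qed (use assms in \<open>auto simp: carrier_hnn\<close>)

lemma base_add:
  assumes a: "a \<in> carrier_vec n" "b \<in> carrier_vec n"
  shows "base (a + b) = base a \<otimes>\<^bsub>hnn\<^esub> base b"
proof -
  have "base a \<otimes>\<^bsub>hnn\<^esub> base b = hnn_class [(Base a, True), (Base b, True)]"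
    unfolding base_def using a by (subst hnn_mult) auto
  also have "\<dots> = base (a + b)"
    unfolding base_def
    by (intro word_class_eqI pres_eq.relator) (use a in \<open>auto simp: hnn_rels_def monoid_vec_simps\<close>)
  finally show ?thesis by simp
qed

lemma base_zero: "base (0\<^sub>v n) = \<one>\<^bsub>hnn\<^esub>"
proof -
  have "base (0\<^sub>v n) \<otimes>\<^bsub>hnn\<^esub> base (0\<^sub>v n) = base (0\<^sub>v n)"
    using base_add[of "0\<^sub>v n" "0\<^sub>v n"] by simp
  then show ?thesis using hnn.l_cancel_one'[of "base (0\<^sub>v n)" "base (0\<^sub>v n)"] by simp
qed

lemma inv_base:
  assumes a: "a \<in> carrier_vec n"
  shows "inv\<^bsub>hnn\<^esub> base a = base (- a)"
proof (rule hnn.inv_equality)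
  have "- a + a = 0\<^sub>v n" using a by simp
  then show "base (- a) \<otimes>\<^bsub>hnn\<^esub> base a = \<one>\<^bsub>hnn\<^esub>"
    using base_add[of "- a" a] a by (simp add: base_zero)
qed (use a in simp_all)

lemma stable_conj:
  assumes a: "a \<in> carrier_vec n"
  shows "stable_letter \<otimes>\<^bsub>hnn\<^esub> base a = base (\<phi> a) \<otimes>\<^bsub>hnn\<^esub> stable_letter"
proof -
  have "stable_letter \<otimes>\<^bsub>hnn\<^esub> base a = hnn_class [(Stable, True), (Base a, True)]"
    unfolding base_def stable_letter_def using a by (subst hnn_mult) auto
  then have "stable_letter \<otimes>\<^bsub>hnn\<^esub> base a \<otimes>\<^bsub>hnn\<^esub> inv\<^bsub>hnn\<^esub> stable_letter
      = hnn_class [(Stable, True), (Base a, True), (Stable, False)]"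
    unfolding stable_letter_def using a by (simp add: inv_generator hnn_mult)
  also have "\<dots> = base (\<phi> a)"
    unfolding base_def
    by (intro word_class_eqI pres_eq.relator) (use a in \<open>auto simp: hnn_rels_def monoid_vec_simps\<close>)
  finally have "stable_letter \<otimes>\<^bsub>hnn\<^esub> base a \<otimes>\<^bsub>hnn\<^esub> inv\<^bsub>hnn\<^esub> stable_letter = base (\<phi> a)" .
  then show ?thesis using a hnn.inv_solve_right'[of "base (\<phi> a)" "stable_letter \<otimes>\<^bsub>hnn\<^esub> base a" stable_letter]
    by (simp add: \<phi>_closed)
qed

lemma funpow_closed: "a \<in> carrier_vec n \<Longrightarrow> (\<phi> ^^ i) a \<in> carrier_vec n"
  using hom_Zn_simps(1)[OF funpow_hom_Zn[OF hom]] by blast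

lemma stable_pow_conj:
  assumes a: "a \<in> carrier_vec n"
  shows "stable_letter [^]\<^bsub>hnn\<^esub> int i \<otimes>\<^bsub>hnn\<^esub> base a = base ((\<phi> ^^ i) a) \<otimes>\<^bsub>hnn\<^esub> stable_letter [^]\<^bsub>hnn\<^esub> int i"
proof (induction i)
  case (Suc i)
  have pow: "stable_letter [^]\<^bsub>hnn\<^esub> int (Suc i) = stable_letter \<otimes>\<^bsub>hnn\<^esub> stable_letter [^]\<^bsub>hnn\<^esub> int i"
    using hnn.int_pow_mult[OF hnn_closed(1), of 1 "int i"] by (simp add: hnn.int_pow_1)
  have "stable_letter [^]\<^bsub>hnn\<^esub> int (Suc i) \<otimes>\<^bsub>hnn\<^esub> base a
      = stable_letter \<otimes>\<^bsub>hnn\<^esub> (base ((\<phi> ^^ i) a) \<otimes>\<^bsub>hnn\<^esub> stable_letter [^]\<^bsub>hnn\<^esub> int i)"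
    unfolding pow using a by (simp add: hnn.m_assoc Suc.IH)
  also have "\<dots> = base (\<phi> ((\<phi> ^^ i) a)) \<otimes>\<^bsub>hnn\<^esub> stable_letter \<otimes>\<^bsub>hnn\<^esub> stable_letter [^]\<^bsub>hnn\<^esub> int i"
    using a funpow_closed[OF a, of i] by (simp add: hnn.m_assoc[symmetric] stable_conj)
  finally show ?case
    unfolding pow using funpow_closed[OF a, of "Suc i"] by (simp add: hnn.m_assoc)
qed (use a in simp)

text \<open>The usual form t^(-i) a t^j of elements of an ascending HNN extension, with
  \<open>j\<close> any integer. No reducedness is imposed, since triviality will be detected in the
  torus.\<close>

definition normal_form :: "nat \<Rightarrow> int vec \<Rightarrow> int \<Rightarrow> int vec hnn_gen word set" where
  "normal_form i a j = stable_letter [^]\<^bsub>hnn\<^esub> (- int i) \<otimes>\<^bsub>hnn\<^esub> base a \<otimes>\<^bsub>hnn\<^esub> stable_letter [^]\<^bsub>hnn\<^esub> j"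

lemma normal_form_mult_stable:
  assumes a: "a \<in> carrier_vec n"
  shows "stable_letter \<otimes>\<^bsub>hnn\<^esub> normal_form i a j = normal_form i (\<phi> a) (1 + j)"
    and "inv\<^bsub>hnn\<^esub> stable_letter \<otimes>\<^bsub>hnn\<^esub> normal_form i a j = normal_form (Suc i) a j"
proof -
  note c = hnn_closed(1)
  have comm: "stable_letter \<otimes>\<^bsub>hnn\<^esub> stable_letter [^]\<^bsub>hnn\<^esub> k = stable_letter [^]\<^bsub>hnn\<^esub> k \<otimes>\<^bsub>hnn\<^esub> stable_letter" for k :: int
    using hnn.int_pow_mult[OF c, of 1 k] hnn.int_pow_mult[OF c, of k 1]
    by (simp add: hnn.int_pow_1 add.commute)
  have "stable_letter \<otimes>\<^bsub>hnn\<^esub> normal_form i a j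
      = stable_letter [^]\<^bsub>hnn\<^esub> (- int i) \<otimes>\<^bsub>hnn\<^esub> (stable_letter \<otimes>\<^bsub>hnn\<^esub> base a) \<otimes>\<^bsub>hnn\<^esub> stable_letter [^]\<^bsub>hnn\<^esub> j"
    unfolding normal_form_def using a comm[of "- int i"] by (simp add: hnn.m_assoc[symmetric])
  also have "\<dots> = stable_letter [^]\<^bsub>hnn\<^esub> (- int i) \<otimes>\<^bsub>hnn\<^esub> base (\<phi> a) \<otimes>\<^bsub>hnn\<^esub> (stable_letter \<otimes>\<^bsub>hnn\<^esub> stable_letter [^]\<^bsub>hnn\<^esub> j)"
    unfolding stable_conj[OF a] using \<phi>_closed[OF a] by (simp add: hnn.m_assoc)
  also have "stable_letter \<otimes>\<^bsub>hnn\<^esub> stable_letter [^]\<^bsub>hnn\<^esub> j = stable_letter [^]\<^bsub>hnn\<^esub> (1 + j)"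
    using hnn.int_pow_mult[OF c, of 1 j] by (simp add: hnn.int_pow_1)
  finally show "stable_letter \<otimes>\<^bsub>hnn\<^esub> normal_form i a j = normal_form i (\<phi> a) (1 + j)"
    by (simp only: normal_form_def)
  have "inv\<^bsub>hnn\<^esub> stable_letter \<otimes>\<^bsub>hnn\<^esub> stable_letter [^]\<^bsub>hnn\<^esub> (- int i) = stable_letter [^]\<^bsub>hnn\<^esub> (- int (Suc i))"
    using hnn.int_pow_mult[OF c, of "-1" "- int i"] hnn.int_pow_neg[OF c, of 1]
    by (simp add: hnn.int_pow_1[OF c])
  then show "inv\<^bsub>hnn\<^esub> stable_letter \<otimes>\<^bsub>hnn\<^esub> normal_form i a j = normal_form (Suc i) a j"
    unfolding normal_form_def using a by (simp add: hnn.m_assoc[symmetric])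
qed

text \<open>From t^i b = \<phi>^i(b) t^i: a base element moves to the right past t^(-i) and turns
  into \<phi>^i(b).\<close>

lemma normal_form_mult_base:
  assumes a: "a \<in> carrier_vec n" and b: "b \<in> carrier_vec n"
  shows "base b \<otimes>\<^bsub>hnn\<^esub> normal_form i a j = normal_form i ((\<phi> ^^ i) b + a) j"
proof -
  let ?t = "stable_letter [^]\<^bsub>hnn\<^esub> int i" and ?s = "stable_letter [^]\<^bsub>hnn\<^esub> (- int i)"
  have st: "?s = inv\<^bsub>hnn\<^esub> ?t" by (rule hnn.int_pow_neg) simp
  have "base b \<otimes>\<^bsub>hnn\<^esub> ?s = ?s \<otimes>\<^bsub>hnn\<^esub> (?t \<otimes>\<^bsub>hnn\<^esub> base b) \<otimes>\<^bsub>hnn\<^esub> ?s"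
    unfolding st using b by (simp add: hnn.m_assoc[symmetric])
  also have "\<dots> = ?s \<otimes>\<^bsub>hnn\<^esub> base ((\<phi> ^^ i) b)"
    unfolding stable_pow_conj[OF b] st using funpow_closed[OF b, of i] by (simp add: hnn.m_assoc)
  finally have "base b \<otimes>\<^bsub>hnn\<^esub> ?s = ?s \<otimes>\<^bsub>hnn\<^esub> base ((\<phi> ^^ i) b)" .
  then have "base b \<otimes>\<^bsub>hnn\<^esub> normal_form i a j
      = ?s \<otimes>\<^bsub>hnn\<^esub> (base ((\<phi> ^^ i) b) \<otimes>\<^bsub>hnn\<^esub> base a) \<otimes>\<^bsub>hnn\<^esub> stable_letter [^]\<^bsub>hnn\<^esub> j"
    unfolding normal_form_def using a b funpow_closed[OF b, of i] by (simp add: hnn.m_assoc[symmetric])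
  then show ?thesis
    unfolding normal_form_def base_add[OF funpow_closed[OF b] a, symmetric] .
qed

lemma hnn_normal_form:
  assumes "x \<in> carrier hnn"
  shows "\<exists>i j. \<exists>a\<in>carrier_vec n. x = normal_form i a j"
proof -
  obtain w where w: "w \<in> lists (hnn_gens (Zn n) \<times> UNIV)" "x = hnn_class w"
    using assms by (auto simp only: carrier_hnn)
  have "\<exists>i j. \<exists>a\<in>carrier_vec n. hnn_class w = normal_form i a j"
    using w(1)
  proof (induction rule: lists.induct)
    case Nil
    have "hnn_class [] = normal_form 0 (0\<^sub>v n) 0"
      by (simp add: normal_form_def base_zero hnn_one[symmetric])
    then show ?case by (intro exI bexI[of _ "0\<^sub>v n"]) simp_all
  next
    case (Cons y w)
    obtain g b where y: "y = (g, b)" by force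
    have g: "g \<in> hnn_gens (Zn n)" using Cons.hyps(1) y by auto
    obtain i j a where nf: "a \<in> carrier_vec n" "hnn_class w = normal_form i a j" using Cons.IH by blast
    have eq: "hnn_class (y # w) = hnn_class [(g, b)] \<otimes>\<^bsub>hnn\<^esub> normal_form i a j"
      unfolding nf(2)[symmetric] using hnn_mult[of "[(g, b)]" w] g Cons.hyps(2) y by simp
    show ?case
    proof (cases g)
      case (Base c)
      then have c: "c \<in> carrier_vec n" using g by simp
      have "hnn_class [(Base c, False)] = base (- c)"
        using inv_base[OF c] inv_generator[OF g[unfolded Base]] by (simp add: base_def)
      then have "hnn_class [(g, b)] = base (if b then c else - c)"
        unfolding Base by (cases b) (simp_all add: base_def)
      then have "hnn_class (y # w) = normal_form i ((\<phi> ^^ i) (if b then c else - c) + a) j"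
        unfolding eq using normal_form_mult_base[OF nf(1), of "if b then c else - c"] c by simp
      moreover have "(\<phi> ^^ i) (if b then c else - c) + a \<in> carrier_vec n"
        using nf(1) funpow_closed[of "if b then c else - c" i] c by simp
      ultimately show ?thesis by (intro exI bexI)
    next
      case Stable
      have "hnn_class [(Stable, False)] = inv\<^bsub>hnn\<^esub> stable_letter"
        using inv_generator[OF hnn_gens_iff(1)] by (simp add: stable_letter_def)
      then have "hnn_class [(g, b)] = (if b then stable_letter else inv\<^bsub>hnn\<^esub> stable_letter)"
        unfolding Stable by (cases b) (simp_all add: stable_letter_def)
      then have "hnn_class (y # w) = (if b then normal_form i (\<phi> a) (1 + j) else normal_form (Suc i) a j)"
        unfolding eq using normal_form_mult_stable[OF nf(1)] by simp
      then show ?thesis using nf(1) \<phi>_closed[OF nf(1)] by (cases b) auto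
    qed
  qed
  then show ?thesis using w(2) by simp
qed

text \<open>With a going to (a, 0) and t to (0, 1), the element t^(-i) a t^j goes to (T^(-i) a, j -
  i). This is trivial only if a = 0 and i = j, which gives injectivity; surjectivity holds because
  every element of B is some T^(-j) a.\<close>

lemma hnn_iso_torus: "hnn \<cong> torus"
proof -
  define f where "f g = (case g of Base a \<Rightarrow> (rat_vec a, 0 :: int) | Stable \<Rightarrow> (0\<^sub>v n, 1))" for g
  have f: "f \<in> hnn_gens (Zn n) \<rightarrow> carrier torus"
  proof
    fix g assume "g \<in> hnn_gens (Zn n)"
    then show "f g \<in> carrier torus"
      by (cases g) (simp_all add: f_def rat_vec_in_lattice lattice_mod_closed(2))
  qed
  have rels: "eval_word torus f u = eval_word torus f v" if uv: "(u, v) \<in> hnn_rels (Zn n) \<phi>" for u v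
  proof -
    consider a b where "a \<in> carrier_vec n" "b \<in> carrier_vec n"
        "u = [(Base a, True), (Base b, True)]" "v = [(Base (a + b), True)]"
      | a where "a \<in> carrier_vec n"
        "u = [(Stable, True), (Base a, True), (Stable, False)]" "v = [(Base (\<phi> a), True)]"
      using uv by (auto simp: hnn_rels_def monoid_vec_simps)
    then show ?thesis
    proof cases
      case 1
      then show ?thesis by (simp add: f_def rat_vec_simps(1))
    next
      case 2
      have "T (rat_vec a) = rat_vec (\<phi> a)" by (rule rat_extension_rat_vec[OF hom 2(1)])
      then show ?thesis
        using 2 \<phi>_closed[OF 2(1)]
        by (simp add: f_def shift_1 inv_torus[OF lattice_mod_closed(2)])
    qed
  qed
  obtain F where F: "F \<in> Group.hom hnn torus"
    "\<And>w. w \<in> lists (hnn_gens (Zn n) \<times> UNIV) \<Longrightarrow> F (hnn_class w) = eval_word torus f w"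
    using presented_group_hom[OF group_torus f hnn_rels_words rels] unfolding ascending_HNN_def by blast
  interpret F: group_hom hnn torus F
    using F(1) hnn.is_group group_torus by (simp add: group_hom_def group_hom_axioms_def)
  have F_base: "F (base a) = (rat_vec a, 0)" if a: "a \<in> carrier_vec n" for a
  proof -
    have "F (base a) = eval_word torus f [(Base a, True)]" unfolding base_def using a by (intro F(2)) auto
    then show ?thesis using a by (simp add: f_def)
  qed
  have F_stable: "F stable_letter = (0\<^sub>v n, 1)"
  proof -
    have "F stable_letter = eval_word torus f [(Stable, True)]" unfolding stable_letter_def by (intro F(2)) auto
    then show ?thesis by (simp add: f_def)
  qed
  have F_pow: "F (stable_letter [^]\<^bsub>hnn\<^esub> k) = (0\<^sub>v n, k)" for k :: int
    using F.hom_int_pow[OF hnn_closed(1), of k] by (simp add: F_stable torus_pow_stable)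
  have F_nf: "F (normal_form i a j) = (shift (- int i) (rat_vec a), j - int i)" if a: "a \<in> carrier_vec n" for i a j
    unfolding normal_form_def using a by (simp add: F_pow F_base)
  have "x = \<one>\<^bsub>hnn\<^esub>" if x: "x \<in> carrier hnn" "F x = \<one>\<^bsub>torus\<^esub>" for x
  proof -
    obtain i j a where nf: "a \<in> carrier_vec n" "x = normal_form i a j" using hnn_normal_form[OF x(1)] by blast
    then have "shift (- int i) (rat_vec a) = 0\<^sub>v n" "j = int i" using x(2) F_nf by auto
    moreover from this have "rat_vec a = 0\<^sub>v n"
      using shift_inj[of "rat_vec a" "0\<^sub>v n" "- int i"] nf(1) by simp
    moreover have "rat_vec (0\<^sub>v n) = 0\<^sub>v n" by (intro eq_vecI) auto
    ultimately have "a = 0\<^sub>v n" "j = int i" using rat_vec_inject by metis+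
    then have "x = stable_letter [^]\<^bsub>hnn\<^esub> (- int i) \<otimes>\<^bsub>hnn\<^esub> stable_letter [^]\<^bsub>hnn\<^esub> int i"
      unfolding nf(2) by (simp add: normal_form_def base_zero)
    also have "\<dots> = \<one>\<^bsub>hnn\<^esub>"
      using hnn.int_pow_mult[OF hnn_closed(1), of "- int i" "int i"] by simp
    finally show ?thesis .
  qed
  then have "kernel hnn torus F \<subseteq> {\<one>\<^bsub>hnn\<^esub>}" unfolding kernel_def by blast
  moreover have "\<one>\<^bsub>hnn\<^esub> \<in> kernel hnn torus F" unfolding kernel_def by simp
  ultimately have "kernel hnn torus F = {\<one>\<^bsub>hnn\<^esub>}" by blast
  then have "inj_on F (carrier hnn)" by (rule F.trivial_ker_imp_inj)
  moreover have "F ` carrier hnn = carrier torus"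
  proof
    show "F ` carrier hnn \<subseteq> carrier torus" by auto
    show "carrier torus \<subseteq> F ` carrier hnn"
    proof
      fix g assume "g \<in> carrier torus"
      then obtain x m where g: "g = (x, m)" "x \<in> lattice_mod 1" "x \<in> carrier_vec n" by (elim carrier_torusE)
      then obtain j a where a: "a \<in> carrier_vec n" "shift (int j) x = rat_vec a"
        by (auto simp: lattice_mod_def)
      have "shift (- int j) (rat_vec a) = x" unfolding a(2)[symmetric] using g(3) by (simp add: shift_shift)
      then have eq: "g = F (normal_form j a (m + int j))"
        unfolding F_nf[OF a(1)] g(1) by simp
      have "normal_form j a (m + int j) \<in> carrier hnn" unfolding normal_form_def using a(1) by simp
      then show "g \<in> F ` carrier hnn" unfolding eq by (rule imageI)
    qed
  qed
  ultimately have "F \<in> iso hnn torus" using F(1) by (simp add: iso_def bij_betw_def)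
  then show ?thesis by (auto simp: is_iso_def)
qed

lemma cyclic_subgroup_separable_hnn_iff:
  "cyclic_subgroup_separable hnn \<longleftrightarrow> (\<forall>p. prime p \<longrightarrow> collapsing n \<phi> p \<subseteq> {0\<^sub>v n})"
proof
  assume "cyclic_subgroup_separable hnn"
  then have "cyclic_subgroup_separable torus"
    using cyclic_subgroup_separable_iso[OF hnn_iso_torus hnn.is_group group_torus] by blast
  then have "a = 0\<^sub>v n" if "prime p" "a \<in> collapsing n \<phi> p" for p a
    using torus_not_cyclic_subgroup_separable[OF that] by auto
  then show "\<forall>p. prime p \<longrightarrow> collapsing n \<phi> p \<subseteq> {0\<^sub>v n}" by blast
next
  assume "\<forall>p. prime p \<longrightarrow> collapsing n \<phi> p \<subseteq> {0\<^sub>v n}"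
  then have "cyclic_subgroup_separable torus" by (intro torus_cyclic_subgroup_separable) blast
  then show "cyclic_subgroup_separable hnn"
    by (rule cyclic_subgroup_separable_iso[OF group.iso_sym[OF hnn.is_group hnn_iso_torus]
        group_torus hnn.is_group])
qed

end

section \<open>Composition series\<close>

lemma subspace_vec_iff:
  "VectorSpace.subspace class_ring W (module_vec TYPE('a :: field) n) \<longleftrightarrow>
    W \<subseteq> carrier_vec n \<and> 0\<^sub>v n \<in> W \<and> (\<forall>x\<in>W. \<forall>y\<in>W. x + y \<in> W) \<and> (\<forall>c. \<forall>x\<in>W. c \<cdot>\<^sub>v x \<in> W)"
proof -
  have "vectorspace class_ring (module_vec TYPE('a) n)" "module class_ring (module_vec TYPE('a) n)"
    by (rule vec_vs, rule vec_module)
  then show ?thesis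
    by (auto simp: VectorSpace.subspace_def submodule_def module_vec_simps class_ring_simps)
qed

lemma clear_denominators:
  fixes x :: "rat vec"
  assumes "x \<in> carrier_vec n"
  shows "\<exists>c > 0. \<exists>a\<in>carrier_vec n. rat_of_int c \<cdot>\<^sub>v x = rat_vec a"
proof -
  define d where "d i = snd (quotient_of (x $ i))" for i
  define c where "c = (\<Prod>i<n. d i)"
  have d: "d i > 0" for i by (simp add: d_def quotient_of_denom_pos')
  then have "c > 0" unfolding c_def by (intro prod_pos) simp
  have "\<exists>b. rat_of_int c * x $ i = rat_of_int b" if "i < n" for i
  proof -
    have "x $ i = rat_of_int (fst (quotient_of (x $ i))) / rat_of_int (d i)"
      unfolding d_def by (rule quotient_of_div) simp
    then obtain u where u: "x $ i = rat_of_int u / rat_of_int (d i)" by blast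
    define e where "e = (\<Prod>j\<in>{..<n} - {i}. d j)"
    have "c = d i * e" unfolding c_def e_def using that by (intro prod.remove) auto
    then have "rat_of_int c * x $ i = rat_of_int (e * u)" using d[of i] by (simp add: u)
    then show ?thesis by blast
  qed
  then obtain b where b: "\<And>i. i < n \<Longrightarrow> rat_of_int c * x $ i = rat_of_int (b i)" by metis
  have "rat_of_int c \<cdot>\<^sub>v x = rat_vec (vec n b)" using b assms by (intro eq_vecI) auto
  then show ?thesis using \<open>c > 0\<close> by (intro exI[of _ c] conjI bexI[of _ "vec n b"]) simp_all
qed

lemma lattice_part_subspace:
  assumes W: "VectorSpace.subspace class_ring W (module_vec TYPE(rat) n)"
  shows "subgroup (lattice_part n W) (Zn n)"
    and "c \<noteq> 0 \<Longrightarrow> a \<in> carrier_vec n \<Longrightarrow> c \<cdot>\<^sub>v a \<in> lattice_part n W \<Longrightarrow> a \<in> lattice_part n W"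
proof -
  note W' = W[unfolded subspace_vec_iff]
  show "subgroup (lattice_part n W) (Zn n)"
    unfolding subgroup_monoid_vec_iff
  proof (intro conjI ballI)
    have zero: "rat_vec (0\<^sub>v n) = 0\<^sub>v n" by (intro eq_vecI) auto
    have "rat_vec (0\<^sub>v n) \<in> W" unfolding zero using W' by blast
    then show "0\<^sub>v n \<in> lattice_part n W" unfolding lattice_part_def by simp
  next
    fix a b assume "a \<in> lattice_part n W" "b \<in> lattice_part n W"
    then show "a + b \<in> lattice_part n W" using W' by (simp add: lattice_part_def rat_vec_simps(1)[of a n b])
  next
    fix a assume a: "a \<in> lattice_part n W"
    have "- rat_vec a = (- 1) \<cdot>\<^sub>v rat_vec a" by (intro eq_vecI) auto
    then show "- a \<in> lattice_part n W" using W' a by (simp add: lattice_part_def rat_vec_simps(3))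
  qed (auto simp: lattice_part_def)
  assume c: "c \<noteq> 0" "a \<in> carrier_vec n" "c \<cdot>\<^sub>v a \<in> lattice_part n W"
  then have "(1 / rat_of_int c) \<cdot>\<^sub>v (rat_of_int c \<cdot>\<^sub>v rat_vec a) \<in> W"
    using W' by (simp add: lattice_part_def rat_vec_simps(4))
  also have "(1 / rat_of_int c) \<cdot>\<^sub>v (rat_of_int c \<cdot>\<^sub>v rat_vec a) = rat_vec a"
    using c(1) by (intro eq_vecI) auto
  finally show "a \<in> lattice_part n W" using c(2) by (simp add: lattice_part_def)
qed

text \<open>A vector in the difference becomes integral once its denominators are cleared. The
  strictness makes each layer A_(i+1) / A_i nonzero.\<close>

lemma lattice_part_psubset:
  assumes W: "VectorSpace.subspace class_ring W (module_vec TYPE(rat) n)"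
    and W': "VectorSpace.subspace class_ring W' (module_vec TYPE(rat) n)" and sub: "W \<subset> W'"
  shows "lattice_part n W \<subset> lattice_part n W'"
proof -
  note cl = W[unfolded subspace_vec_iff] W'[unfolded subspace_vec_iff]
  obtain x where x: "x \<in> W'" "x \<notin> W" using sub by blast
  then obtain c a where c: "c > 0" "a \<in> carrier_vec n" "rat_of_int c \<cdot>\<^sub>v x = rat_vec a"
    using clear_denominators[of x n] cl by blast
  have "rat_vec a \<in> W'" unfolding c(3)[symmetric] using cl x(1) by blast
  moreover have "rat_vec a \<notin> W"
  proof
    assume "rat_vec a \<in> W"
    then have "(1 / rat_of_int c) \<cdot>\<^sub>v (rat_of_int c \<cdot>\<^sub>v x) \<in> W" unfolding c(3) using cl by blast
    also have "(1 / rat_of_int c) \<cdot>\<^sub>v (rat_of_int c \<cdot>\<^sub>v x) = x" using c(1) by (intro eq_vecI) auto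
    finally show False using x(2) by blast
  qed
  ultimately have "a \<in> lattice_part n W'" "a \<notin> lattice_part n W" using c(2) by (simp_all add: lattice_part_def)
  moreover have "lattice_part n W \<subseteq> lattice_part n W'" using sub by (auto simp: lattice_part_def)
  ultimately show ?thesis by blast
qed

section \<open>Invariant subspaces and the layers of the composition series\<close>

context Zn_monomorphism
begin

lemma lattice_part_invariant:
  assumes "invariant_subspace n T W" "a \<in> lattice_part n W"
  shows "\<phi> a \<in> lattice_part n W"
proof -
  have a: "a \<in> carrier_vec n" "rat_vec a \<in> W" using assms(2) by (simp_all add: lattice_part_def)
  then have "T (rat_vec a) \<in> W" using assms(1) by (auto simp: invariant_subspace_def)
  moreover have "\<phi> a \<in> carrier_vec n" using hom_Zn_simps(1)[OF hom a(1) a(1)] .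
  ultimately show ?thesis by (simp add: lattice_part_def rat_extension_rat_vec[OF hom a(1)])
qed

lemma invariant_subspaceD:
  assumes "invariant_subspace n T W"
  shows "x \<in> W \<Longrightarrow> x \<in> carrier_vec n" "0\<^sub>v n \<in> W" "x \<in> W \<Longrightarrow> y \<in> W \<Longrightarrow> x + y \<in> W"
    "x \<in> W \<Longrightarrow> c \<cdot>\<^sub>v x \<in> W" "x \<in> W \<Longrightarrow> T x \<in> W"
  using assms by (auto simp: invariant_subspace_def subspace_vec_iff)

lemma invariant_subspaceI:
  assumes "\<And>x. x \<in> W \<Longrightarrow> x \<in> carrier_vec n" "0\<^sub>v n \<in> W" "\<And>x y. x \<in> W \<Longrightarrow> y \<in> W \<Longrightarrow> x + y \<in> W"
    "\<And>c x. x \<in> W \<Longrightarrow> c \<cdot>\<^sub>v x \<in> W" "\<And>x. x \<in> W \<Longrightarrow> T x \<in> W"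
  shows "invariant_subspace n T W"
  using assms by (auto simp: invariant_subspace_def subspace_vec_iff)

lemma invariant_subspace_Int:
  assumes "invariant_subspace n T U" "invariant_subspace n T W"
  shows "invariant_subspace n T (U \<inter> W)"
  using invariant_subspaceD[OF assms(1)] invariant_subspaceD[OF assms(2)]
  by (intro invariant_subspaceI) simp_all

lemma invariant_subspace_add:
  assumes "invariant_subspace n T U" "invariant_subspace n T W"
  shows "invariant_subspace n T {x + y | x y. x \<in> U \<and> y \<in> W}" (is "invariant_subspace n T ?S")
proof (rule invariant_subspaceI)
  note U = invariant_subspaceD[OF assms(1)] and W = invariant_subspaceD[OF assms(2)]
  have I: "x + y \<in> ?S" if "x \<in> U" "y \<in> W" for x y using that by blast
  have "0\<^sub>v n + 0\<^sub>v n \<in> ?S" by (rule I[OF U(2) W(2)])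
  then show "0\<^sub>v n \<in> ?S" by simp
  fix z assume "z \<in> ?S"
  then obtain x y where z: "z = x + y" "x \<in> U" "y \<in> W" by blast
  have c: "x \<in> carrier_vec n" "y \<in> carrier_vec n" by (rule U(1)[OF z(2)], rule W(1)[OF z(3)])
  then show "z \<in> carrier_vec n" by (simp add: z(1))
  show "T z \<in> ?S" unfolding z(1) rat_extension_add[OF c] by (rule I[OF U(5)[OF z(2)] W(5)[OF z(3)]])
  show "r \<cdot>\<^sub>v z \<in> ?S" for r
    unfolding z(1) smult_add_distrib_vec[OF c] by (rule I[OF U(4)[OF z(2)] W(4)[OF z(3)]])
  fix z' assume "z' \<in> ?S"
  then obtain x' y' where z': "z' = x' + y'" "x' \<in> U" "y' \<in> W" by blast
  have "z + z' = (x + x') + (y + y')"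
    unfolding z(1) z'(1) using c U(1)[OF z'(2)] W(1)[OF z'(3)] by (intro eq_vecI) simp_all
  then show "z + z' \<in> ?S" using I[OF U(3)[OF z(2) z'(2)] W(3)[OF z(3) z'(3)]] by simp
qed

lemma invariant_subspace_shift:
  assumes W: "invariant_subspace n T W" and x: "x \<in> W"
  shows "shift (int j) x \<in> W"
proof -
  note Wc = invariant_subspaceD(1)[OF W] and WT = invariant_subspaceD(5)[OF W]
  show ?thesis
  proof (induction j)
    case 0
    then show ?case using x Wc by simp
  next
    case (Suc j)
    have "shift (int (Suc j)) x = shift 1 (shift (int j) x)" using Wc[OF x] by (simp add: shift_shift)
    also have "\<dots> = T (shift (int j) x)" using Wc[OF x] by (simp add: shift_1)
    finally show ?case using WT[OF Suc.IH] by simp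
  qed
qed

text \<open>The rational span of \<open>collapsing n \<phi> p\<close>, written without linear
  combinations: after clearing one denominator \<open>c\<close>, the same for all \<open>k\<close>,
  the vector lies in every p^k B.\<close>

definition collapsing_space :: "nat \<Rightarrow> rat vec set" where
  "collapsing_space p =
     {x \<in> carrier_vec n. \<exists>c::int. c \<noteq> 0 \<and> (\<forall>k. of_int c \<cdot>\<^sub>v x \<in> lattice_mod (int p ^ k))}"

lemma collapsing_spaceI:
  assumes "x \<in> carrier_vec n" "c \<noteq> 0" "\<And>k. of_int c \<cdot>\<^sub>v x \<in> lattice_mod (int p ^ k)"
  shows "x \<in> collapsing_space p"
  using assms by (auto simp: collapsing_space_def)

lemma collapsing_space_invariant: "invariant_subspace n T (collapsing_space p)"
proof (rule invariant_subspaceI)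
  have "of_int 1 \<cdot>\<^sub>v 0\<^sub>v n = (0\<^sub>v n :: rat vec)" by (intro eq_vecI) auto
  then show "0\<^sub>v n \<in> collapsing_space p"
    unfolding collapsing_space_def using lattice_mod_closed(2) by (auto intro!: exI[of _ 1])
next
  fix x y assume "x \<in> collapsing_space p" "y \<in> collapsing_space p"
  then obtain c d where x: "x \<in> carrier_vec n" "c \<noteq> 0" "\<And>k. of_int c \<cdot>\<^sub>v x \<in> lattice_mod (int p ^ k)"
    and y: "y \<in> carrier_vec n" "d \<noteq> 0" "\<And>k. of_int d \<cdot>\<^sub>v y \<in> lattice_mod (int p ^ k)"
    by (auto simp: collapsing_space_def)
  have eq: "of_int (c * d) \<cdot>\<^sub>v (x + y) = of_int d \<cdot>\<^sub>v (of_int c \<cdot>\<^sub>v x) + of_int c \<cdot>\<^sub>v (of_int d \<cdot>\<^sub>v y)"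
    using x(1) y(1) by (intro eq_vecI) (auto simp: algebra_simps)
  show "x + y \<in> collapsing_space p"
  proof (rule collapsing_spaceI)
    show "of_int (c * d) \<cdot>\<^sub>v (x + y) \<in> lattice_mod (int p ^ k)" for k
      unfolding eq by (intro lattice_mod_closed(3,6) x(3) y(3))
  qed (use x y in simp_all)
next
  fix r :: rat and x assume "x \<in> collapsing_space p"
  then obtain c where x: "x \<in> carrier_vec n" "c \<noteq> 0" "\<And>k. of_int c \<cdot>\<^sub>v x \<in> lattice_mod (int p ^ k)"
    by (auto simp: collapsing_space_def)
  obtain u d where r: "r = rat_of_int u / rat_of_int d" "d > 0"
    using quotient_of_div[of r] quotient_of_denom_pos[of r] by (cases "quotient_of r") blast
  have eq: "of_int (c * d) \<cdot>\<^sub>v (r \<cdot>\<^sub>v x) = of_int u \<cdot>\<^sub>v (of_int c \<cdot>\<^sub>v x)"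
    using r x(1) by (intro eq_vecI) (simp_all add: field_simps)
  show "r \<cdot>\<^sub>v x \<in> collapsing_space p"
  proof (rule collapsing_spaceI)
    show "of_int (c * d) \<cdot>\<^sub>v (r \<cdot>\<^sub>v x) \<in> lattice_mod (int p ^ k)" for k
      unfolding eq by (intro lattice_mod_closed(6) x(3))
  qed (use x(1,2) r(2) in simp_all)
next
  fix x assume "x \<in> collapsing_space p"
  then obtain c where x: "x \<in> carrier_vec n" "c \<noteq> 0" "\<And>k. of_int c \<cdot>\<^sub>v x \<in> lattice_mod (int p ^ k)"
    by (auto simp: collapsing_space_def)
  have eq: "of_int c \<cdot>\<^sub>v T x = shift 1 (of_int c \<cdot>\<^sub>v x)"
    unfolding shift_of_int_smult[OF x(1)] shift_1[OF x(1)] ..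
  show "T x \<in> collapsing_space p"
  proof (rule collapsing_spaceI[OF _ x(2)])
    show "of_int c \<cdot>\<^sub>v T x \<in> lattice_mod (int p ^ k)" for k
      unfolding eq by (rule lattice_mod_shift[OF x(3)])
  qed (rule rat_extension_closed)
qed (auto simp: collapsing_space_def)

lemma collapsing_layer:
  assumes p: "prime p" and a: "a \<in> collapsing n \<phi> p" "a \<noteq> 0\<^sub>v n"
    and cs: "composition_series n T V l"
  shows "\<exists>i<l. lattice_part n (V (i + 1)) \<subseteq> K_set n \<phi> p (lattice_part n (V i))"
proof -
  let ?W = "collapsing_space p"
  have V0: "V 0 = {0\<^sub>v n}" and Vl: "V l = carrier_vec n"
    and inv: "\<And>i. i \<le> l \<Longrightarrow> invariant_subspace n T (V i)"
    and psub: "\<And>i. i < l \<Longrightarrow> V i \<subset> V (Suc i)"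
    and simple: "\<And>i U. i < l \<Longrightarrow> invariant_subspace n T U \<Longrightarrow> V i \<subset> U \<Longrightarrow> \<not> U \<subset> V (Suc i)"
    using cs unfolding composition_series_def by auto
  have sub: "VectorSpace.subspace class_ring (V i) (module_vec TYPE(rat) n)" if "i \<le> l" for i
    using inv[OF that] by (simp add: invariant_subspace_def)
  have ac: "a \<in> carrier_vec n" and ak: "\<And>k. \<exists>j. vec_dvd (int p ^ k) ((\<phi> ^^ j) a)"
    using a(1) by (auto simp: collapsing_def)
  have one: "of_int 1 \<cdot>\<^sub>v rat_vec a = rat_vec a" by (intro eq_vecI) simp_all
  have aW: "rat_vec a \<in> ?W"
  proof (rule collapsing_spaceI[where c = 1])
    show "of_int 1 \<cdot>\<^sub>v rat_vec a \<in> lattice_mod (int p ^ k)" for k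
      unfolding one rat_vec_in_lattice_mod_iff[OF ac] by (rule ak)
  qed (use ac in simp_all)
  \<comment> \<open>If no step of the series enlarged the intersection with \<open>?W\<close>, it
    would stay zero up to V_l, which is all of Q^n, although \<open>?W\<close> contains
    \<open>a\<close>.\<close>
  have "\<exists>i<l. \<not> V (Suc i) \<inter> ?W \<subseteq> V i"
  proof (rule ccontr)
    assume "\<not> ?thesis"
    then have step: "V (Suc i) \<inter> ?W \<subseteq> V i" if "i < l" for i using that by metis
    have "V i \<inter> ?W \<subseteq> {0\<^sub>v n}" if "i \<le> l" for i
      using that
    proof (induction i)
      case 0
      show ?case unfolding V0 by (rule Int_lower1)
    next
      case (Suc i)
      have i: "i < l" "i \<le> l" using Suc.prems by simp_all
      have "V (Suc i) \<inter> ?W \<subseteq> V i \<inter> ?W" using step[OF i(1)] by (rule Int_greatest) (rule Int_lower2)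
      also have "\<dots> \<subseteq> {0\<^sub>v n}" by (rule Suc.IH[OF i(2)])
      finally show ?case .
    qed
    from this[OF order_refl] have Vl_W: "V l \<inter> ?W \<subseteq> {0\<^sub>v n}" .
    have "rat_vec a \<in> V l" unfolding Vl using ac by simp
    then have "rat_vec a = 0\<^sub>v n" by (intro singletonD[OF subsetD[OF Vl_W IntI[OF _ aW]]])
    also have "0\<^sub>v n = rat_vec (0\<^sub>v n)" by (intro eq_vecI) simp_all
    finally show False using a(2) unfolding rat_vec_inject by simp
  qed
  then obtain i where i: "i < l" "\<not> V (Suc i) \<inter> ?W \<subseteq> V i" by (elim exE conjE)
  have iV: "invariant_subspace n T (V i)" "invariant_subspace n T (V (Suc i))" by (rule inv, use i(1) in simp)+
  then have sV: "VectorSpace.subspace class_ring (V i) (module_vec TYPE(rat) n)"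
    by (simp add: invariant_subspace_def)
  let ?V = "V (Suc i) \<inter> ?W"
  \<comment> \<open>\<open>?U\<close> is invariant, strictly above V_i and inside V_(i+1), so it
    equals V_(i+1): modulo V_i every vector of the layer comes from \<open>?W\<close>.\<close>
  let ?U = "{x + y | x y. x \<in> ?V \<and> y \<in> V i}"
  have iW: "invariant_subspace n T ?V"
    by (rule invariant_subspace_Int[OF iV(2) collapsing_space_invariant])
  have iU: "invariant_subspace n T ?U" by (rule invariant_subspace_add[OF iW iV(1)])
  note V = invariant_subspaceD[OF iV(1)] and V' = invariant_subspaceD[OF iV(2)] and W = invariant_subspaceD[OF iW]
  have VU: "V i \<subseteq> ?U"
  proof
    fix y assume y: "y \<in> V i"
    have "y = 0\<^sub>v n + y" using V(1)[OF y] by simp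
    then show "y \<in> ?U" using W(2) y by blast
  qed
  have WU: "?V \<subseteq> ?U"
  proof
    fix x assume x: "x \<in> ?V"
    have "x = x + 0\<^sub>v n" using W(1)[OF x] by simp
    then show "x \<in> ?U" using V(2) x by blast
  qed
  have UV: "?U \<subseteq> V (Suc i)"
  proof
    fix z assume "z \<in> ?U"
    then obtain x y where z: "z = x + y" "x \<in> V (Suc i)" "y \<in> V i" by blast
    have "y \<in> V (Suc i)" by (rule psubsetD[OF psub[OF i(1)] z(3)])
    then show "z \<in> V (Suc i)" unfolding z(1) by (rule V'(3)[OF z(2)])
  qed
  have "V i \<noteq> ?U"
  proof
    assume "V i = ?U"
    then have "?V \<subseteq> V i" using WU by (rule ssubst)
    then show False using i(2) by (rule notE[rotated])
  qed
  then have U_gt: "V i \<subset> ?U" by (rule psubsetI[OF VU])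
  have U_eq: "V (Suc i) = ?U"
  proof (rule ccontr)
    assume "V (Suc i) \<noteq> ?U"
    then have "?U \<noteq> V (Suc i)" by (rule not_sym)
    then have "?U \<subset> V (Suc i)" by (rule psubsetI[OF UV])
    then show False by (rule notE[OF simple[OF i(1) iU U_gt]])
  qed
  let ?A = "lattice_part n (V i)"
  have "b \<in> K_set n \<phi> p ?A" if b: "b \<in> lattice_part n (V (Suc i))" for b
  proof -
    have bc: "b \<in> carrier_vec n" and "rat_vec b \<in> V (Suc i)" using b unfolding lattice_part_def by simp_all
    then have "rat_vec b \<in> ?U" by (intro equalityD1[OF U_eq, THEN subsetD])
    then obtain x y where xy: "rat_vec b = x + y" "x \<in> ?V" "y \<in> V i" by blast
    have xc: "x \<in> carrier_vec n" and yc: "y \<in> carrier_vec n" by (rule W(1)[OF xy(2)], rule V(1)[OF xy(3)])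
    obtain c where c: "c \<noteq> 0" "\<And>k. of_int c \<cdot>\<^sub>v x \<in> lattice_mod (int p ^ k)"
      using IntD2[OF xy(2)] unfolding collapsing_space_def by blast
    \<comment> \<open>One more power of \<open>p\<close> than \<open>c\<close> contains will be
      requested: p^k is cancelled by purity of A_i, and the remaining factor \<open>p\<close> gives
      membership in A_i + p A.\<close>
    define k where "k = multiplicity (int p) c"
    obtain c' where c': "c = int p ^ k * c'" "\<not> int p dvd c'"
    proof (rule multiplicity_decompose'[of c "int p"])
      show "\<not> is_unit (int p)" using prime_gt_1_nat[OF p] by simp
    qed (use c(1) that in \<open>simp_all add: k_def\<close>)
    obtain j u where u: "u \<in> carrier_vec n" "vec_dvd (int p ^ Suc k) u" "shift (int j) (of_int c \<cdot>\<^sub>v x) = rat_vec u"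
      using c(2)[of "Suc k"] by (auto simp: lattice_mod_def)
    obtain z where z: "z \<in> carrier_vec n" "u = int p ^ Suc k \<cdot>\<^sub>v z"
      using u(1,2) by (auto simp: vec_dvd_iff_smult)
    define w where "w = (\<phi> ^^ j) b"
    have wc: "w \<in> carrier_vec n" unfolding w_def using hom_Zn_simps(1)[OF funpow_hom_Zn[OF hom] bc bc] .
    have "of_int c \<cdot>\<^sub>v y \<in> V i" by (rule V(4)[OF xy(3)])
    then have "shift (int j) (of_int c \<cdot>\<^sub>v y) \<in> V i" by (rule invariant_subspace_shift[OF iV(1)])
    also have "of_int c \<cdot>\<^sub>v y = of_int c \<cdot>\<^sub>v rat_vec b - of_int c \<cdot>\<^sub>v x"
      unfolding xy(1) using xc yc by (intro eq_vecI) (auto simp: algebra_simps)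
    also have "shift (int j) (of_int c \<cdot>\<^sub>v rat_vec b - of_int c \<cdot>\<^sub>v x) = of_int c \<cdot>\<^sub>v rat_vec w - rat_vec u"
      using bc xc u(3) shift_rat_vec[OF bc, of j] by (simp add: shift_minus shift_of_int_smult w_def)
    also have "\<dots> = rat_vec (int p ^ k \<cdot>\<^sub>v (c' \<cdot>\<^sub>v w - int p \<cdot>\<^sub>v z))"
      unfolding c'(1) z(2) using wc z(1) by (intro eq_vecI) (auto simp: algebra_simps)
    finally have "int p ^ k \<cdot>\<^sub>v (c' \<cdot>\<^sub>v w - int p \<cdot>\<^sub>v z) \<in> ?A"
      using wc z(1) by (simp add: lattice_part_def)
    then have e: "c' \<cdot>\<^sub>v w - int p \<cdot>\<^sub>v z \<in> ?A"
      using lattice_part_subspace(2)[OF sV, of "int p ^ k" "c' \<cdot>\<^sub>v w - int p \<cdot>\<^sub>v z"] wc z(1) prime_gt_0_nat[OF p]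
      by simp
    have "coprime (int p) c'" using c'(2) p by (intro prime_imp_coprime) simp_all
    then obtain \<alpha> \<beta> where bez: "\<alpha> * int p + \<beta> * c' = 1" using bezout_int[of "int p" c'] by auto
    \<comment> \<open>\<open>\<beta>\<close> inverts c' modulo \<open>p\<close>, so the relation c'
      w - p z \<in> A_i can be solved for \<open>w\<close> up to multiples of
      \<open>p\<close>.\<close>
    have "w = \<beta> \<cdot>\<^sub>v (c' \<cdot>\<^sub>v w - int p \<cdot>\<^sub>v z) + int p \<cdot>\<^sub>v (\<beta> \<cdot>\<^sub>v z + \<alpha> \<cdot>\<^sub>v w)"
    proof (rule eq_vecI)
      fix m assume "m < dim_vec (\<beta> \<cdot>\<^sub>v (c' \<cdot>\<^sub>v w - int p \<cdot>\<^sub>v z) + int p \<cdot>\<^sub>v (\<beta> \<cdot>\<^sub>v z + \<alpha> \<cdot>\<^sub>v w))"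
      then have m: "m < n" using wc z(1) by simp
      have "w $ m = (\<alpha> * int p + \<beta> * c') * w $ m" unfolding bez by simp
      then show "w $ m = (\<beta> \<cdot>\<^sub>v (c' \<cdot>\<^sub>v w - int p \<cdot>\<^sub>v z) + int p \<cdot>\<^sub>v (\<beta> \<cdot>\<^sub>v z + \<alpha> \<cdot>\<^sub>v w)) $ m"
        using m wc z(1) by (simp add: algebra_simps)
    qed (use wc z(1) in simp)
    moreover have "\<beta> \<cdot>\<^sub>v (c' \<cdot>\<^sub>v w - int p \<cdot>\<^sub>v z) \<in> ?A"
      using subgroup_Zn_smult[OF lattice_part_subspace(1)[OF sV] e] .
    moreover have "\<beta> \<cdot>\<^sub>v z + \<alpha> \<cdot>\<^sub>v w \<in> carrier_vec n" using wc z(1) by simp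
    ultimately show ?thesis unfolding K_set_def w_def using bc by blast
  qed
  then show ?thesis using i(1) by (intro exI[of _ i]) auto
qed

lemma composition_layer:
  assumes cs: "composition_series n T V l" and i: "i < l"
  shows "subgroup (lattice_part n (V (i + 1))) (Zn n)" "subgroup (lattice_part n (V i)) (Zn n)"
    "\<phi> ` lattice_part n (V (i + 1)) \<subseteq> lattice_part n (V (i + 1))"
    "\<phi> ` lattice_part n (V i) \<subseteq> lattice_part n (V i)"
    "lattice_part n (V i) \<subset> lattice_part n (V (i + 1))"
    "c \<noteq> 0 \<Longrightarrow> a \<in> carrier_vec n \<Longrightarrow> c \<cdot>\<^sub>v a \<in> lattice_part n (V (i + 1)) \<Longrightarrow>
      a \<in> lattice_part n (V (i + 1))"
    "c \<noteq> 0 \<Longrightarrow> a \<in> carrier_vec n \<Longrightarrow> c \<cdot>\<^sub>v a \<in> lattice_part n (V i) \<Longrightarrow>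
      a \<in> lattice_part n (V i)"
proof -
  have inv: "invariant_subspace n T (V i)" "invariant_subspace n T (V (i + 1))" and VV: "V i \<subset> V (i + 1)"
    using cs i unfolding composition_series_def by auto
  then have sub: "VectorSpace.subspace class_ring (V i) (module_vec TYPE(rat) n)"
    "VectorSpace.subspace class_ring (V (i + 1)) (module_vec TYPE(rat) n)"
    by (simp_all add: invariant_subspace_def)
  note H = lattice_part_subspace[OF sub(2)] and N = lattice_part_subspace[OF sub(1)]
  show "subgroup (lattice_part n (V (i + 1))) (Zn n)" "subgroup (lattice_part n (V i)) (Zn n)"
    by (rule H(1), rule N(1))
  show "c \<noteq> 0 \<Longrightarrow> a \<in> carrier_vec n \<Longrightarrow> c \<cdot>\<^sub>v a \<in> lattice_part n (V (i + 1)) \<Longrightarrow>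
      a \<in> lattice_part n (V (i + 1))" by (rule H(2))
  show "c \<noteq> 0 \<Longrightarrow> a \<in> carrier_vec n \<Longrightarrow> c \<cdot>\<^sub>v a \<in> lattice_part n (V i) \<Longrightarrow>
      a \<in> lattice_part n (V i)" by (rule N(2))
  show "\<phi> ` lattice_part n (V (i + 1)) \<subseteq> lattice_part n (V (i + 1))"
    "\<phi> ` lattice_part n (V i) \<subseteq> lattice_part n (V i)"
    using lattice_part_invariant inv by blast+
  show "lattice_part n (V i) \<subset> lattice_part n (V (i + 1))" by (rule lattice_part_psubset[OF sub VV])
qed

lemma layer_char_poly_cong:
  assumes p: "prime p" and cs: "composition_series n T V l" and i: "i < l"
    and K: "lattice_part n (V (i + 1)) \<subseteq> K_set n \<phi> p (lattice_part n (V i))"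
  defines "Q \<equiv> quotient_group (Zn n) (lattice_part n (V (i + 1))) (lattice_part n (V i))"
  shows "poly_cong (endo_char_poly Q (quotient_endo (Zn n) (lattice_part n (V i)) \<phi>))
    (monom 1 (free_rank Q)) (int p)"
proof -
  let ?H = "lattice_part n (V (i + 1))" and ?N = "lattice_part n (V i)"
  note H = composition_layer(1,3,6)[OF cs i] and N = composition_layer(2,4,7)[OF cs i]
    and HN = composition_layer(5)[OF cs i]
  show ?thesis
  proof (rule quotient_of_Zn_representation[OF H(1) N(1) psubset_imp_subset[OF HN] N(3) hom H(2) N(2)])
    fix m M q
    assume M: "M \<in> carrier_mat m m" and q: "q ` ?H = carrier_vec m"
      "\<And>x y. x \<in> ?H \<Longrightarrow> y \<in> ?H \<Longrightarrow> q (x + y) = q x + q y"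
      "\<And>c x. x \<in> ?H \<Longrightarrow> q (c \<cdot>\<^sub>v x) = c \<cdot>\<^sub>v q x"
      "\<And>x. x \<in> ?H \<Longrightarrow> q x = 0\<^sub>v m \<longleftrightarrow> x \<in> ?N" "\<And>x. x \<in> ?H \<Longrightarrow> q (\<phi> x) = M *\<^sub>v q x"
      and eq: "free_rank (quotient_group (Zn n) ?H ?N) = m"
      "endo_char_poly (quotient_group (Zn n) ?H ?N) (quotient_endo (Zn n) ?N \<phi>) = char_poly M"
    show ?thesis
      unfolding Q_def eq
      by (rule char_poly_mod_of_K_set[OF hom p H(1,2) N(1) psubset_imp_subset[OF HN] H(3) M q K])
  qed
qed

lemma collapsing_of_layer:
  assumes cs: "composition_series n T V l" and i: "i < l"
  defines "Q \<equiv> quotient_group (Zn n) (lattice_part n (V (i + 1))) (lattice_part n (V i))"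
  assumes cong: "poly_cong (endo_char_poly Q (quotient_endo (Zn n) (lattice_part n (V i)) \<phi>))
    (monom 1 (free_rank Q)) (int p)"
  shows "\<exists>a\<in>collapsing n \<phi> p. a \<noteq> 0\<^sub>v n"
proof -
  let ?H = "lattice_part n (V (i + 1))" and ?N = "lattice_part n (V i)"
  note H = composition_layer(1,3,6)[OF cs i] and N = composition_layer(2,4,7)[OF cs i]
    and HN = composition_layer(5)[OF cs i]
  show ?thesis
  proof (rule quotient_of_Zn_representation[OF H(1) N(1) psubset_imp_subset[OF HN] N(3) hom H(2) N(2)])
    fix m M q
    assume M: "M \<in> carrier_mat m m" and q: "q ` ?H = carrier_vec m"
      "\<And>x y. x \<in> ?H \<Longrightarrow> y \<in> ?H \<Longrightarrow> q (x + y) = q x + q y"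
      "\<And>c x. x \<in> ?H \<Longrightarrow> q (c \<cdot>\<^sub>v x) = c \<cdot>\<^sub>v q x"
      "\<And>x. x \<in> ?H \<Longrightarrow> q x = 0\<^sub>v m \<longleftrightarrow> x \<in> ?N" "\<And>x. x \<in> ?H \<Longrightarrow> q (\<phi> x) = M *\<^sub>v q x"
      and eq: "free_rank (quotient_group (Zn n) ?H ?N) = m"
      "endo_char_poly (quotient_group (Zn n) ?H ?N) (quotient_endo (Zn n) ?N \<phi>) = char_poly M"
    show ?thesis
      by (rule collapsing_nontrivial[OF hom H(1,2) N(1) HN N(3) M equalityD1[OF q(1)] q(2-5)
            cong[unfolded Q_def eq]])
  qed
qed

end

theorem theorem5p17:
  fixes n l :: nat
    and \<phi> :: "int vec \<Rightarrow> int vec"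
    and V :: "nat \<Rightarrow> rat vec set"
    and A :: "nat \<Rightarrow> int vec set"
    and r :: "nat \<Rightarrow> nat"
    and f :: "nat \<Rightarrow> int poly"
  assumes "n \<ge> 1"
    and "\<phi> \<in> mon (Zn n) (Zn n)"
    and "composition_series n (rat_extension n \<phi>) V l"
  defines "A \<equiv> \<lambda>i. lattice_part n (V i)"
    and "r \<equiv> \<lambda>i. free_rank (quotient_group (Zn n) (A i) (A (i - 1)))"
    and "f \<equiv> \<lambda>i. endo_char_poly (quotient_group (Zn n) (A i) (A (i - 1)))
                     (quotient_endo (Zn n) (A (i - 1)) \<phi>)"
  shows "(cyclic_subgroup_separable (ascending_HNN (Zn n) \<phi>) \<longleftrightarrow>
           \<not> (\<exists>p i. prime p \<and> i < l \<and> A (i + 1) \<subseteq> K_set n \<phi> p (A i)))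
       \<and> (\<not> (\<exists>p i. prime p \<and> i < l \<and> A (i + 1) \<subseteq> K_set n \<phi> p (A i)) \<longleftrightarrow>
           \<not> (\<exists>p i. prime p \<and> 1 \<le> i \<and> i \<le> l \<and> poly_cong (f i) (monom 1 (r i)) (int p)))"
proof -
  interpret Zn_monomorphism n \<phi> using assms(2) by (simp add: Zn_monomorphism_def)
  \<comment> \<open>The negated conditions are compared: \<open>?C\<close>, the failure of cyclic
    subgroup separability, implies \<open>?K\<close>, which implies \<open>?F\<close>, which implies
    \<open>?C\<close>.\<close>
  let ?C = "\<exists>p. prime p \<and> (\<exists>a\<in>collapsing n \<phi> p. a \<noteq> 0\<^sub>v n)"
  let ?K = "\<exists>p i. prime p \<and> i < l \<and> A (i + 1) \<subseteq> K_set n \<phi> p (A i)"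
  let ?F = "\<exists>p i. prime p \<and> 1 \<le> i \<and> i \<le> l \<and> poly_cong (f i) (monom 1 (r i)) (int p)"
  have "cyclic_subgroup_separable (ascending_HNN (Zn n) \<phi>) \<longleftrightarrow> \<not> ?C"
    unfolding cyclic_subgroup_separable_hnn_iff by blast
  moreover have "?C \<Longrightarrow> ?K"
    using collapsing_layer[OF _ _ _ assms(3)] unfolding A_def by meson
  moreover have "?F" if K: ?K
  proof -
    obtain p i where pi: "prime p" "i < l" "A (i + 1) \<subseteq> K_set n \<phi> p (A i)" using K by blast
    \<comment> \<open>\<open>K_set\<close> numbers a layer by its lower end and \<open>f\<close> by
      its upper end, hence the shift by one.\<close>
    have "poly_cong (f (Suc i)) (monom 1 (r (Suc i))) (int p)"
      using layer_char_poly_cong[OF pi(1) assms(3) pi(2) pi(3)[unfolded A_def]]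
      unfolding f_def r_def A_def by simp
    then show ?F using pi(1,2) by (intro exI[of _ p] exI[of _ "Suc i"]) simp
  qed
  moreover have "?C" if F: ?F
  proof -
    obtain p i where pi: "prime p" "1 \<le> i" "i \<le> l" "poly_cong (f i) (monom 1 (r i)) (int p)" using F by blast
    then obtain j where j: "i = Suc j" "j < l" by (cases i) auto
    have "\<exists>a\<in>collapsing n \<phi> p. a \<noteq> 0\<^sub>v n"
      by (rule collapsing_of_layer[OF assms(3) j(2)])
        (use pi(4) in \<open>simp add: j(1) f_def r_def A_def\<close>)
    then show ?C using pi(1) by blast
  qed
  ultimately show ?thesis by argo
qed

end
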